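(* Let $S$ be a measurable subset of $(0,\infty)$ and let $\alpha>-1/2$. If a separated set $\Lambda=\{t_n\}_{n=0}^{\infty}\subset(0,\infty)$ is a set of sampling for $\mathcal{B}_\alpha(S)$, then $$D^{-}(\Lambda)\ \geq\ \frac{1}{\pi}\,m(S),$$ where $m(S)$ denotes the Lebesgue measure of $S$.
   Context: $J_\alpha$ is the Bessel function of the first kind of order $\alpha$. The Hankel transform is $H_\alpha(f)(x)=\int_0^\infty f(t)(xt)^{1/2}J_\alpha(xt)\,dt$, extended to a unitary involution of $L^2(0,\infty)$. $\mathcal{B}_\alpha(S)$ is the space of $f\in L^2(0,\infty)$ whose Hankel transform is supported in $S$ (i.e. vanishes a.e. outside $S$). Point values: if $f\in\mathcal{B}_\alpha(S)$ and $H_\alpha f$ is integrable (which holds for all $f\in\mathcal{B}_\alpha(S)$ when $m(S)<\infty$), $f(t)$ denotes the value at $t$ of the continuous representative $f(t)=\int_S H_\alpha f(x)(tx)^{1/2}J_\alpha(tx)\,dx$. $\Lambda=\{t_n\}_{n=0}^\infty$ is a set of sampling for $\mathcal{B}_\alpha(S)$ if there is a constant $A>0$ such that $A\int_0^\infty|f(x)|^2dx\le\sum_{n=0}^\infty|f(t_n)|^2$ for every $f\in\mathcal{B}_\alpha(S)$ (when $m(S)=\infty$, for those $f$ with $H_\alpha f$ integrable, so that point values make sense). $\Lambda$ is separated if the distance between any two distinct points of it exceeds some fixed $d>0$; the $t_n$ are pairwise distinct. For $a\ge0$, $r>0$, let $n_a(r)$ be the number of points of $\Lambda$ in $[a,a+r]$.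 The lower density is $D^-(\Lambda)=\liminf_{r\to\infty}\ \inf_{a\ge0}\frac{n_a(r)}{r}$. *)

theory Defs
  imports "HOL-Analysis.Analysis"
begin

text \<open>Intended for \<^term>\<open>x > (0::real)\<close> only: \<^term>\<open>(x / 2) powr a\<close> is the power
  of a positive base.\<close>

definition bessel_J :: "real \<Rightarrow> real \<Rightarrow> real" where
  "bessel_J \<alpha> x =
     (\<Sum>k. (-1) ^ k / (fact k * Gamma (real k + \<alpha> + 1)) * (x / 2) powr (2 * real k + \<alpha>))"

definition hankel_kernel :: "real \<Rightarrow> real \<Rightarrow> real \<Rightarrow> real" where
  "hankel_kernel \<alpha> x t = sqrt (x * t) * bessel_J \<alpha> (x * t)"

abbreviation half_line :: "real measure" where
  "half_line \<equiv> lebesgue_on {0<..}"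

definition square_integrable :: "(real \<Rightarrow> complex) \<Rightarrow> bool" where
  "square_integrable f \<longleftrightarrow>
     f \<in> borel_measurable half_line \<and> integrable half_line (\<lambda>x. (norm (f x))\<^sup>2)"

definition L2_sqnorm :: "(real \<Rightarrow> complex) \<Rightarrow> ennreal" where
  "L2_sqnorm f = (\<integral>\<^sup>+ x. ennreal ((norm (f x))\<^sup>2) \<partial>half_line)"

definition hankel_integral :: "real \<Rightarrow> (real \<Rightarrow> complex) \<Rightarrow> real \<Rightarrow> complex" where
  "hankel_integral \<alpha> f x = (LINT t|half_line. f t * complex_of_real (hankel_kernel \<alpha> x t))"

text \<open>The extension of the integral transform by continuity from the dense subspace of functions
  that are both integrable and square integrable (for \<^term>\<open>\<alpha> > -1/2\<close> the kernel is bounded,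
  so the integral converges there).  It is a relation because the transform is
  determined only up to null sets.\<close>

definition has_hankel_transform ::
    "real \<Rightarrow> (real \<Rightarrow> complex) \<Rightarrow> (real \<Rightarrow> complex) \<Rightarrow> bool" where
  "has_hankel_transform \<alpha> f g \<longleftrightarrow>
     square_integrable f \<and> square_integrable g \<and>
     (\<exists>F :: nat \<Rightarrow> real \<Rightarrow> complex.
        (\<forall>n. integrable half_line (F n) \<and> square_integrable (F n)) \<and>
        (\<lambda>n. L2_sqnorm (\<lambda>x. F n x - f x)) \<longlonglongrightarrow> 0 \<and>
        (\<lambda>n. L2_sqnorm (\<lambda>x. hankel_integral \<alpha> (F n) x - g x)) \<longlonglongrightarrow> 0)"

definition bandlimited :: "real \<Rightarrow> real set \<Rightarrow> (real \<Rightarrow> complex) set" where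
  "bandlimited \<alpha> S =
     {f. \<exists>g. has_hankel_transform \<alpha> f g \<and> (AE x in half_line. x \<notin> S \<longrightarrow> g x = 0)}"

text \<open>The value at \<open>t\<close> of the continuous representative of the function in
  \<^term>\<open>bandlimited \<alpha> S\<close> whose Hankel transform is the integrable function \<open>g\<close>.\<close>

definition point_value :: "real \<Rightarrow> real set \<Rightarrow> (real \<Rightarrow> complex) \<Rightarrow> real \<Rightarrow> complex" where
  "point_value \<alpha> S g t = (LINT x|lebesgue_on S. g x * complex_of_real (hankel_kernel \<alpha> t x))"

text \<open>The integrability condition on \<open>g\<close> is automatic when \<open>S\<close> has finite measure, see
  \<open>integrable_of_finite_measure\<close> below.  The inequality is stated in \<^typ>\<open>ennreal\<close>,
  so a divergent sum counts as infinite.\<close>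

definition set_of_sampling :: "real \<Rightarrow> real set \<Rightarrow> (nat \<Rightarrow> real) \<Rightarrow> bool" where
  "set_of_sampling \<alpha> S t \<longleftrightarrow>
     (\<exists>A>0. \<forall>f\<in>bandlimited \<alpha> S. \<forall>g.
        has_hankel_transform \<alpha> f g \<longrightarrow> integrable half_line g \<longrightarrow>
        ennreal A * L2_sqnorm f \<le> (\<Sum>n. ennreal ((norm (point_value \<alpha> S g (t n)))\<^sup>2)))"

lemma integrable_of_finite_measure:
  assumes "S \<in> sets lebesgue" "S \<subseteq> {0<..}" "emeasure lebesgue S < \<infinity>"
    and "square_integrable g" "AE x in half_line. x \<notin> S \<longrightarrow> g x = 0"
  shows "integrable half_line g"
proof (rule Bochner_Integration.integrable_bound)
  have S: "S \<in> sets half_line"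
    using assms(1,2) by (simp add: sets_restrict_space_iff)
  have "emeasure half_line S < \<infinity>"
    using assms(2,3) by (simp add: emeasure_restrict_space)
  with S have "integrable half_line (indicator S :: real \<Rightarrow> real)"
    using assms(2) by (simp add: integrable_indicator_iff Int_absorb2)
  then show "integrable half_line (\<lambda>x. indicator S x + (norm (g x))\<^sup>2 :: real)"
    using assms(4) by (simp add: square_integrable_def)
  show "g \<in> borel_measurable half_line"
    using assms(4) by (simp add: square_integrable_def)
  have le: "norm (g x) \<le> 1 + (norm (g x))\<^sup>2" for x
    using sum_squares_bound[of 1 "norm (g x)"] norm_ge_zero[of "g x"]
    by (simp only: power_one mult_1_right)
  show "AE x in half_line. norm (g x) \<le> norm (indicator S x + (norm (g x))\<^sup>2 :: real)"
    using assms(5) by eventually_elim (use le in \<open>auto simp: indicator_def\<close>)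
qed

text \<open>\<^const>\<open>card\<close> is the right count for sets that meet every bounded interval in a finite
  set, in particular for separated ones.\<close>

definition lower_density :: "real set \<Rightarrow> ennreal" where
  "lower_density \<Lambda> =
     Liminf at_top (\<lambda>r::real. INF a\<in>{0..}. ennreal (real (card (\<Lambda> \<inter> {a..a + r})) / r))"

end

theory Submission
  imports Defs
begin

text \<open>Proof idea. Write \<open>k z = sqrt z * J \<alpha> z\<close> and \<open>k\<^sub>y x = k (y * x)\<close>, so that \<open>\<langle>u, k\<^sub>y\<rangle>\<close>, the inner product in
  \<open>L\<^sup>2(S)\<close>, is the value at \<open>y\<close> of the function whose Hankel transform is \<open>u\<close>. One may assume that \<open>S\<close> is a Borel
  subset of some \<open>[\<epsilon>, R]\<close> with \<open>\<epsilon> > 0\<close>. For \<open>I = [a, a + r]\<close> let \<open>J\<close> be the set of indices of the sampling points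
  within distance \<open>\<delta>\<close> of \<open>I\<close>. By the sampling inequality, a function that vanishes at the points of \<open>J\<close> is controlled
  by its samples outside \<open>J\<close>, and for \<open>k\<^sub>y\<close> with \<open>y \<in> I\<close> these have a small sum of squares when \<open>\<delta>\<close> is
  large. Hence all \<open>k\<^sub>y\<close> with \<open>y \<in> I\<close> lie close to one space \<open>W\<close> of dimension at most \<open>card J\<close>. Integrating
  \<open>\<parallel>P\<^sub>W k\<^sub>y\<parallel>\<^sup>2\<close> over all \<open>y > 0\<close> gives \<open>dim W\<close>, because the Hankel transform is isometric, whereas
  the integral of \<open>\<parallel>k\<^sub>y\<parallel>\<^sup>2\<close> over \<open>I\<close> is \<open>r * m(S) * L\<close> up to a bounded error, where \<open>L\<close> is the mean value of
  \<open>k\<^sup>2\<close>. Thus \<open>card J \<ge> r * m(S) * L - o(r)\<close>.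

  That \<open>L \<ge> 1 / \<pi>\<close> follows from the same trace comparison on \<open>(0, 1]\<close>: the functions \<open>k\<^sub>j\<close> at the zeros \<open>j\<close>
  of \<open>k\<close> are orthogonal, and by Sturm comparison the zeros have density at least \<open>1 / \<pi>\<close>.
  The isometry of the Hankel transform is checked on the functions \<open>x powr (\<alpha> + 1/2) * exp (- p * x\<^sup>2 / 2)\<close>, which the
  transform permutes up to factors, and extended by density.\<close>

section \<open>The Bessel function and its derivatives\<close>

text \<open>The obstacle is a general \<open>S\<close>. For an interval, Lommel's closed form makes
  the inner product of \<open>k\<^sub>y\<close> and \<open>k\<^sub>s\<close> decay like
  \<open>1 / \<bar>s - y\<bar>\<close>; for a Borel set no such rate is at hand. What survives is
  that the squares of the far samples have a small sum, uniformly in \<open>y\<close>: this passes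
  to complements and disjoint unions, and the Plancherel-Polya inequality, whose constant is common
  to all Borel subsets of \<open>(0, R]\<close>, absorbs a remainder of small measure. The cut at
  \<open>\<epsilon>\<close> keeps the trace error bounded: the integral of \<open>k\<^sup>2\<close>
  over \<open>x * I\<close> is \<open>L * r * x\<close> up to a constant, and this is divided by
  \<open>x\<close>. The constant \<open>L\<close> is never evaluated. It comes from a
  conserved-energy argument, and only its lower bound enters, so no asymptotic expansion of the
  Bessel function is used. The vectors are bounded continuous real functions, on which integration
  over \<open>S\<close> is merely a semidefinite form. All projections are onto spans of finite
  sets, so neither a quotient space nor completeness enters.\<close>

definition bessel_coeff :: "real \<Rightarrow> nat \<Rightarrow> real" where
  "bessel_coeff \<alpha> k = (-1) ^ k / (fact k * Gamma (real k + \<alpha> + 1) * 2 powr (2 * real k + \<alpha>))"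

text \<open>The entire function with \<open>J \<alpha> z = z powr \<alpha> * bessel_entire \<alpha>
  (z\<^sup>2)\<close>. Splitting off the real power leaves a power series, which can be
  differentiated termwise.\<close>

definition bessel_entire :: "real \<Rightarrow> real \<Rightarrow> real" where
  "bessel_entire \<alpha> w = (\<Sum>k. bessel_coeff \<alpha> k * w ^ k)"

text \<open>The kernel as a function of the product of its two arguments. The value \<open>0\<close>
  on the nonpositive axis keeps it continuous on the whole line when \<open>\<alpha> > -1/2\<close>
  and lets integrals over the half line be taken over \<open>lborel\<close>.\<close>

definition sqrt_bessel :: "real \<Rightarrow> real \<Rightarrow> real" where
  "sqrt_bessel \<alpha> z = (if z > 0 then sqrt z * bessel_J \<alpha> z else 0)"

lemma bessel_coeff_Suc:
  assumes "\<alpha> > -1"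
  shows "bessel_coeff \<alpha> (Suc k) = - bessel_coeff \<alpha> k / (4 * (real k + 1) * (real k + \<alpha> + 1))"
proof -
  have "real k + \<alpha> + 1 > 0" using assms by linarith
  then have "Gamma (real k + \<alpha> + 1 + 1) = (real k + \<alpha> + 1) * Gamma (real k + \<alpha> + 1)"
    by (intro Gamma_plus1) (auto elim!: nonpos_Ints_cases)
  then have G: "Gamma (real (Suc k) + \<alpha> + 1) = (real k + \<alpha> + 1) * Gamma (real k + \<alpha> + 1)"
    by (simp add: add_ac)
  have P: "2 powr (2 * real (Suc k) + \<alpha>) = 4 * 2 powr (2 * real k + \<alpha>)"
  proof -
    have "2 * real (Suc k) + \<alpha> = 2 + (2 * real k + \<alpha>)" by simp
    then show ?thesis by (simp only: powr_add) simp
  qed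
  show ?thesis unfolding bessel_coeff_def G P by (simp add: field_simps)
qed

lemma bessel_coeff_shift:
  assumes "\<alpha> > -1"
  shows "bessel_coeff \<alpha> k = 2 * (real k + \<alpha> + 1) * bessel_coeff (\<alpha> + 1) k"
proof -
  have pos: "real k + \<alpha> + 1 > 0" using assms by linarith
  then have "Gamma (real k + \<alpha> + 1 + 1) = (real k + \<alpha> + 1) * Gamma (real k + \<alpha> + 1)"
    by (intro Gamma_plus1) (auto elim!: nonpos_Ints_cases)
  then have G: "Gamma (real k + (\<alpha> + 1) + 1) = (real k + \<alpha> + 1) * Gamma (real k + \<alpha> + 1)"
    by (simp add: add_ac)
  have P: "2 powr (2 * real k + (\<alpha> + 1)) = 2 * 2 powr (2 * real k + \<alpha>)"
    using powr_add[of 2 "2 * real k + \<alpha>" 1] by (simp add: add_ac)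
  have c: "x / (f * g * p) = 2 * c * (x / (f * (c * g) * (2 * p)))" if "c \<noteq> 0" for x f g p c :: real
    using that by simp
  show ?thesis unfolding bessel_coeff_def G P by (rule c) (use pos in simp)
qed

lemma summable_bessel_entire:
  assumes "\<alpha> > -1"
  shows "summable (\<lambda>k. bessel_coeff \<alpha> k * w ^ k)"
proof -
  obtain N :: nat where N: "real N \<ge> \<bar>w\<bar> + \<bar>\<alpha>\<bar> + 1"
    using real_arch_simple by blast
  show ?thesis
  proof (rule summable_ratio_test[of "1/2" N])
    fix n assume n: "n \<ge> N"
    have "real n \<ge> \<bar>w\<bar> + \<bar>\<alpha>\<bar> + 1" using n N by linarith
    then have p1: "real n + 1 \<ge> 1" "real n + \<alpha> + 1 \<ge> \<bar>w\<bar> + 1" by linarith+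
    have "(\<bar>w\<bar> + 1) * 1 \<le> (real n + \<alpha> + 1) * (real n + 1)"
      by (intro mult_mono) (use p1 in auto)
    then have le: "2 * \<bar>w\<bar> \<le> 4 * (real n + 1) * (real n + \<alpha> + 1)"
      by (simp add: algebra_simps)
    have D: "4 * (real n + 1) * (real n + \<alpha> + 1) > 0" using p1 by (intro mult_pos_pos) auto
    have "norm (bessel_coeff \<alpha> (Suc n) * w ^ Suc n)
        = \<bar>w\<bar> / (4 * (real n + 1) * (real n + \<alpha> + 1)) * norm (bessel_coeff \<alpha> n * w ^ n)"
      unfolding bessel_coeff_Suc[OF assms] using D p1 by (simp add: abs_mult abs_divide)
    also have "\<dots> \<le> 1/2 * norm (bessel_coeff \<alpha> n * w ^ n)"
      using le D by (intro mult_right_mono) (auto simp: pos_divide_le_eq)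
    finally show "norm (bessel_coeff \<alpha> (Suc n) * w ^ Suc n) \<le> 1/2 * norm (bessel_coeff \<alpha> n * w ^ n)" .
  qed simp
qed

text \<open>In the variable \<open>w = z\<^sup>2\<close> this is the classical rule that the
  derivative of \<open>J \<alpha> z / z powr \<alpha>\<close> is
  \<open>- J (\<alpha> + 1) z / z powr \<alpha>\<close>.\<close>

lemma DERIV_bessel_entire:
  assumes "\<alpha> > -1"
  shows "(bessel_entire \<alpha> has_real_derivative - bessel_entire (\<alpha> + 1) w / 2) (at w)"
proof -
  have eq: "diffs (bessel_coeff \<alpha>) k = - (1/2) * bessel_coeff (\<alpha> + 1) k" for k
  proof -
    have "real k + \<alpha> + 1 > 0" using assms by linarith
    then show ?thesis
      unfolding diffs_def bessel_coeff_Suc[OF assms] bessel_coeff_shift[OF assms, of k]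
      by (simp add: divide_simps) (simp add: algebra_simps)
  qed
  have "((\<lambda>w. \<Sum>k. bessel_coeff \<alpha> k * w ^ k) has_real_derivative
          (\<Sum>k. diffs (bessel_coeff \<alpha>) k * w ^ k)) (at w)"
    by (rule termdiffs_strong[of _ "\<bar>w\<bar> + 1"]) (use summable_bessel_entire[OF assms] in auto)
  also have "(\<Sum>k. diffs (bessel_coeff \<alpha>) k * w ^ k)
      = (\<Sum>k. - (1/2) * (bessel_coeff (\<alpha> + 1) k * w ^ k))"
    by (simp only: eq mult.assoc)
  also have "\<dots> = - (1/2) * bessel_entire (\<alpha> + 1) w"
    unfolding bessel_entire_def using assms
    by (intro suminf_mult summable_bessel_entire) auto
  finally show ?thesis by (simp add: bessel_entire_def[abs_def])
qed

text \<open>The three-term recurrence \<open>J \<alpha> + J (\<alpha> + 2) = 2 * (\<alpha> + 1) / z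
  * J (\<alpha> + 1)\<close> in the variable \<open>w = z\<^sup>2\<close>. In
  \<open>bessel_coeff_shift\<close> the factor \<open>k + \<alpha> + 1\<close> splits: its part
  \<open>k\<close> amounts to \<open>w\<close> times the derivative of the series of order
  \<open>\<alpha> + 1\<close>.\<close>

lemma bessel_entire_shift:
  assumes "\<alpha> > -1"
  shows "bessel_entire \<alpha> w = 2 * (\<alpha> + 1) * bessel_entire (\<alpha> + 1) w - w * bessel_entire (\<alpha> + 2) w"
proof -
  have a1: "\<alpha> + 1 > -1" using assms by simp
  have "(\<lambda>k. diffs (bessel_coeff (\<alpha> + 1)) k * w ^ k) sums (- (1/2) * bessel_entire (\<alpha> + 2) w)"
  proof -
    have eq: "diffs (bessel_coeff (\<alpha> + 1)) k = - (1/2) * bessel_coeff (\<alpha> + 2) k" for k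
    proof -
      have "real k + \<alpha> + 2 > 0" using assms by linarith
      moreover have "\<alpha> + 1 + 1 = \<alpha> + 2" "real k + (\<alpha> + 1) + 1 = real k + \<alpha> + 2" by auto
      ultimately show ?thesis
        unfolding diffs_def bessel_coeff_Suc[OF a1] bessel_coeff_shift[OF a1, of k]
        by (simp add: divide_simps) (simp add: algebra_simps)
    qed
    have "(\<lambda>k. bessel_coeff (\<alpha> + 2) k * w ^ k) sums bessel_entire (\<alpha> + 2) w"
      unfolding bessel_entire_def using assms
      by (intro summable_sums summable_bessel_entire) auto
    from sums_mult[OF this, of "-(1/2)"] show ?thesis
      by (simp only: eq mult.assoc)
  qed
  from sums_mult[OF this, of w]
  have "(\<lambda>k. real (Suc k) * bessel_coeff (\<alpha> + 1) (Suc k) * w ^ Suc k) sums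
     (- w / 2 * bessel_entire (\<alpha> + 2) w)"
    by (simp add: diffs_def mult_ac del: of_nat_Suc)
  then have s1: "(\<lambda>k. real k * bessel_coeff (\<alpha> + 1) k * w ^ k) sums (- w / 2 * bessel_entire (\<alpha> + 2) w)"
    by (subst (asm) sums_Suc_iff) simp
  have s2: "(\<lambda>k. bessel_coeff (\<alpha> + 1) k * w ^ k) sums bessel_entire (\<alpha> + 1) w"
    unfolding bessel_entire_def using a1 by (intro summable_sums summable_bessel_entire)
  have "(\<lambda>k. 2 * (\<alpha> + 1) * (bessel_coeff (\<alpha> + 1) k * w ^ k) + 2 * (real k * bessel_coeff (\<alpha> + 1) k * w ^ k))
     sums (2 * (\<alpha> + 1) * bessel_entire (\<alpha> + 1) w + 2 * (- w / 2 * bessel_entire (\<alpha> + 2) w))"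
    by (intro sums_add sums_mult s1 s2)
  moreover have "2 * (\<alpha> + 1) * (bessel_coeff (\<alpha> + 1) k * w ^ k) + 2 * (real k * bessel_coeff (\<alpha> + 1) k * w ^ k)
      = bessel_coeff \<alpha> k * w ^ k" for k
    unfolding bessel_coeff_shift[OF assms, of k] by (simp add: algebra_simps)
  ultimately have "(\<lambda>k. bessel_coeff \<alpha> k * w ^ k) sums
     (2 * (\<alpha> + 1) * bessel_entire (\<alpha> + 1) w + 2 * (- w / 2 * bessel_entire (\<alpha> + 2) w))"
    by (simp only:)
  then show ?thesis unfolding bessel_entire_def[of \<alpha>] by (simp add: sums_iff)
qed

lemma sqrt_bessel_nonpos [simp]: "z \<le> 0 \<Longrightarrow> sqrt_bessel \<alpha> z = 0"
  by (simp add: sqrt_bessel_def)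

lemma sqrt_bessel_eq:
  assumes "\<alpha> > -1" "z > 0"
  shows "sqrt_bessel \<alpha> z = z powr (\<alpha> + 1/2) * bessel_entire \<alpha> (z\<^sup>2)"
proof -
  have t: "(-1) ^ k / (fact k * Gamma (real k + \<alpha> + 1)) * (z / 2) powr (2 * real k + \<alpha>)
     = z powr \<alpha> * (bessel_coeff \<alpha> k * (z\<^sup>2) ^ k)" for k
  proof -
    have "(z / 2) powr (2 * real k + \<alpha>) = z powr (2 * real k) * z powr \<alpha> / 2 powr (2 * real k + \<alpha>)"
      using assms by (simp add: powr_divide powr_add)
    moreover have "z powr (2 * real k) = (z\<^sup>2) ^ k"
      using assms powr_realpow[of z "2 * k"] by (simp add: power_mult)
    ultimately show ?thesis by (simp add: bessel_coeff_def)
  qed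
  have "bessel_J \<alpha> z = z powr \<alpha> * bessel_entire \<alpha> (z\<^sup>2)"
    unfolding bessel_J_def t bessel_entire_def
    by (rule suminf_mult[OF summable_bessel_entire]) fact
  moreover have "sqrt z * z powr \<alpha> = z powr (\<alpha> + 1/2)"
    using assms by (simp add: powr_half_sqrt[symmetric] powr_add)
  ultimately show ?thesis using assms by (simp add: sqrt_bessel_def mult.assoc[symmetric])
qed

text \<open>Together with \<open>DERIV_sqrt_bessel_Suc\<close> this is a closed first-order linear
  system for the orders \<open>\<alpha>\<close> and \<open>\<alpha> + 1\<close>. The energy, the
  primitive of the square, Lommel's integral and the Sturm comparison all rest on it.\<close>

lemma DERIV_sqrt_bessel:
  assumes "\<alpha> > -1" "z > 0"
  shows "(sqrt_bessel \<alpha> has_real_derivative (\<alpha> + 1/2) * sqrt_bessel \<alpha> z / z - sqrt_bessel (\<alpha> + 1) z) (at z)"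
proof -
  have d: "((\<lambda>z. z powr (\<alpha> + 1/2) * bessel_entire \<alpha> (z\<^sup>2)) has_real_derivative
     ((\<alpha> + 1/2) * z powr (\<alpha> + 1/2 - 1)) * bessel_entire \<alpha> (z\<^sup>2)
      + (- bessel_entire (\<alpha> + 1) (z\<^sup>2) / 2 * (2 * z)) * z powr (\<alpha> + 1/2)) (at z)"
    using assms
    by (intro DERIV_mult DERIV_chain2[OF DERIV_bessel_entire] has_real_derivative_powr)
       (auto intro!: derivative_eq_intros)
  have p: "z powr (\<alpha> + 1/2 - 1) = z powr (\<alpha> + 1/2) / z"
    using assms powr_diff[of z "\<alpha> + 1/2" 1] by simp
  have q: "z powr (\<alpha> + 1 + 1/2) = z powr (\<alpha> + 1/2) * z"
    using assms powr_add[of z "\<alpha> + 1/2" 1] by (simp add: add_ac)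
  have "((\<alpha> + 1/2) * z powr (\<alpha> + 1/2 - 1)) * bessel_entire \<alpha> (z\<^sup>2)
      + (- bessel_entire (\<alpha> + 1) (z\<^sup>2) / 2 * (2 * z)) * z powr (\<alpha> + 1/2)
      = (\<alpha> + 1/2) * sqrt_bessel \<alpha> z / z - sqrt_bessel (\<alpha> + 1) z"
  proof -
    have "sqrt_bessel \<alpha> z = z powr (\<alpha> + 1/2) * bessel_entire \<alpha> (z\<^sup>2)"
      using assms by (rule sqrt_bessel_eq)
    moreover have "sqrt_bessel (\<alpha> + 1) z = z powr (\<alpha> + 1/2) * z * bessel_entire (\<alpha> + 1) (z\<^sup>2)"
      using assms sqrt_bessel_eq[of "\<alpha> + 1" z, unfolded q] by simp
    ultimately show ?thesis unfolding p by simp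
  qed
  with d have "((\<lambda>z. z powr (\<alpha> + 1/2) * bessel_entire \<alpha> (z\<^sup>2)) has_real_derivative
      (\<alpha> + 1/2) * sqrt_bessel \<alpha> z / z - sqrt_bessel (\<alpha> + 1) z) (at z)" by simp
  then show ?thesis
    by (rule has_field_derivative_transform_within_open[of _ _ _ "{0<..}"])
       (use assms in \<open>auto simp: sqrt_bessel_eq\<close>)
qed

text \<open>The derivative formula at order \<open>\<alpha> + 1\<close> involves order
  \<open>\<alpha> + 2\<close>, which the three-term recurrence eliminates.\<close>

lemma DERIV_sqrt_bessel_Suc:
  assumes "\<alpha> > -1" "z > 0"
  shows "(sqrt_bessel (\<alpha> + 1) has_real_derivative sqrt_bessel \<alpha> z - (\<alpha> + 1/2) * sqrt_bessel (\<alpha> + 1) z / z) (at z)"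
proof -
  have q: "z powr (\<alpha> + 1 + 1/2) = z powr (\<alpha> + 1/2) * z"
    "z powr (\<alpha> + 2 + 1/2) = z powr (\<alpha> + 1/2) * z * z"
    using assms powr_add[of z "\<alpha> + 1/2" 1] powr_add[of z "\<alpha> + 1/2" 2]
    by (simp_all add: add_ac power2_eq_square)
  have h: "sqrt_bessel \<alpha> z = z powr (\<alpha> + 1/2) * bessel_entire \<alpha> (z\<^sup>2)"
    "sqrt_bessel (\<alpha> + 1) z = z powr (\<alpha> + 1/2) * z * bessel_entire (\<alpha> + 1) (z\<^sup>2)"
    "sqrt_bessel (\<alpha> + 2) z = z powr (\<alpha> + 1/2) * z * z * bessel_entire (\<alpha> + 2) (z\<^sup>2)"
    using assms sqrt_bessel_eq[of \<alpha> z] sqrt_bessel_eq[of "\<alpha> + 1" z, unfolded q] sqrt_bessel_eq[of "\<alpha> + 2" z, unfolded q]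
    by auto
  have "sqrt_bessel \<alpha> z = 2 * (\<alpha> + 1) * sqrt_bessel (\<alpha> + 1) z / z - sqrt_bessel (\<alpha> + 2) z"
    unfolding h bessel_entire_shift[OF assms(1), of "z\<^sup>2"]
    using assms(2) by (simp add: power2_eq_square) (simp add: algebra_simps)
  moreover have "(\<alpha> + 1 + 1/2) * sqrt_bessel (\<alpha> + 1) z / z
      = 2 * (\<alpha> + 1) * sqrt_bessel (\<alpha> + 1) z / z - (\<alpha> + 1/2) * sqrt_bessel (\<alpha> + 1) z / z"
    by (simp add: diff_divide_distrib[symmetric] algebra_simps)
  moreover have "sqrt_bessel (\<alpha> + 1 + 1) z = sqrt_bessel (\<alpha> + 2) z" by (simp add: add.assoc)
  ultimately have "(\<alpha> + 1 + 1/2) * sqrt_bessel (\<alpha> + 1) z / z - sqrt_bessel (\<alpha> + 1 + 1) z = sqrt_bessel \<alpha> z - (\<alpha> + 1/2) * sqrt_bessel (\<alpha> + 1) z / z"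
    by linarith
  then show ?thesis using DERIV_sqrt_bessel[of "\<alpha> + 1" z] assms by simp
qed

section \<open>Bounds and mean square of the kernel, Lommel's integral\<close>

text \<open>The exponent \<open>\<alpha> + 1/2\<close> is positive, so the power tends to
  \<open>0\<close> at the origin; writing \<open>max z 0\<close> for \<open>z\<close> covers the
  whole line by one formula.\<close>

lemma continuous_on_sqrt_bessel:
  assumes "\<alpha> > -1/2"
  shows "continuous_on S (sqrt_bessel \<alpha>)"
proof -
  have "isCont (bessel_entire \<alpha>) w" for w
    by (rule DERIV_isCont[OF DERIV_bessel_entire]) (use assms in simp)
  then have "continuous_on UNIV (bessel_entire \<alpha>)"
    by (simp add: continuous_at_imp_continuous_on)
  then have "continuous_on UNIV (\<lambda>z::real. bessel_entire \<alpha> ((max z 0)\<^sup>2))"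
    by (rule continuous_on_compose2) (auto intro!: continuous_intros)
  moreover have "continuous_on UNIV (\<lambda>z::real. (max z 0) powr (\<alpha> + 1/2))"
    using assms by (intro continuous_on_powr' continuous_intros) auto
  ultimately have "continuous_on UNIV (\<lambda>z. (max z 0) powr (\<alpha> + 1/2) * bessel_entire \<alpha> ((max z 0)\<^sup>2))"
    by (intro continuous_on_mult)
  also have "(\<lambda>z. (max z 0) powr (\<alpha> + 1/2) * bessel_entire \<alpha> ((max z 0)\<^sup>2)) = sqrt_bessel \<alpha>"
    using assms by (auto simp: fun_eq_iff sqrt_bessel_eq max_def)
  finally show ?thesis by (rule continuous_on_subset) simp
qed

lemma continuous_on_sqrt_bessel_mult:
  assumes "\<alpha> > -1/2"
  shows "continuous_on S (\<lambda>x. sqrt_bessel \<alpha> (c * x))"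
  by (rule continuous_on_compose2[OF continuous_on_sqrt_bessel[OF assms, of UNIV]])
     (auto intro!: continuous_intros)

lemma sqrt_bessel_borel_measurable [measurable]:
  assumes "\<alpha> > -1/2"
  shows "sqrt_bessel \<alpha> \<in> borel_measurable borel"
  by (intro borel_measurable_continuous_onI continuous_on_sqrt_bessel assms)

text \<open>The derivative of \<open>k\<^sup>2 + l\<^sup>2\<close> is
  \<open>(2 * \<alpha> + 1) * (k\<^sup>2 - l\<^sup>2) / z\<close>, which is not integrable at
  infinity by size alone. Since \<open>k * l\<close> has derivative
  \<open>k\<^sup>2 - l\<^sup>2\<close>, the third term cancels it and leaves a derivative of order
  \<open>1 / z\<^sup>2\<close>.\<close>

definition sqrt_bessel_energy :: "real \<Rightarrow> real \<Rightarrow> real" where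
  "sqrt_bessel_energy \<alpha> z = (sqrt_bessel \<alpha> z)\<^sup>2 + (sqrt_bessel (\<alpha> + 1) z)\<^sup>2 - (2 * \<alpha> + 1) * sqrt_bessel \<alpha> z * sqrt_bessel (\<alpha> + 1) z / z"

lemma DERIV_sqrt_bessel_energy:
  assumes "\<alpha> > -1" "z > 0"
  shows "(sqrt_bessel_energy \<alpha> has_real_derivative (2 * \<alpha> + 1) * sqrt_bessel \<alpha> z * sqrt_bessel (\<alpha> + 1) z / z\<^sup>2) (at z)"
proof -
  have z: "z \<noteq> 0" using assms by simp
  define k l where "k = sqrt_bessel \<alpha> z" and "l = sqrt_bessel (\<alpha> + 1) z"
  have "(sqrt_bessel_energy \<alpha> has_real_derivative 2 * k * ((\<alpha> + 1/2) * k / z - l) + 2 * l * (k - (\<alpha> + 1/2) * l / z)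
     - (2 * \<alpha> + 1) * ((((\<alpha> + 1/2) * k / z - l) * l + k * (k - (\<alpha> + 1/2) * l / z)) * z - k * l) / z\<^sup>2) (at z)"
    unfolding sqrt_bessel_energy_def[abs_def] k_def l_def
    by (rule DERIV_sqrt_bessel[OF assms] DERIV_sqrt_bessel_Suc[OF assms] derivative_eq_intros z refl)+
       (simp add: power2_eq_square algebra_simps)
  moreover have "2 * k * ((\<alpha> + 1/2) * k / z - l) + 2 * l * (k - (\<alpha> + 1/2) * l / z)
     - (2 * \<alpha> + 1) * ((((\<alpha> + 1/2) * k / z - l) * l + k * (k - (\<alpha> + 1/2) * l / z)) * z - k * l) / z\<^sup>2
     = (2 * \<alpha> + 1) * k * l / z\<^sup>2"
    using z by (simp add: divide_simps power2_eq_square) (simp add: algebra_simps)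
  ultimately show ?thesis by (simp only: k_def l_def)
qed

text \<open>For such \<open>z\<close> the factor \<open>(2 * \<alpha> + 1) / z\<close> is at most
  \<open>1\<close>, so the cross term is at most \<open>\<bar>k * l\<bar>\<close>, hence at most
  half of \<open>k\<^sup>2 + l\<^sup>2\<close>.\<close>

lemma sqrt_bessel_energy_bounds:
  assumes "\<alpha> > -1/2" "z \<ge> 2 * \<alpha> + 2"
  shows "(sqrt_bessel \<alpha> z)\<^sup>2 + (sqrt_bessel (\<alpha> + 1) z)\<^sup>2 \<le> 2 * sqrt_bessel_energy \<alpha> z"
    and "(2 * \<alpha> + 1) * \<bar>sqrt_bessel \<alpha> z * sqrt_bessel (\<alpha> + 1) z\<bar> \<le> (2 * \<alpha> + 1) * sqrt_bessel_energy \<alpha> z"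
proof -
  define k l b where "k = sqrt_bessel \<alpha> z" and "l = sqrt_bessel (\<alpha> + 1) z" and "b = 2 * \<alpha> + 1"
  have b: "b > 0" "z > 0" "b \<le> z" using assms by (auto simp: b_def)
  have kl: "2 * \<bar>k * l\<bar> \<le> k\<^sup>2 + l\<^sup>2"
    using sum_squares_bound[of "\<bar>k\<bar>" "\<bar>l\<bar>"] by (simp add: abs_mult)
  have "b * (k * l) / z \<le> \<bar>k * l\<bar>"
  proof -
    have "b / z * (k * l) \<le> b / z * \<bar>k * l\<bar>"
      using b by (intro mult_left_mono) auto
    also have "\<dots> \<le> 1 * \<bar>k * l\<bar>"
      using b by (intro mult_right_mono) auto
    finally show ?thesis by simp
  qed
  then have G: "sqrt_bessel_energy \<alpha> z \<ge> k\<^sup>2 + l\<^sup>2 - \<bar>k * l\<bar>"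
    by (simp add: sqrt_bessel_energy_def k_def l_def b_def mult.assoc)
  show "(sqrt_bessel \<alpha> z)\<^sup>2 + (sqrt_bessel (\<alpha> + 1) z)\<^sup>2 \<le> 2 * sqrt_bessel_energy \<alpha> z"
    using G kl by (simp add: k_def[symmetric] l_def[symmetric])
  have "b * \<bar>k * l\<bar> \<le> b * sqrt_bessel_energy \<alpha> z"
    using b G kl by (intro mult_left_mono) auto
  then show "(2 * \<alpha> + 1) * \<bar>sqrt_bessel \<alpha> z * sqrt_bessel (\<alpha> + 1) z\<bar> \<le> (2 * \<alpha> + 1) * sqrt_bessel_energy \<alpha> z"
    by (simp add: k_def l_def b_def)
qed

text \<open>A Gronwall argument: \<open>sqrt_bessel_energy \<alpha> z * exp ((2 * \<alpha> + 1) / z)\<close> decreases.\<close>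

lemma sqrt_bessel_energy_bounded:
  assumes "\<alpha> > -1/2"
  obtains B where "\<And>z. z \<ge> 2 * \<alpha> + 2 \<Longrightarrow> sqrt_bessel_energy \<alpha> z \<le> B"
proof
  define z0 b where "z0 = 2 * \<alpha> + 2" and "b = 2 * \<alpha> + 1"
  have z0: "z0 > 0" "b > 0" using assms by (auto simp: z0_def b_def)
  fix z assume z: "z \<ge> 2 * \<alpha> + 2"
  have "sqrt_bessel_energy \<alpha> z0 * exp (b / z0) \<ge> sqrt_bessel_energy \<alpha> z * exp (b / z)"
  proof (rule DERIV_nonpos_imp_nonincreasing[of z0 z "\<lambda>x. sqrt_bessel_energy \<alpha> x * exp (b / x)"])
    show "z0 \<le> z" using z by (simp add: z0_def)
    fix x assume x: "z0 \<le> x" "x \<le> z"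
    then have xp: "x > 0" using z0 by linarith
    have "((\<lambda>x. sqrt_bessel_energy \<alpha> x * exp (b / x)) has_real_derivative
        (b * sqrt_bessel \<alpha> x * sqrt_bessel (\<alpha> + 1) x / x\<^sup>2 - b * sqrt_bessel_energy \<alpha> x / x\<^sup>2) * exp (b / x)) (at x)"
      by (rule DERIV_sqrt_bessel_energy derivative_eq_intros refl | use assms xp in \<open>simp add: b_def; fail\<close>)+
         (use xp in \<open>simp add: b_def power2_eq_square field_simps\<close>)
    moreover have "b * (sqrt_bessel \<alpha> x * sqrt_bessel (\<alpha> + 1) x) \<le> b * sqrt_bessel_energy \<alpha> x"
      using sqrt_bessel_energy_bounds(2)[OF assms, of x] x z0
      by (auto simp: b_def z0_def intro: order.trans[OF mult_left_mono])
    then have "(b * sqrt_bessel \<alpha> x * sqrt_bessel (\<alpha> + 1) x / x\<^sup>2 - b * sqrt_bessel_energy \<alpha> x / x\<^sup>2) * exp (b / x) \<le> 0"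
      by (auto intro!: mult_nonpos_nonneg divide_right_mono simp: diff_le_0_iff_le mult.assoc)
    ultimately show "\<exists>y. ((\<lambda>x. sqrt_bessel_energy \<alpha> x * exp (b / x)) has_real_derivative y) (at x) \<and> y \<le> 0"
      by blast
  qed
  moreover have "sqrt_bessel_energy \<alpha> z \<ge> 0"
    using sqrt_bessel_energy_bounds(1)[OF assms z] by (smt (verit) zero_le_power2)
  then have "sqrt_bessel_energy \<alpha> z * 1 \<le> sqrt_bessel_energy \<alpha> z * exp (b / z)"
    using z z0 by (intro mult_left_mono) (auto simp: z0_def)
  ultimately show "sqrt_bessel_energy \<alpha> z \<le> sqrt_bessel_energy \<alpha> (2 * \<alpha> + 2) * exp ((2 * \<alpha> + 1) / (2 * \<alpha> + 2))"
    by (simp add: z0_def b_def)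
qed

text \<open>Continuity covers a compact initial interval, the energy bound the rest. One constant
  serves both orders because the boundary terms below mix them.\<close>

lemma sqrt_bessel_bounded:
  assumes "\<alpha> > -1/2"
  obtains C where "C > 0" "\<And>z. \<bar>sqrt_bessel \<alpha> z\<bar> \<le> C" "\<And>z. \<bar>sqrt_bessel (\<alpha> + 1) z\<bar> \<le> C"
proof -
  define z0 where "z0 = 2 * \<alpha> + 2"
  have z0: "z0 > 0" using assms by (simp add: z0_def)
  obtain B where B: "\<And>z. z \<ge> z0 \<Longrightarrow> sqrt_bessel_energy \<alpha> z \<le> B"
    using sqrt_bessel_energy_bounded[OF assms] by (auto simp: z0_def)
  have bd: "\<exists>D. \<forall>z\<in>{0..z0}. \<bar>sqrt_bessel a z\<bar> \<le> D" if "a > -1/2" for a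
  proof -
    have "compact (sqrt_bessel a ` {0..z0})"
      by (intro compact_continuous_image continuous_on_sqrt_bessel that) auto
    then show ?thesis
      by (force dest!: compact_imp_bounded simp: bounded_iff)
  qed
  obtain D1 where D1: "\<forall>z\<in>{0..z0}. \<bar>sqrt_bessel \<alpha> z\<bar> \<le> D1" using bd[OF assms] by blast
  obtain D2 where D2: "\<forall>z\<in>{0..z0}. \<bar>sqrt_bessel (\<alpha> + 1) z\<bar> \<le> D2" using bd[of "\<alpha> + 1"] assms by auto
  have large: "\<bar>sqrt_bessel \<alpha> z\<bar> \<le> sqrt (2 * B)" "\<bar>sqrt_bessel (\<alpha> + 1) z\<bar> \<le> sqrt (2 * B)" if "z \<ge> z0" for z
  proof -
    have "(sqrt_bessel \<alpha> z)\<^sup>2 + (sqrt_bessel (\<alpha> + 1) z)\<^sup>2 \<le> 2 * B"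
      using sqrt_bessel_energy_bounds(1)[OF assms, of z] B[OF that] that by (simp add: z0_def)
    then have "(sqrt_bessel \<alpha> z)\<^sup>2 \<le> 2 * B" "(sqrt_bessel (\<alpha> + 1) z)\<^sup>2 \<le> 2 * B"
      by (smt (verit) zero_le_power2)+
    then show "\<bar>sqrt_bessel \<alpha> z\<bar> \<le> sqrt (2 * B)" "\<bar>sqrt_bessel (\<alpha> + 1) z\<bar> \<le> sqrt (2 * B)"
      by (auto intro!: real_le_rsqrt simp: power2_abs)
  qed
  define C where "C = Max {D1, D2, sqrt (2 * B), 1}"
  have C: "D1 \<le> C" "D2 \<le> C" "sqrt (2 * B) \<le> C" "1 \<le> C" by (auto simp: C_def)
  show ?thesis
  proof
    show "C > 0" using C by simp
    fix z
    consider "z \<le> 0" | "z \<in> {0..z0}" | "z \<ge> z0" by fastforce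
    then show "\<bar>sqrt_bessel \<alpha> z\<bar> \<le> C" "\<bar>sqrt_bessel (\<alpha> + 1) z\<bar> \<le> C"
      using D1 D2 large[of z] C by (cases; fastforce)+
  qed
qed

text \<open>The derivative is at most \<open>C / z\<^sup>2\<close> in absolute value. Adding
  \<open>C / z\<close> therefore gives a decreasing function and subtracting it an increasing one,
  and the two enclose a common limit \<open>L\<close>.\<close>

lemma sqrt_bessel_energy_limit:
  assumes "\<alpha> > -1/2"
  obtains L C where "\<And>z. z \<ge> 1 \<Longrightarrow> \<bar>sqrt_bessel_energy \<alpha> z - L\<bar> \<le> C / z"
proof -
  obtain D where D: "D > 0" "\<And>z. \<bar>sqrt_bessel \<alpha> z\<bar> \<le> D" "\<And>z. \<bar>sqrt_bessel (\<alpha> + 1) z\<bar> \<le> D"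
    using sqrt_bessel_bounded[OF assms] by blast
  define C where "C = (2 * \<alpha> + 1) * (D * D)"
  have C0: "C \<ge> 0" using D assms by (simp add: C_def)
  have le: "\<bar>(2 * \<alpha> + 1) * sqrt_bessel \<alpha> z * sqrt_bessel (\<alpha> + 1) z\<bar> \<le> C" for z
    unfolding C_def abs_mult mult.assoc using assms D by (intro mult_mono) auto
  define up lo where "up = (\<lambda>z. sqrt_bessel_energy \<alpha> z + C / z)" and "lo = (\<lambda>z. sqrt_bessel_energy \<alpha> z - C / z)"
  have up: "up x \<ge> up y" if "1 \<le> x" "x \<le> y" for x y
  proof (rule DERIV_nonpos_imp_nonincreasing[OF that(2)])
    fix z assume "x \<le> z" "z \<le> y"
    then have z: "z > 0" using that by simp
    have "(up has_real_derivative ((2 * \<alpha> + 1) * sqrt_bessel \<alpha> z * sqrt_bessel (\<alpha> + 1) z / z\<^sup>2 - C / z\<^sup>2)) (at z)"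
      unfolding up_def
      by (rule DERIV_sqrt_bessel_energy derivative_eq_intros refl | use assms z in \<open>simp; fail\<close>)+
         (use z in \<open>simp add: power2_eq_square\<close>)
    moreover have "(2 * \<alpha> + 1) * sqrt_bessel \<alpha> z * sqrt_bessel (\<alpha> + 1) z / z\<^sup>2 - C / z\<^sup>2 \<le> 0"
      unfolding diff_le_0_iff_le using le[of z] by (intro divide_right_mono) auto
    ultimately show "\<exists>y. (up has_real_derivative y) (at z) \<and> y \<le> 0" by blast
  qed
  have lo: "lo x \<le> lo y" if "1 \<le> x" "x \<le> y" for x y
  proof (rule DERIV_nonneg_imp_nondecreasing[OF that(2)])
    fix z assume "x \<le> z" "z \<le> y"
    then have z: "z > 0" using that by simp
    have "(lo has_real_derivative ((2 * \<alpha> + 1) * sqrt_bessel \<alpha> z * sqrt_bessel (\<alpha> + 1) z / z\<^sup>2 - (- C) / z\<^sup>2)) (at z)"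
      unfolding lo_def
      by (rule DERIV_sqrt_bessel_energy derivative_eq_intros refl | use assms z in \<open>simp; fail\<close>)+
         (use z in \<open>simp add: power2_eq_square\<close>)
    moreover have "(2 * \<alpha> + 1) * sqrt_bessel \<alpha> z * sqrt_bessel (\<alpha> + 1) z / z\<^sup>2 - (- C) / z\<^sup>2 \<ge> 0"
      unfolding diff_ge_0_iff_ge using le[of z] by (intro divide_right_mono) auto
    ultimately show "\<exists>y. (lo has_real_derivative y) (at z) \<and> y \<ge> 0" by blast
  qed
  have lu: "lo x \<le> up y" if "x \<ge> 1" "y \<ge> 1" for x y
  proof -
    have "lo (max x y) \<le> up (max x y)" using C0 that by (simp add: lo_def up_def)
    moreover have "lo x \<le> lo (max x y)" using that by (intro lo) auto
    moreover have "up (max x y) \<le> up y" using that by (intro up) auto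
    ultimately show ?thesis by linarith
  qed
  define L where "L = (SUP x\<in>{1..}. lo x)"
  show ?thesis
  proof
    fix z :: real assume z: "z \<ge> 1"
    have "bdd_above (lo ` {1..})" using lu[of _ 1] by (intro bdd_aboveI2[of _ _ "up 1"]) auto
    then have "lo z \<le> L" unfolding L_def using z by (intro cSUP_upper) auto
    moreover have "L \<le> up z" unfolding L_def using z lu by (intro cSUP_least) auto
    ultimately show "\<bar>sqrt_bessel_energy \<alpha> z - L\<bar> \<le> C / z" unfolding lo_def up_def by linarith
  qed
qed

text \<open>Lommel's antiderivative of \<open>z * (J \<alpha> z)\<^sup>2\<close>, with the
  derivative of the Bessel function expressed through order \<open>\<alpha> + 1\<close>. It vanishes
  at \<open>0\<close>.\<close>

definition sqrt_bessel_sq_primitive :: "real \<Rightarrow> real \<Rightarrow> real" where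
  "sqrt_bessel_sq_primitive \<alpha> z = (z * ((sqrt_bessel \<alpha> z)\<^sup>2 + (sqrt_bessel (\<alpha> + 1) z)\<^sup>2) - 2 * \<alpha> * sqrt_bessel \<alpha> z * sqrt_bessel (\<alpha> + 1) z) / 2"

lemma DERIV_sqrt_bessel_sq_primitive:
  assumes "\<alpha> > -1" "z > 0"
  shows "(sqrt_bessel_sq_primitive \<alpha> has_real_derivative (sqrt_bessel \<alpha> z)\<^sup>2) (at z)"
proof -
  define k l where "k = sqrt_bessel \<alpha> z" and "l = sqrt_bessel (\<alpha> + 1) z"
  have z: "z \<noteq> 0" using assms by simp
  have "(sqrt_bessel_sq_primitive \<alpha> has_real_derivative
     (k\<^sup>2 + l\<^sup>2 + z * (2 * k * ((\<alpha> + 1/2) * k / z - l) + 2 * l * (k - (\<alpha> + 1/2) * l / z))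
     - 2 * \<alpha> * (((\<alpha> + 1/2) * k / z - l) * l + k * (k - (\<alpha> + 1/2) * l / z))) / 2) (at z)"
    unfolding sqrt_bessel_sq_primitive_def[abs_def] k_def l_def
    by (rule DERIV_cdivide, (rule DERIV_sqrt_bessel[OF assms] DERIV_sqrt_bessel_Suc[OF assms] derivative_eq_intros z refl
        | (simp add: power2_eq_square algebra_simps; fail))+)
  moreover have "(k\<^sup>2 + l\<^sup>2 + z * (2 * k * ((\<alpha> + 1/2) * k / z - l) + 2 * l * (k - (\<alpha> + 1/2) * l / z))
     - 2 * \<alpha> * (((\<alpha> + 1/2) * k / z - l) * l + k * (k - (\<alpha> + 1/2) * l / z))) / 2 = k\<^sup>2"
    using z by (simp add: divide_simps power2_eq_square) (simp add: algebra_simps)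
  ultimately show ?thesis by (simp only: k_def)
qed

lemma has_integral_sqrt_bessel_sq:
  assumes "\<alpha> > -1/2" "0 \<le> p" "p \<le> q"
  shows "((\<lambda>z. (sqrt_bessel \<alpha> z)\<^sup>2) has_integral (sqrt_bessel_sq_primitive \<alpha> q - sqrt_bessel_sq_primitive \<alpha> p)) {p..q}"
proof (rule fundamental_theorem_of_calculus_interior[OF assms(3)])
  show "continuous_on {p..q} (sqrt_bessel_sq_primitive \<alpha>)"
    unfolding sqrt_bessel_sq_primitive_def[abs_def] using assms
    by (intro continuous_intros continuous_on_sqrt_bessel) auto
  fix x assume "x \<in> {p<..<q}"
  then show "(sqrt_bessel_sq_primitive \<alpha> has_vector_derivative (sqrt_bessel \<alpha> x)\<^sup>2) (at x)"
    using DERIV_sqrt_bessel_sq_primitive[of \<alpha> x] assms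
    by (simp add: has_real_derivative_iff_has_vector_derivative)
qed

text \<open>The primitive equals \<open>z / 2\<close> times the energy plus the bounded term
  \<open>k * l / 2\<close>. The slope obtained is thus half the limit of the energy, and it is the
  mean value of the squared kernel.\<close>

lemma sqrt_bessel_sq_primitive_asymp:
  assumes "\<alpha> > -1/2"
  obtains L C where "\<And>z. z \<ge> 0 \<Longrightarrow> \<bar>sqrt_bessel_sq_primitive \<alpha> z - L * z\<bar> \<le> C"
proof -
  obtain D where D: "D > 0" "\<And>z. \<bar>sqrt_bessel \<alpha> z\<bar> \<le> D" "\<And>z. \<bar>sqrt_bessel (\<alpha> + 1) z\<bar> \<le> D"
    using sqrt_bessel_bounded[OF assms] by blast
  obtain L C where L: "\<And>z. z \<ge> 1 \<Longrightarrow> \<bar>sqrt_bessel_energy \<alpha> z - L\<bar> \<le> C / z"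
    using sqrt_bessel_energy_limit[OF assms] by blast
  have kl: "\<bar>sqrt_bessel \<alpha> z * sqrt_bessel (\<alpha> + 1) z\<bar> \<le> D * D" for z
    unfolding abs_mult using D by (intro mult_mono) auto
  have large: "\<bar>sqrt_bessel_sq_primitive \<alpha> z - L / 2 * z\<bar> \<le> \<bar>C\<bar> + D * D" if "z \<ge> 1" for z
  proof -
    have "sqrt_bessel_sq_primitive \<alpha> z - L / 2 * z = (z * (sqrt_bessel_energy \<alpha> z - L) + sqrt_bessel \<alpha> z * sqrt_bessel (\<alpha> + 1) z) / 2"
      using that unfolding sqrt_bessel_sq_primitive_def sqrt_bessel_energy_def by (simp add: field_simps)
    moreover have "\<bar>z * (sqrt_bessel_energy \<alpha> z - L)\<bar> \<le> C"
      using mult_left_mono[OF L[OF that], of z] that by (simp add: abs_mult)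
    moreover have "\<bar>(x + y) / 2\<bar> \<le> \<bar>C\<bar> + D * D" if "\<bar>x\<bar> \<le> C" "\<bar>y\<bar> \<le> D * D" for x y :: real
      using that abs_triangle_ineq[of x y] abs_ge_zero[of x] abs_ge_zero[of y] abs_ge_self[of C]
      by (simp only: abs_divide abs_numeral)
    ultimately show ?thesis using kl[of z] by simp
  qed
  have "compact ((\<lambda>z. sqrt_bessel_sq_primitive \<alpha> z - L / 2 * z) ` {0..1})"
    unfolding sqrt_bessel_sq_primitive_def[abs_def] using assms
    by (intro compact_continuous_image continuous_intros continuous_on_sqrt_bessel) auto
  then obtain B where B: "\<And>z. z \<in> {0..1} \<Longrightarrow> \<bar>sqrt_bessel_sq_primitive \<alpha> z - L / 2 * z\<bar> \<le> B"
    by (force dest!: compact_imp_bounded simp: bounded_iff)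
  show ?thesis
  proof
    fix z :: real assume "z \<ge> 0"
    then show "\<bar>sqrt_bessel_sq_primitive \<alpha> z - L / 2 * z\<bar> \<le> max B (\<bar>C\<bar> + D * D)"
      using large[of z] B[of z] by (cases "z \<ge> 1") auto
  qed
qed

text \<open>Up to sign the Wronskian in \<open>x\<close> of the kernels dilated by \<open>y\<close>
  and by \<open>s\<close>: the terms with \<open>(\<alpha> + 1/2) / x\<close> cancel. Both dilates
  solve the same Sturm-Liouville equation with eigenvalues \<open>y\<^sup>2\<close> and
  \<open>s\<^sup>2\<close>, so its derivative is \<open>s\<^sup>2 - y\<^sup>2\<close> times their
  product.\<close>

definition lommel :: "real \<Rightarrow> real \<Rightarrow> real \<Rightarrow> real \<Rightarrow> real" where
  "lommel \<alpha> y s x = s * sqrt_bessel \<alpha> (y * x) * sqrt_bessel (\<alpha> + 1) (s * x) - y * sqrt_bessel (\<alpha> + 1) (y * x) * sqrt_bessel \<alpha> (s * x)"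

lemma DERIV_lommel:
  assumes "\<alpha> > -1" "y > 0" "s > 0" "x > 0"
  shows "(lommel \<alpha> y s has_real_derivative (s\<^sup>2 - y\<^sup>2) * (sqrt_bessel \<alpha> (y * x) * sqrt_bessel \<alpha> (s * x))) (at x)"
proof -
  have d: "((\<lambda>x. sqrt_bessel \<alpha> (c * x)) has_real_derivative ((\<alpha> + 1/2) * sqrt_bessel \<alpha> (c * x) / (c * x) - sqrt_bessel (\<alpha> + 1) (c * x)) * c) (at x)"
     "((\<lambda>x. sqrt_bessel (\<alpha> + 1) (c * x)) has_real_derivative (sqrt_bessel \<alpha> (c * x) - (\<alpha> + 1/2) * sqrt_bessel (\<alpha> + 1) (c * x) / (c * x)) * c) (at x)"
    if "c > 0" for c
    using that assms
    by (auto intro!: DERIV_chain2[OF DERIV_sqrt_bessel] DERIV_chain2[OF DERIV_sqrt_bessel_Suc] derivative_eq_intros)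
  define k1 l1 k2 l2 where "k1 = sqrt_bessel \<alpha> (y * x)" and "l1 = sqrt_bessel (\<alpha> + 1) (y * x)"
    and "k2 = sqrt_bessel \<alpha> (s * x)" and "l2 = sqrt_bessel (\<alpha> + 1) (s * x)"
  have z: "y \<noteq> 0" "s \<noteq> 0" "x \<noteq> 0" using assms by auto
  have "(lommel \<alpha> y s has_real_derivative
      s * ((((\<alpha> + 1/2) * k1 / (y * x) - l1) * y) * l2 + k1 * ((k2 - (\<alpha> + 1/2) * l2 / (s * x)) * s))
      - y * (((k1 - (\<alpha> + 1/2) * l1 / (y * x)) * y) * k2 + l1 * (((\<alpha> + 1/2) * k2 / (s * x) - l2) * s))) (at x)"
    unfolding lommel_def[abs_def] k1_def l1_def k2_def l2_def
    by (rule d[OF assms(2)] d[OF assms(3)] derivative_eq_intros refl)+ (simp add: algebra_simps)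
  moreover have "s * ((((\<alpha> + 1/2) * k1 / (y * x) - l1) * y) * l2 + k1 * ((k2 - (\<alpha> + 1/2) * l2 / (s * x)) * s))
      - y * (((k1 - (\<alpha> + 1/2) * l1 / (y * x)) * y) * k2 + l1 * (((\<alpha> + 1/2) * k2 / (s * x) - l2) * s))
      = (s\<^sup>2 - y\<^sup>2) * (k1 * k2)"
    using z by (simp add: divide_simps power2_eq_square) (simp add: algebra_simps)
  ultimately show ?thesis by (simp only: k1_def k2_def)
qed

lemma has_integral_sqrt_bessel_prod:
  assumes "\<alpha> > -1/2" "0 \<le> p" "p \<le> q" "y > 0" "s > 0" "y \<noteq> s"
  shows "((\<lambda>x. sqrt_bessel \<alpha> (y * x) * sqrt_bessel \<alpha> (s * x)) has_integral
     (lommel \<alpha> y s q - lommel \<alpha> y s p) / (s\<^sup>2 - y\<^sup>2)) {p..q}"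
proof -
  have "((\<lambda>x. (s\<^sup>2 - y\<^sup>2) * (sqrt_bessel \<alpha> (y * x) * sqrt_bessel \<alpha> (s * x))) has_integral
     (lommel \<alpha> y s q - lommel \<alpha> y s p)) {p..q}"
  proof (rule fundamental_theorem_of_calculus_interior[OF assms(3)])
    show "continuous_on {p..q} (lommel \<alpha> y s)"
      unfolding lommel_def[abs_def] using assms
      by (intro continuous_intros continuous_on_sqrt_bessel_mult) auto
    fix x assume "x \<in> {p<..<q}"
    then show "(lommel \<alpha> y s has_vector_derivative (s\<^sup>2 - y\<^sup>2) * (sqrt_bessel \<alpha> (y * x) * sqrt_bessel \<alpha> (s * x))) (at x)"
      using DERIV_lommel[of \<alpha> y s x] assms
      by (simp add: has_real_derivative_iff_has_vector_derivative)
  qed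
  from has_integral_mult_right[OF this, of "1 / (s\<^sup>2 - y\<^sup>2)"]
  show ?thesis using assms by (simp add: power2_eq_iff)
qed

section \<open>The Hankel transform is an isometry\<close>

text \<open>The substitution \<open>u = p * x\<^sup>2 / 2\<close> in Euler's integral for
  \<open>Gamma s\<close>.\<close>

lemma gaussian_moment:
  assumes "s > 0" "p > (0::real)"
  shows "has_bochner_integral lborel (\<lambda>x. if x > 0 then x powr (2 * s - 1) * exp (- p * x\<^sup>2 / 2) else 0)
     ((2 / p) powr s * Gamma s / 2)"
proof -
  define f where "f = (\<lambda>u::real. u powr (s - 1) / exp u)"
  define g where "g = (\<lambda>x. p * x\<^sup>2 / 2)"
  have "(f has_integral Gamma s) {0..}"
    unfolding f_def by (rule Gamma_integral_real[OF assms(1)])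
  then have "(f has_integral Gamma s) {0<..}"
    by (rule has_integral_spike_set_eq[THEN iffD1, rotated -1]) (rule negligible_subset[of "{0}"]; auto)+
  then have f: "f absolutely_integrable_on {0<..} \<and> integral {0<..} f = Gamma s"
    by (auto intro!: nonnegative_absolutely_integrable_1 simp: f_def has_integral_iff)
  have img: "g ` {0<..} = {0<..}"
  proof (intro equalityI subsetI)
    fix y :: real assume "y \<in> {0<..}"
    then show "y \<in> g ` {0<..}"
      using assms by (intro image_eqI[of _ _ "sqrt (2 * y / p)"]) (auto simp: g_def)
  qed (use assms in \<open>auto simp: g_def\<close>)
  have "(\<lambda>x. \<bar>p * x\<bar> * f (g x)) absolutely_integrable_on {0<..} \<and>
           integral {0<..} (\<lambda>x. \<bar>p * x\<bar> * f (g x)) = Gamma s"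
  proof -
    have "(g has_field_derivative p * x) (at x within {0<..})" for x
      unfolding g_def by (auto intro!: derivative_eq_intros)
    moreover have "inj_on g {0<..}"
      using assms by (auto simp: inj_on_def g_def power2_eq_iff)
    ultimately show ?thesis
      using has_absolute_integral_change_of_variables_1'[of "{0<..}" g "\<lambda>x. p * x" f "Gamma s"] f img
      by simp
  qed
  moreover have "\<bar>p * x\<bar> * f (g x) = 2 * (p / 2) powr s * (x powr (2 * s - 1) * exp (- p * x\<^sup>2 / 2))"
    if "x \<in> {0<..}" for x
  proof -
    have x: "x > 0" using that by simp
    have "g x powr (s - 1) = (p / 2) powr (s - 1) * x powr (2 * (s - 1))"
      unfolding g_def using assms x powr_powr[of x 2 "s - 1"]
      by (simp add: powr_mult powr_divide)
    also have "(p / 2) powr (s - 1) = (p / 2) powr s / (p / 2)"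
      using assms by (simp add: powr_diff)
    also have "x powr (2 * (s - 1)) = x powr (2 * s - 1) / x"
      using x powr_diff[of x "2 * s - 1" 1] by (simp add: algebra_simps)
    finally show ?thesis using x assms
      by (simp add: f_def g_def exp_minus field_simps)
  qed
  ultimately have "(\<lambda>x. 2 * (p / 2) powr s * (x powr (2 * s - 1) * exp (- p * x\<^sup>2 / 2))) absolutely_integrable_on {0<..} \<and>
     integral {0<..} (\<lambda>x. 2 * (p / 2) powr s * (x powr (2 * s - 1) * exp (- p * x\<^sup>2 / 2))) = Gamma s"
    by (metis (mono_tags, lifting) Henstock_Kurzweil_Integration.integral_cong set_integrable_cong)
  then have *: "(\<lambda>x. x powr (2 * s - 1) * exp (- p * x\<^sup>2 / 2)) absolutely_integrable_on {0<..}"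
     "2 * (p / 2) powr s * integral {0<..} (\<lambda>x. x powr (2 * s - 1) * exp (- p * x\<^sup>2 / 2)) = Gamma s"
    using assms by auto
  have "integral {0<..} (\<lambda>x. x powr (2 * s - 1) * exp (- p * x\<^sup>2 / 2)) = (2 / p) powr s * Gamma s / 2"
    using * assms by (simp add: powr_divide field_simps)
  moreover have "integral {0<..} (\<lambda>x. x powr (2 * s - 1) * exp (- p * x\<^sup>2 / 2))
     = (\<integral>x. indicator {0<..} x *\<^sub>R (x powr (2 * s - 1) * exp (- p * x\<^sup>2 / 2)) \<partial>lebesgue)"
    using set_lebesgue_integral_eq_integral(2)[OF *(1)] by (simp add: set_lebesgue_integral_def)
  moreover have "(\<lambda>x. indicator {0<..} x *\<^sub>R (x powr (2 * s - 1) * exp (- p * x\<^sup>2 / 2))) \<in> borel_measurable lborel"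
    by measurable
  ultimately have "has_bochner_integral lborel (\<lambda>x. indicator {0<..} x *\<^sub>R (x powr (2 * s - 1) * exp (- p * x\<^sup>2 / 2)))
     ((2 / p) powr s * Gamma s / 2)"
    using *(1) by (simp add: has_bochner_integral_iff integral_completion integrable_completion set_integrable_def)
  also have "(\<lambda>x. indicator {0<..} x *\<^sub>R (x powr (2 * s - 1) * exp (- p * x\<^sup>2 / 2)))
     = (\<lambda>x. if x > 0 then x powr (2 * s - 1) * exp (- p * x\<^sup>2 / 2) else 0)"
    by (auto simp: indicator_def fun_eq_iff)
  finally show ?thesis .
qed

text \<open>The case \<open>p = 1\<close> is a fixed point of the transform. The power of
  \<open>x\<close> equals the one split off from the kernel, so that integrating the series termwise
  yields Gamma integrals.\<close>

definition gauss_fun :: "real \<Rightarrow> real \<Rightarrow> real \<Rightarrow> real" where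
  "gauss_fun \<alpha> p x = (if x > 0 then x powr (\<alpha> + 1/2) * exp (- p * x\<^sup>2 / 2) else 0)"

text \<open>A real version over the whole line. For functions that vanish on the nonpositive axis it
  agrees with \<open>hankel_integral\<close> at positive points.\<close>

definition hankel :: "real \<Rightarrow> (real \<Rightarrow> real) \<Rightarrow> real \<Rightarrow> real" where
  "hankel \<alpha> g y = (\<integral>x. g x * sqrt_bessel \<alpha> (y * x) \<partial>lborel)"

lemma gauss_fun_measurable [measurable]: "gauss_fun \<alpha> p \<in> borel_measurable borel"
  unfolding gauss_fun_def[abs_def] by measurable

lemma gauss_fun_nonneg: "gauss_fun \<alpha> p x \<ge> 0"
  by (simp add: gauss_fun_def)

lemma integrable_gauss_fun:
  assumes "\<alpha> > -1/2" "p > 0"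
  shows "integrable lborel (gauss_fun \<alpha> p)"
proof -
  have e: "2 * ((\<alpha> + 3/2) / 2) - 1 = \<alpha> + 1/2" by (simp add: field_simps)
  show ?thesis
    using gaussian_moment[of "(\<alpha> + 3/2) / 2" p, unfolded e] assms
    unfolding gauss_fun_def[abs_def] by (auto simp: has_bochner_integral_iff)
qed

lemma has_bochner_integral_gauss_fun_mult:
  assumes "\<alpha> > -1" "p > 0" "q > 0"
  shows "has_bochner_integral lborel (\<lambda>x. gauss_fun \<alpha> p x * gauss_fun \<alpha> q x)
     ((2 / (p + q)) powr (\<alpha> + 1) * Gamma (\<alpha> + 1) / 2)"
proof -
  have "gauss_fun \<alpha> p x * gauss_fun \<alpha> q x = (if x > 0 then x powr (2 * (\<alpha> + 1) - 1) * exp (- (p + q) * x\<^sup>2 / 2) else 0)" for x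
  proof (cases "x > 0")
    case True
    have e: "2 * (\<alpha> + 1) - 1 = (\<alpha> + 1/2) + (\<alpha> + 1/2)" by simp
    have e2: "- (p + q) * x\<^sup>2 / 2 = - p * x\<^sup>2 / 2 + (- q * x\<^sup>2 / 2)" by (simp add: field_simps)
    show ?thesis using True unfolding e e2 powr_add exp_add gauss_fun_def by simp
  qed (simp add: gauss_fun_def)
  then show ?thesis
    using gaussian_moment[of "\<alpha> + 1" "p + q"] assms by (simp only:)
qed

text \<open>Weber's integral. In the termwise integrated series the Gamma value of the moment
  cancels the one in the coefficient, and the exponential series of
  \<open>- y\<^sup>2 / (2 * p)\<close> remains.\<close>

lemma hankel_gauss_fun:
  assumes "\<alpha> > -1/2" "p > 0"
  shows "hankel \<alpha> (gauss_fun \<alpha> p) y = p powr (- (\<alpha> + 1)) * gauss_fun \<alpha> (1 / p) y"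
proof (cases "y > 0")
  case False
  then have "(\<lambda>x. gauss_fun \<alpha> p x * sqrt_bessel \<alpha> (y * x)) = (\<lambda>x. 0)"
    by (auto simp: gauss_fun_def mult_nonpos_nonneg fun_eq_iff)
  then have "hankel \<alpha> (gauss_fun \<alpha> p) y = 0" unfolding hankel_def by simp
  then show ?thesis using False by (simp add: gauss_fun_def)
next
  case y: True
  define b where "b = \<alpha> + 1/2"
  define m where "m k x = (if x > 0 then x powr (2 * (real k + \<alpha> + 1) - 1) * exp (- p * x\<^sup>2 / 2) else 0)"
    for k :: nat and x :: real
  define d where "d k = bessel_coeff \<alpha> k * (y powr b * (y\<^sup>2) ^ k)" for k
  have ks: "real k + \<alpha> + 1 > 0" for k using assms by linarith
  have m: "has_bochner_integral lborel (m k) ((2 / p) powr (real k + \<alpha> + 1) * Gamma (real k + \<alpha> + 1) / 2)" for k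
    unfolding m_def using gaussian_moment[OF ks assms(2)] .
  have mpos: "m k x \<ge> 0" for k x by (simp add: m_def)
  have termk: "bessel_coeff \<alpha> k * ((2 / p) powr (real k + \<alpha> + 1) * Gamma (real k + \<alpha> + 1) / 2)
     = p powr (- (\<alpha> + 1)) * ((- 1 / (2 * p)) ^ k / fact k)" for k
  proof -
    have G: "Gamma (real k + \<alpha> + 1) > 0" using ks by (simp add: Gamma_real_pos)
    have "(2 / p) powr (real k + \<alpha> + 1) = 2 powr (real k + \<alpha> + 1) * p powr (- (\<alpha> + 1)) * p powr (- real k)"
    proof -
      have "- (real k + \<alpha> + 1) = - (\<alpha> + 1) + (- real k)" by simp
      then have "p powr (- (real k + \<alpha> + 1)) = p powr (- (\<alpha> + 1)) * p powr (- real k)"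
        by (simp only: powr_add)
      moreover have "(2 / p) powr (real k + \<alpha> + 1) = 2 powr (real k + \<alpha> + 1) * p powr (- (real k + \<alpha> + 1))"
        using assms by (simp only: powr_minus_divide) (simp add: powr_divide)
      ultimately show ?thesis by simp
    qed
    also have "p powr (- real k) = 1 / p ^ k"
      using assms by (simp add: powr_minus_divide powr_realpow)
    also have "2 powr (real k + \<alpha> + 1) = 2 * 2 powr (2 * real k + \<alpha>) / 2 ^ k"
    proof -
      have "real k + \<alpha> + 1 = 1 + (2 * real k + \<alpha>) - real k" by simp
      then show ?thesis by (simp only: powr_diff powr_add) (simp add: powr_realpow)
    qed
    finally have e: "(2 / p) powr (real k + \<alpha> + 1)
      = 2 * 2 powr (2 * real k + \<alpha>) / 2 ^ k * p powr (- (\<alpha> + 1)) * (1 / p ^ k)" .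
    have "s / (f * g * w) * (2 * w / t * q * (1 / r) * g / 2) = q * (s / (t * r) / f)"
      if "g \<noteq> 0" "w \<noteq> 0" for s f g w t q r :: real
      using that by (simp add: field_simps)
    moreover have "(- 1 / (2 * p)) ^ k = (- 1) ^ k / (2 ^ k * p ^ k)"
      by (simp only: power_divide power_mult_distrib)
    moreover have "2 powr (2 * real k + \<alpha>) \<noteq> (0::real)" by simp
    ultimately show ?thesis using G unfolding bessel_coeff_def e by (metis less_irrefl)
  qed
  have term2: "d k * ((2 / p) powr (real k + \<alpha> + 1) * Gamma (real k + \<alpha> + 1) / 2)
     = p powr (- (\<alpha> + 1)) * y powr b * ((- (y\<^sup>2 / (2 * p))) ^ k /\<^sub>R fact k)" for k
  proof -
    have "d k * ((2 / p) powr (real k + \<alpha> + 1) * Gamma (real k + \<alpha> + 1) / 2)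
      = (y powr b * (y\<^sup>2) ^ k) * (bessel_coeff \<alpha> k * ((2 / p) powr (real k + \<alpha> + 1) * Gamma (real k + \<alpha> + 1) / 2))"
      by (simp add: d_def)
    also have "\<dots> = (y powr b * (y\<^sup>2) ^ k) * (p powr (- (\<alpha> + 1)) * ((- 1 / (2 * p)) ^ k / fact k))"
      unfolding termk ..
    also have "\<dots> = p powr (- (\<alpha> + 1)) * y powr b * (((y\<^sup>2) * (- 1 / (2 * p))) ^ k / fact k)"
      by (simp only: power_mult_distrib) simp
    also have "(y\<^sup>2) * (- 1 / (2 * p)) = - (y\<^sup>2 / (2 * p))" by simp
    finally show ?thesis by (simp add: scaleR_conv_of_real field_simps)
  qed
  have dm: "d k * m k x = gauss_fun \<alpha> p x * (y * x) powr b * (bessel_coeff \<alpha> k * ((y * x)\<^sup>2) ^ k)" if x: "x > 0" for k x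
  proof -
    have "2 * (real k + \<alpha> + 1) - 1 = b + b + 2 * real k" by (simp add: b_def)
    then have "x powr (2 * (real k + \<alpha> + 1) - 1) = x powr b * x powr b * x powr (2 * real k)"
      by (simp only: powr_add)
    also have "x powr (2 * real k) = (x\<^sup>2) ^ k"
      using x powr_realpow[of x "2 * k"] by (simp add: power_mult)
    finally show ?thesis using x y
      by (simp add: d_def m_def gauss_fun_def b_def powr_mult power_mult_distrib)
  qed
  have hke: "gauss_fun \<alpha> p x * sqrt_bessel \<alpha> (y * x) = (\<Sum>k. d k * m k x)" and sm: "summable (\<lambda>k. d k * m k x)" for x
  proof -
    have sb: "summable (\<lambda>k. bessel_coeff \<alpha> k * ((y * x)\<^sup>2) ^ k)"
      using assms by (intro summable_bessel_entire) simp
    show "summable (\<lambda>k. d k * m k x)"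
    proof (cases "x > 0")
      case True then show ?thesis using summable_mult[OF sb] by (simp only: dm)
    qed (simp add: m_def)
    show "gauss_fun \<alpha> p x * sqrt_bessel \<alpha> (y * x) = (\<Sum>k. d k * m k x)"
    proof (cases "x > 0")
      case True
      then have "sqrt_bessel \<alpha> (y * x) = (y * x) powr b * bessel_entire \<alpha> ((y * x)\<^sup>2)"
        using y assms by (simp add: sqrt_bessel_eq b_def)
      with True show ?thesis using suminf_mult[OF sb, of "gauss_fun \<alpha> p x * (y * x) powr b"]
        by (simp only: dm bessel_entire_def mult.assoc)
    qed (simp add: m_def gauss_fun_def)
  qed
  have es: "(\<lambda>k. p powr (- (\<alpha> + 1)) * y powr b * (c ^ k /\<^sub>R fact k)) sums
     (p powr (- (\<alpha> + 1)) * y powr b * exp c)" for c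
    by (intro sums_mult exp_converges)
  have "(\<lambda>k. \<integral>x. d k * m k x \<partial>lborel) sums (\<integral>x. (\<Sum>k. d k * m k x) \<partial>lborel)"
  proof (rule sums_integral)
    show "integrable lborel (\<lambda>x. d k * m k x)" for k
      using m[of k] by (auto simp: has_bochner_integral_iff)
    \<comment> \<open>The signs of the coefficients alternate, so the series of absolute values is
      the same power series at \<open>- (y * x)\<^sup>2\<close>.\<close>
    have "summable (\<lambda>k. norm (d k) * norm (m k x))" for x
    proof (cases "x > 0")
      case x: True
      have "\<bar>bessel_coeff \<alpha> k\<bar> = (-1) ^ k * bessel_coeff \<alpha> k" for k
        using ks[of k] by (simp add: bessel_coeff_def abs_mult power_abs Gamma_real_pos less_imp_le)
      moreover have "norm (d k) * norm (m k x)
         = gauss_fun \<alpha> p x * (y * x) powr b * (\<bar>bessel_coeff \<alpha> k\<bar> * ((y * x)\<^sup>2) ^ k)" for k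
        unfolding norm_mult[symmetric] dm[OF x] using x y by (simp add: abs_mult gauss_fun_nonneg)
      moreover have "summable (\<lambda>k. bessel_coeff \<alpha> k * (- ((y * x)\<^sup>2)) ^ k)"
        using assms by (intro summable_bessel_entire) simp
      then have "summable (\<lambda>k. (-1) ^ k * bessel_coeff \<alpha> k * ((y * x)\<^sup>2) ^ k)"
        by (subst (asm) power_minus) (simp add: mult_ac)
      ultimately show ?thesis by (simp add: summable_mult)
    qed (simp add: m_def)
    then show "AE x in lborel. summable (\<lambda>k. norm (d k * m k x))" by (simp add: abs_mult)
    have "(\<integral>x. norm (d k * m k x) \<partial>lborel) = \<bar>d k * ((2 / p) powr (real k + \<alpha> + 1) * Gamma (real k + \<alpha> + 1) / 2)\<bar>" for k
    proof -
      have "(\<integral>x. norm (d k * m k x) \<partial>lborel) = (\<integral>x. \<bar>d k\<bar> * m k x \<partial>lborel)"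
        using mpos by (simp add: abs_mult)
      also have "\<dots> = \<bar>d k\<bar> * ((2 / p) powr (real k + \<alpha> + 1) * Gamma (real k + \<alpha> + 1) / 2)"
        using m[of k] by (simp add: has_bochner_integral_iff)
      finally show ?thesis using ks[of k] by (simp add: abs_mult Gamma_real_pos less_imp_le)
    qed
    also have "\<bar>d k * ((2 / p) powr (real k + \<alpha> + 1) * Gamma (real k + \<alpha> + 1) / 2)\<bar>
       = p powr (- (\<alpha> + 1)) * y powr b * ((y\<^sup>2 / (2 * p)) ^ k /\<^sub>R fact k)" for k
      unfolding term2 using assms by (simp add: abs_mult power_abs)
    finally show "summable (\<lambda>k. \<integral>x. norm (d k * m k x) \<partial>lborel)"
      using es by (simp add: sums_iff)
  qed
  also have "(\<lambda>k. \<integral>x. d k * m k x \<partial>lborel) = (\<lambda>k. p powr (- (\<alpha> + 1)) * y powr b * ((- (y\<^sup>2 / (2 * p))) ^ k /\<^sub>R fact k))"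
    unfolding term2[symmetric] by (simp only: integral_mult_right_zero has_bochner_integral_integral_eq[OF m])
  finally have "(\<integral>x. (\<Sum>k. d k * m k x) \<partial>lborel) = p powr (- (\<alpha> + 1)) * y powr b * exp (- (y\<^sup>2 / (2 * p)))"
    using es by (simp add: sums_iff)
  then show ?thesis using y unfolding hankel_def hke by (simp add: gauss_fun_def b_def)
qed

text \<open>Large \<open>t\<close> forces \<open>c \<ge> 0\<close>; for \<open>c = 0\<close> the
  expression is affine in \<open>t\<close>, which forces \<open>b = 0\<close>; otherwise the
  minimiser \<open>t = b / c\<close> gives the bound. It yields Cauchy-Schwarz both for integrals
  and for abstract forms.\<close>

lemma discriminant_nonneg:
  fixes a b c :: real
  assumes "\<And>t. a - 2 * t * b + t\<^sup>2 * c \<ge> 0"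
  shows "b\<^sup>2 \<le> a * c"
proof (cases "c = 0")
  case True
  have "b = 0"
  proof (rule ccontr)
    assume "b \<noteq> 0"
    \<comment> \<open>At this \<open>t\<close> the expression takes the value
      \<open>-1\<close>.\<close>
    then show False using assms[of "(a + 1) / (2 * b)"] True by simp
  qed
  then show ?thesis using True by simp
next
  case False
  have "c \<ge> 0"
  proof (rule ccontr)
    assume "\<not> c \<ge> 0"
    then have c: "c < 0" by simp
    \<comment> \<open>The fraction makes \<open>t * - c\<close> at least
      \<open>\<bar>a\<bar> + 2 * \<bar>b\<bar> + 1\<close>; the final \<open>+ 1\<close> secures
      \<open>t \<ge> 1\<close>.\<close>
    define t where "t = (\<bar>a\<bar> + 2 * \<bar>b\<bar> + 1) / - c + 1"
    have t: "t \<ge> 1" using c by (simp add: t_def divide_nonneg_neg)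
    have "t * - c \<ge> \<bar>a\<bar> + 2 * \<bar>b\<bar> + 1" using c by (simp add: t_def field_simps)
    then have "t * (t * - c) \<ge> t * (\<bar>a\<bar> + 2 * \<bar>b\<bar> + 1)" using t by (intro mult_left_mono) auto
    moreover have "t * \<bar>a\<bar> \<ge> \<bar>a\<bar>" using t by (simp add: mult_le_cancel_right1)
    moreover have "- (2 * t * b) \<le> t * (2 * \<bar>b\<bar>)" using t by (simp add: abs_if)
    ultimately have "a - 2 * t * b + t\<^sup>2 * c < 0" using t by (simp add: algebra_simps power2_eq_square)
    with assms[of t] show False by simp
  qed
  with False have c: "c > 0" by simp
  have "a - 2 * (b / c) * b + (b / c)\<^sup>2 * c = a - b\<^sup>2 / c"
    using c by (simp add: field_simps power2_eq_square)
  with assms[of "b / c"] have "b\<^sup>2 / c \<le> a" by simp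
  then show ?thesis using c by (simp add: pos_divide_le_eq)
qed

section \<open>Square-integrable functions: Cauchy-Schwarz and Minkowski inequalities\<close>

definition sq_int :: "'a measure \<Rightarrow> ('a \<Rightarrow> real) \<Rightarrow> bool" where
  "sq_int M f \<longleftrightarrow> f \<in> borel_measurable M \<and> integrable M (\<lambda>x. (f x)\<^sup>2)"

definition l2 :: "'a measure \<Rightarrow> ('a \<Rightarrow> real) \<Rightarrow> real" where
  "l2 M f = sqrt (\<integral>x. (f x)\<^sup>2 \<partial>M)"

lemma sq_int_measurable: "sq_int M f \<Longrightarrow> f \<in> borel_measurable M"
  by (simp add: sq_int_def)

lemma l2_nonneg: "l2 M f \<ge> 0"
  by (simp add: l2_def)

lemma l2_sq: "(l2 M f)\<^sup>2 = (\<integral>x. (f x)\<^sup>2 \<partial>M)"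
  by (simp add: l2_def)

lemma l2_le_iff: "l2 M f \<le> c \<longleftrightarrow> (\<integral>x. (f x)\<^sup>2 \<partial>M) \<le> c\<^sup>2" if "c \<ge> 0"
  unfolding l2_def using that by (metis real_sqrt_le_iff real_sqrt_unique)

lemma sq_int_mult:
  assumes "sq_int M f" "sq_int M g"
  shows "integrable M (\<lambda>x. f x * g x)"
proof (rule Bochner_Integration.integrable_bound)
  show "integrable M (\<lambda>x. (f x)\<^sup>2 + (g x)\<^sup>2)" using assms by (simp add: sq_int_def)
  show "(\<lambda>x. f x * g x) \<in> borel_measurable M"
    using assms by (intro borel_measurable_times sq_int_measurable)
  have "\<bar>a * b\<bar> \<le> a\<^sup>2 + b\<^sup>2" for a b :: real
    using sum_squares_bound[of "\<bar>a\<bar>" "\<bar>b\<bar>"] zero_le_power2[of a] zero_le_power2[of b]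
    by (simp only: abs_mult power2_abs)
  then show "AE x in M. norm (f x * g x) \<le> norm ((f x)\<^sup>2 + (g x)\<^sup>2)" by simp
qed

lemma sq_int_diff: "sq_int M f \<Longrightarrow> sq_int M g \<Longrightarrow> sq_int M (\<lambda>x. f x - g x)"
  using sq_int_mult[of M f g] by (auto simp: sq_int_def power2_diff mult.assoc)

lemma Cauchy_Schwarz_integral:
  assumes "sq_int M f" "sq_int M g"
  shows "\<bar>\<integral>x. f x * g x \<partial>M\<bar> \<le> l2 M f * l2 M g"
proof -
  have "(\<integral>x. f x * g x \<partial>M)\<^sup>2 \<le> (\<integral>x. (f x)\<^sup>2 \<partial>M) * (\<integral>x. (g x)\<^sup>2 \<partial>M)"
  proof (rule discriminant_nonneg)
    fix t
    have "0 \<le> (\<integral>x. (f x - t * g x)\<^sup>2 \<partial>M)" by simp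
    also have "\<dots> = (\<integral>x. (f x)\<^sup>2 - 2 * t * (f x * g x) + t\<^sup>2 * (g x)\<^sup>2 \<partial>M)"
      by (intro Bochner_Integration.integral_cong) (auto simp: power2_diff power_mult_distrib)
    also have "\<dots> = (\<integral>x. (f x)\<^sup>2 \<partial>M) - 2 * t * (\<integral>x. f x * g x \<partial>M) + t\<^sup>2 * (\<integral>x. (g x)\<^sup>2 \<partial>M)"
      using assms sq_int_mult[OF assms] by (simp add: sq_int_def)
    finally show "0 \<le> (\<integral>x. (f x)\<^sup>2 \<partial>M) - 2 * t * (\<integral>x. f x * g x \<partial>M) + t\<^sup>2 * (\<integral>x. (g x)\<^sup>2 \<partial>M)" .
  qed
  then have "\<bar>\<integral>x. f x * g x \<partial>M\<bar> \<le> sqrt ((\<integral>x. (f x)\<^sup>2 \<partial>M) * (\<integral>x. (g x)\<^sup>2 \<partial>M))"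
    by (simp add: real_le_rsqrt)
  then show ?thesis by (simp add: l2_def real_sqrt_mult)
qed

lemma l2_triangle:
  assumes "sq_int M f" "sq_int M g"
  shows "l2 M (\<lambda>x. f x + g x) \<le> l2 M f + l2 M g"
proof -
  have "(\<integral>x. (f x + g x)\<^sup>2 \<partial>M) = (\<integral>x. (f x)\<^sup>2 + 2 * (f x * g x) + (g x)\<^sup>2 \<partial>M)"
    by (intro Bochner_Integration.integral_cong) (auto simp: power2_sum)
  also have "\<dots> = (l2 M f)\<^sup>2 + 2 * (\<integral>x. f x * g x \<partial>M) + (l2 M g)\<^sup>2"
    using assms sq_int_mult[OF assms] by (simp add: sq_int_def l2_sq)
  also have "\<dots> \<le> (l2 M f)\<^sup>2 + 2 * (l2 M f * l2 M g) + (l2 M g)\<^sup>2"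
    using Cauchy_Schwarz_integral[OF assms] by simp
  also have "\<dots> = (l2 M f + l2 M g)\<^sup>2" by (simp add: power2_sum)
  finally show ?thesis by (simp add: l2_le_iff l2_nonneg)
qed

section \<open>The transform of integrable functions: bounds and self-adjointness\<close>

lemma sqrt_bessel_bound: "\<alpha> > -1/2 \<Longrightarrow> \<exists>C>0. \<forall>z. \<bar>sqrt_bessel \<alpha> z\<bar> \<le> C"
  by (rule sqrt_bessel_bounded[of \<alpha>]) auto

lemma integrable_mult_sqrt_bessel:
  assumes "\<alpha> > -1/2" "integrable lborel g"
  shows "integrable lborel (\<lambda>x. g x * sqrt_bessel \<alpha> (y * x))"
proof -
  obtain C where C: "C > 0" "\<And>z. \<bar>sqrt_bessel \<alpha> z\<bar> \<le> C" using sqrt_bessel_bound[OF assms(1)] by blast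
  note [measurable] = sqrt_bessel_borel_measurable[OF assms(1)] borel_measurable_integrable[OF assms(2)]
  show ?thesis
  proof (rule Bochner_Integration.integrable_bound)
    show "integrable lborel (\<lambda>x. C * g x)" using assms by simp
    have "\<bar>g x\<bar> * \<bar>sqrt_bessel \<alpha> (y * x)\<bar> \<le> \<bar>g x\<bar> * C" for x
      by (intro mult_left_mono C) auto
    then show "AE x in lborel. norm (g x * sqrt_bessel \<alpha> (y * x)) \<le> norm (C * g x)"
      using C by (simp add: abs_mult mult.commute)
  qed measurable
qed

lemma hankel_measurable:
  assumes "\<alpha> > -1/2" "g \<in> borel_measurable borel"
  shows "hankel \<alpha> g \<in> borel_measurable borel"
proof -
  note [measurable] = sqrt_bessel_borel_measurable[OF assms(1)] assms(2)
  show ?thesis unfolding hankel_def[abs_def] by measurable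
qed

lemma hankel_nonpos:
  assumes "\<And>x. x \<le> 0 \<Longrightarrow> g x = 0" "y \<le> 0"
  shows "hankel \<alpha> g y = 0"
proof -
  have "(\<lambda>x. g x * sqrt_bessel \<alpha> (y * x)) = (\<lambda>x. 0)"
  proof
    fix x show "g x * sqrt_bessel \<alpha> (y * x) = 0"
      using assms by (cases "x \<le> 0") (auto simp: mult_nonpos_nonneg)
  qed
  then show ?thesis by (simp add: hankel_def)
qed

lemma hankel_bounded:
  assumes "\<alpha> > -1/2"
  obtains C where "C > 0" "\<And>g y. integrable lborel g \<Longrightarrow> \<bar>hankel \<alpha> g y\<bar> \<le> C * (\<integral>x. \<bar>g x\<bar> \<partial>lborel)"
proof -
  obtain C where C: "C > 0" "\<And>z. \<bar>sqrt_bessel \<alpha> z\<bar> \<le> C" using sqrt_bessel_bound[OF assms(1)] by blast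
  have "\<bar>hankel \<alpha> g y\<bar> \<le> C * (\<integral>x. \<bar>g x\<bar> \<partial>lborel)" if g: "integrable lborel g" for g y
  proof -
    have "\<bar>hankel \<alpha> g y\<bar> \<le> (\<integral>x. \<bar>g x * sqrt_bessel \<alpha> (y * x)\<bar> \<partial>lborel)"
      unfolding hankel_def by simp
    also have "\<dots> \<le> (\<integral>x. C * \<bar>g x\<bar> \<partial>lborel)"
    proof (rule integral_mono)
      have "\<bar>g x\<bar> * \<bar>sqrt_bessel \<alpha> (y * x)\<bar> \<le> \<bar>g x\<bar> * C" for x
        by (intro mult_left_mono C) auto
      then show "\<bar>g x * sqrt_bessel \<alpha> (y * x)\<bar> \<le> C * \<bar>g x\<bar>" for x
        by (simp add: abs_mult mult.commute)
    qed (use g integrable_mult_sqrt_bessel[OF assms g] in auto)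
    finally show ?thesis by simp
  qed
  then show ?thesis using C that by blast
qed

lemma hankel_diff:
  assumes "\<alpha> > -1/2" "integrable lborel f" "integrable lborel g"
  shows "hankel \<alpha> (\<lambda>x. f x - g x) y = hankel \<alpha> f y - hankel \<alpha> g y"
  unfolding hankel_def using assms by (simp add: left_diff_distrib integrable_mult_sqrt_bessel)

text \<open>Fubini, because the kernel depends only on the product of its arguments. This is the
  duality that carries norm bounds from Gaussians to other functions.\<close>

lemma hankel_symmetric:
  assumes "\<alpha> > -1/2" and f: "integrable lborel f" and g: "integrable lborel g"
  shows "(\<integral>y. hankel \<alpha> f y * g y \<partial>lborel) = (\<integral>x. f x * hankel \<alpha> g x \<partial>lborel)"
proof -
  obtain C where C: "C > 0" "\<And>z. \<bar>sqrt_bessel \<alpha> z\<bar> \<le> C" using sqrt_bessel_bound[OF assms(1)] by blast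
  note [measurable] = sqrt_bessel_borel_measurable[OF assms(1)] borel_measurable_integrable[OF f] borel_measurable_integrable[OF g]
  have p: "integrable (lborel \<Otimes>\<^sub>M lborel) (\<lambda>(x, y). f x * g y)"
    by (rule lborel_pair.Fubini_integrable) (use f g in \<open>auto simp: abs_mult\<close>)
  have "integrable (lborel \<Otimes>\<^sub>M lborel) (\<lambda>(x, y). f x * sqrt_bessel \<alpha> (y * x) * g y)"
  proof (rule Bochner_Integration.integrable_bound)
    show "integrable (lborel \<Otimes>\<^sub>M lborel) (\<lambda>z. C * (case z of (x, y) \<Rightarrow> f x * g y))"
      using p by simp
    have "\<bar>f x\<bar> * \<bar>sqrt_bessel \<alpha> (y * x)\<bar> * \<bar>g y\<bar> \<le> C * (\<bar>f x\<bar> * \<bar>g y\<bar>)" for x y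
      using mult_right_mono[OF C(2)[of "y * x"], of "\<bar>f x\<bar> * \<bar>g y\<bar>"] by (simp add: mult_ac)
    then show "AE z in lborel \<Otimes>\<^sub>M lborel. norm (case z of (x, y) \<Rightarrow> f x * sqrt_bessel \<alpha> (y * x) * g y)
       \<le> norm (C * (case z of (x, y) \<Rightarrow> f x * g y))"
      using C by (auto simp: abs_mult)
  qed measurable
  from lborel_pair.Fubini_integral[OF this]
  have "(\<integral>y. (\<integral>x. f x * sqrt_bessel \<alpha> (y * x) * g y \<partial>lborel) \<partial>lborel) = (\<integral>x. (\<integral>y. f x * sqrt_bessel \<alpha> (y * x) * g y \<partial>lborel) \<partial>lborel)" .
  moreover have "(\<integral>x. f x * sqrt_bessel \<alpha> (y * x) * g y \<partial>lborel) = hankel \<alpha> f y * g y" for y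
    by (simp add: hankel_def)
  moreover have "(\<integral>y. f x * sqrt_bessel \<alpha> (y * x) * g y \<partial>lborel) = f x * hankel \<alpha> g x" for x
    by (simp add: hankel_def mult.assoc mult.commute[of x] mult.commute[of "sqrt_bessel _ _"])
  ultimately show ?thesis by (simp only:)
qed

section \<open>Combinations of Gaussians: invariance, norm identity and density\<close>

definition gauss_comb :: "real \<Rightarrow> nat set \<Rightarrow> (nat \<Rightarrow> real) \<Rightarrow> (nat \<Rightarrow> real) \<Rightarrow> real \<Rightarrow> real" where
  "gauss_comb \<alpha> J a p x = (\<Sum>j\<in>J. a j * gauss_fun \<alpha> (p j) x)"

lemma integrable_gauss_comb:
  assumes "\<alpha> > -1/2" "finite J" "\<And>j. p j > 0"
  shows "integrable lborel (gauss_comb \<alpha> J a p)"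
  unfolding gauss_comb_def[abs_def] using assms
  by (intro Bochner_Integration.integrable_sum integrable_mult_right integrable_gauss_fun) auto

lemma gauss_comb_nonpos: "x \<le> 0 \<Longrightarrow> gauss_comb \<alpha> J a p x = 0"
  by (simp add: gauss_comb_def gauss_fun_def)

lemma gauss_comb_sq:
  assumes "\<alpha> > -1/2" "finite J" "\<And>j. p j > 0"
  shows "has_bochner_integral lborel (\<lambda>x. (gauss_comb \<alpha> J a p x)\<^sup>2)
     (\<Sum>i\<in>J. \<Sum>j\<in>J. a i * a j * ((2 / (p i + p j)) powr (\<alpha> + 1) * Gamma (\<alpha> + 1) / 2))"
proof -
  have "(\<lambda>x. (gauss_comb \<alpha> J a p x)\<^sup>2) = (\<lambda>x. \<Sum>i\<in>J. \<Sum>j\<in>J. a i * a j * (gauss_fun \<alpha> (p i) x * gauss_fun \<alpha> (p j) x))"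
    by (simp add: gauss_comb_def power2_eq_square sum_product mult_ac fun_eq_iff)
  moreover have "has_bochner_integral lborel (\<lambda>x. gauss_fun \<alpha> (p i) x * gauss_fun \<alpha> (p j) x)
     ((2 / (p i + p j)) powr (\<alpha> + 1) * Gamma (\<alpha> + 1) / 2)" for i j
    using assms by (intro has_bochner_integral_gauss_fun_mult) auto
  ultimately show ?thesis
    by (simp only:) (intro has_bochner_integral_sum has_bochner_integral_mult_right)
qed

lemma sq_int_gauss_comb:
  assumes "\<alpha> > -1/2" "finite J" "\<And>j. p j > 0"
  shows "sq_int lborel (gauss_comb \<alpha> J a p)"
  using gauss_comb_sq[OF assms] integrable_gauss_comb[OF assms]
  by (auto simp: sq_int_def has_bochner_integral_iff)

lemma hankel_gauss_comb:
  assumes "\<alpha> > -1/2" "finite J" "\<And>j. p j > 0"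
  shows "hankel \<alpha> (gauss_comb \<alpha> J a p) = gauss_comb \<alpha> J (\<lambda>j. a j * p j powr (- (\<alpha> + 1))) (\<lambda>j. 1 / p j)"
proof
  fix y
  have "hankel \<alpha> (gauss_comb \<alpha> J a p) y = (\<integral>x. (\<Sum>j\<in>J. a j * (gauss_fun \<alpha> (p j) x * sqrt_bessel \<alpha> (y * x))) \<partial>lborel)"
    by (simp add: hankel_def gauss_comb_def sum_distrib_right mult.assoc)
  also have "\<dots> = (\<Sum>j\<in>J. a j * hankel \<alpha> (gauss_fun \<alpha> (p j)) y)"
    unfolding hankel_def using assms
    by (subst Bochner_Integration.integral_sum) (auto intro!: integrable_mult_sqrt_bessel integrable_gauss_fun)
  finally show "hankel \<alpha> (gauss_comb \<alpha> J a p) y = gauss_comb \<alpha> J (\<lambda>j. a j * p j powr (- (\<alpha> + 1))) (\<lambda>j. 1 / p j) y"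
    using assms by (simp add: hankel_gauss_fun gauss_comb_def mult.assoc)
qed

lemma hankel_hankel_gauss_comb:
  assumes "\<alpha> > -1/2" "finite J" "\<And>j. p j > 0"
  shows "hankel \<alpha> (hankel \<alpha> (gauss_comb \<alpha> J a p)) = gauss_comb \<alpha> J a p"
proof -
  have "p j powr (- (\<alpha> + 1)) * (1 / p j) powr (- (\<alpha> + 1)) = 1" for j
    using assms(3)[of j] by (simp flip: powr_mult)
  then have "a j * p j powr (- (\<alpha> + 1)) * (1 / p j) powr (- (\<alpha> + 1)) = a j" for j
    by (metis mult.assoc mult.right_neutral)
  then have "(\<lambda>j. a j * p j powr (- (\<alpha> + 1)) * (1 / p j) powr (- (\<alpha> + 1))) = a" "(\<lambda>j. 1 / (1 / p j)) = p"
    by auto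
  moreover have "0 < 1 / p j" for j using assms(3) by simp
  note hankel_gauss_comb[OF assms(1,2) this]
  ultimately show ?thesis
    by (simp only: hankel_gauss_comb[OF assms])
qed

text \<open>The Gram matrices before and after the transform coincide:
  \<open>2 / (1 / p + 1 / q) = p * q * (2 / (p + q))\<close>, and the powers of \<open>p * q\<close>
  cancel the factors that the transform introduces.\<close>

lemma l2_hankel_gauss_comb:
  assumes "\<alpha> > -1/2" "finite J" "\<And>j. p j > 0"
  shows "l2 lborel (hankel \<alpha> (gauss_comb \<alpha> J a p)) = l2 lborel (gauss_comb \<alpha> J a p)"
proof -
  have eq: "(a i * p i powr (- (\<alpha> + 1))) * (a j * p j powr (- (\<alpha> + 1)))
        * ((2 / (1 / p i + 1 / p j)) powr (\<alpha> + 1) * Gamma (\<alpha> + 1) / 2)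
     = a i * a j * ((2 / (p i + p j)) powr (\<alpha> + 1) * Gamma (\<alpha> + 1) / 2)" for i j
  proof -
    have pp: "p i > 0" "p j > 0" using assms by auto
    have "2 / (1 / u + 1 / v) = u * v * (2 / (u + v))" if "u > 0" "v > 0" for u v :: real
      using that by (simp add: divide_simps)
    from this[OF pp] have "2 / (1 / p i + 1 / p j) = p i * p j * (2 / (p i + p j))" .
    then have e1: "(2 / (1 / p i + 1 / p j)) powr (\<alpha> + 1)
       = p i powr (\<alpha> + 1) * p j powr (\<alpha> + 1) * (2 / (p i + p j)) powr (\<alpha> + 1)"
      using pp by (simp only: powr_mult)
    have e2: "u * (1 / v) * (u' * (1 / v')) * (v * v' * w * g / 2) = u * u' * (w * g / 2)"
      if "v \<noteq> 0" "v' \<noteq> 0" for u u' v v' w g :: real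
      using that by simp
    show ?thesis unfolding e1 powr_minus_divide by (rule e2) (use pp in auto)
  qed
  have "(\<integral>x. (gauss_comb \<alpha> J (\<lambda>j. a j * p j powr (- (\<alpha> + 1))) (\<lambda>j. 1 / p j) x)\<^sup>2 \<partial>lborel) = (\<integral>x. (gauss_comb \<alpha> J a p x)\<^sup>2 \<partial>lborel)"
    using gauss_comb_sq[OF assms, of a] gauss_comb_sq[OF assms(1,2), of "\<lambda>j. 1 / p j" "\<lambda>j. a j * p j powr (- (\<alpha> + 1))"] assms(3)
    by (simp only: eq has_bochner_integral_iff zero_less_divide_1_iff)
  then show ?thesis by (simp add: l2_def hankel_gauss_comb[OF assms])
qed

text \<open>The approximation holds in the mean and in mean square at once, since the transform is
  bounded pointwise by the former and isometric for the latter. Vanishing near \<open>0\<close>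
  permits the later division by a power of \<open>x\<close>.\<close>

lemma continuous_approx:
  fixes g :: "real \<Rightarrow> real"
  assumes [measurable]: "g \<in> borel_measurable borel" and M: "\<And>x. \<bar>g x\<bar> \<le> M"
    and supp: "\<And>x. x \<notin> {0<..R} \<Longrightarrow> g x = 0" and "R > 0" "e > 0"
  obtains h \<delta> where "continuous_on UNIV h" "\<delta> > 0" "\<And>x. x \<le> \<delta> \<Longrightarrow> h x = 0" "\<And>x. x \<ge> 2 * R \<Longrightarrow> h x = 0"
    "integrable lborel h" "sq_int lborel h"
    "(\<integral>x. \<bar>g x - h x\<bar> \<partial>lborel) \<le> e" "l2 lborel (\<lambda>x. g x - h x) \<le> e"
proof -
  have M0: "M \<ge> 0" using M[of 0] by linarith
  \<comment> \<open>A measurable function is an almost everywhere limit of continuous functions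
    \<open>G n\<close>. Truncating these at height \<open>M\<close> and cutting them off makes
    dominated convergence applicable.\<close>
  have "g \<in> borel_measurable (lebesgue_on UNIV)"
    by (simp add: lebesgue_on_UNIV_eq measurable_completion)
  then have "g measurable_on UNIV"
    by (subst measurable_on_iff_borel_measurable) auto
  then obtain N G where N: "negligible N" and G: "\<And>n. continuous_on UNIV (G n)"
    and lim: "\<And>x. x \<notin> N \<Longrightarrow> (\<lambda>n. G n x) \<longlonglongrightarrow> g x"
    unfolding measurable_on_def by auto
  \<comment> \<open>For \<open>n > 0\<close> the first factor rises from \<open>0\<close> at
    \<open>1 / n\<close> to \<open>1\<close> at \<open>2 / n\<close>, the second falls from
    \<open>1\<close> at \<open>R\<close> to \<open>0\<close> at \<open>2 * R\<close>. Hence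
    \<open>cut n\<close> is eventually \<open>1\<close> at each point of
    \<open>(0, R]\<close>.\<close>
  define cut where "cut n x = min 1 (max 0 (real n * x - 1)) * min 1 (max 0 (2 - x / R))" for n x
  define h where "h n x = max (- M) (min M (G n x)) * cut n x" for n x
  have cut01: "0 \<le> cut n x" "cut n x \<le> 1" for n x
    unfolding cut_def by (auto intro!: mult_le_one)
  have cut_big: "cut n x = 0" if "x \<ge> 2 * R" for n x
    using that \<open>R > 0\<close> by (auto simp: cut_def max_def field_simps)
  \<comment> \<open>\<open>Suc n\<close> instead of \<open>n\<close> covers the index
    \<open>0\<close>, where the cutoff vanishes identically.\<close>
  have cut_small: "cut n x = 0" if "x \<le> 1 / real (Suc n)" for n x
  proof -
    have "real n * x \<le> 1"
    proof (cases "x \<le> 0")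
      case True then show ?thesis using mult_nonneg_nonpos[of "real n" x] by simp
    next
      case False
      then have "real n * x \<le> real (Suc n) * x" by (intro mult_right_mono) auto
      also have "\<dots> \<le> 1" using that by (simp add: field_simps)
      finally show ?thesis .
    qed
    then show ?thesis by (simp add: cut_def)
  qed
  have hc: "continuous_on UNIV (h n)" for n
    unfolding h_def cut_def using \<open>R > 0\<close> by (intro continuous_intros G) auto
  then have hm [measurable]: "h n \<in> borel_measurable borel" for n
    by (rule borel_measurable_continuous_onI)
  have hb: "\<bar>h n x\<bar> \<le> M * indicator {0..2 * R} x" for n x
  proof (cases "x \<in> {0..2 * R}")
    case True
    have "\<bar>max (- M) (min M (G n x))\<bar> \<le> M" using M0 by auto
    then have "\<bar>h n x\<bar> \<le> M * 1"
      unfolding h_def abs_mult using cut01[of n x] M0 by (intro mult_mono) auto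
    then show ?thesis using True by simp
  next
    case False
    then have "x \<le> 1 / real (Suc n) \<or> x \<ge> 2 * R"
      by (auto intro: order.trans[of x 0])
    then have "cut n x = 0" using cut_big cut_small by auto
    then show ?thesis using M0 by (simp add: h_def indicator_def)
  qed
  have gb: "\<bar>g x\<bar> \<le> M * indicator {0..2 * R} x" for x
    using M[of x] supp[of x] \<open>R > 0\<close> by (cases "x \<in> {0<..R}") (auto simp: indicator_def)
  have hl: "(\<lambda>n. h n x) \<longlonglongrightarrow> g x" if "x \<notin> N" for x
  proof -
    have "(\<lambda>n. max (- M) (min M (G n x))) \<longlonglongrightarrow> max (- M) (min M (g x))"
      by (intro tendsto_intros lim that)
    also have "max (- M) (min M (g x)) = g x" using M[of x] by (auto simp: abs_le_iff)
    finally have l1: "(\<lambda>n. max (- M) (min M (G n x))) \<longlonglongrightarrow> g x" .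
    show ?thesis
    proof (cases "x \<in> {0<..R}")
      case True
      obtain n0 :: nat where n0: "real n0 \<ge> 2 / x" using real_arch_simple by blast
      have "cut n x = 1" if "n \<ge> n0" for n
      proof -
        have "real n * x \<ge> real n0 * x" using that True by (intro mult_right_mono) auto
        moreover have "real n0 * x \<ge> 2" using n0 True by (simp add: field_simps)
        moreover have "x / R \<le> 1" using True by simp
        ultimately show ?thesis by (simp add: cut_def)
      qed
      then have "eventually (\<lambda>n. h n x = max (- M) (min M (G n x))) sequentially"
        unfolding h_def eventually_sequentially by (intro exI[of _ n0]) auto
      then show ?thesis using l1 by (simp add: tendsto_cong)
    next
      case False
      have "(\<lambda>n. max (- M) (min M (G n x))) \<longlonglongrightarrow> 0" using l1 supp[OF False] by simp
      then have "(\<lambda>n. h n x) \<longlonglongrightarrow> 0"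
      proof (rule Lim_null_comparison[rotated, OF tendsto_rabs_zero])
        show "\<forall>\<^sub>F n in sequentially. norm (h n x) \<le> \<bar>max (- M) (min M (G n x))\<bar>"
          unfolding h_def using cut01[of _ x] by (auto simp: abs_mult intro!: always_eventually mult_left_le)
      qed
      then show ?thesis using supp[OF False] by simp
    qed
  qed
  have int0: "integrable lborel (\<lambda>x. c * indicator {0..2 * R} x :: real)" for c
    by (intro integrable_mult_right integrable_real_indicator) (auto simp: emeasure_lborel_Icc_eq)
  have AEN: "AE x in lborel. x \<notin> N"
  proof -
    have "N \<in> null_sets lebesgue" using N by (simp add: negligible_iff_null_sets)
    then have "AE x in lebesgue. x \<notin> N" by (rule AE_not_in)
    then show ?thesis by (simp add: AE_completion_iff)
  qed
  have db: "\<bar>g x - h n x\<bar> \<le> (2 * M) * indicator {0..2 * R} x" for n x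
    using gb[of x] hb[of n x] by linarith
  have "(\<lambda>n. \<integral>x. \<bar>g x - h n x\<bar> \<partial>lborel) \<longlonglongrightarrow> (\<integral>(x::real). (0::real) \<partial>lborel)"
  proof (rule integral_dominated_convergence[where w="\<lambda>x. 2 * M * indicator {0..2 * R} x"])
    show "AE x in lborel. (\<lambda>n. \<bar>g x - h n x\<bar>) \<longlonglongrightarrow> 0"
      using AEN
    proof eventually_elim
      case (elim x)
      show ?case using tendsto_rabs[OF tendsto_diff[OF tendsto_const[of "g x"] hl[OF elim]]] by simp
    qed
  qed (use db int0 in auto)
  then have c1: "(\<lambda>n. \<integral>x. \<bar>g x - h n x\<bar> \<partial>lborel) \<longlonglongrightarrow> 0" by simp
  have "(\<lambda>n. \<integral>x. (g x - h n x)\<^sup>2 \<partial>lborel) \<longlonglongrightarrow> (\<integral>(x::real). (0::real) \<partial>lborel)"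
  proof (rule integral_dominated_convergence[where w="\<lambda>x. (2 * M)\<^sup>2 * indicator {0..2 * R} x"])
    show "AE x in lborel. (\<lambda>n. (g x - h n x)\<^sup>2) \<longlonglongrightarrow> 0"
      using AEN
    proof eventually_elim
      case (elim x)
      show ?case using tendsto_power[OF tendsto_diff[OF tendsto_const[of "g x"] hl[OF elim]], of 2] by simp
    qed
    have "(g x - h n x)\<^sup>2 \<le> (2 * M)\<^sup>2 * indicator {0..2 * R} x" for n x
      using db[of x n] abs_le_square_iff[of "g x - h n x" "2 * M"] M0
      by (auto simp: indicator_def split: if_splits)
    then show "AE x in lborel. norm ((g x - h n x)\<^sup>2) \<le> (2 * M)\<^sup>2 * indicator {0..2 * R} x" for n
      by simp
  qed (use int0 in auto)
  then have "(\<lambda>n. l2 lborel (\<lambda>x. g x - h n x)) \<longlonglongrightarrow> sqrt 0"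
    unfolding l2_def by (intro tendsto_real_sqrt) simp
  then have c2: "(\<lambda>n. l2 lborel (\<lambda>x. g x - h n x)) \<longlonglongrightarrow> 0" by simp
  have "eventually (\<lambda>n. (\<integral>x. \<bar>g x - h n x\<bar> \<partial>lborel) < e \<and> l2 lborel (\<lambda>x. g x - h n x) < e) sequentially"
    using order_tendstoD(2)[OF c1 \<open>e > 0\<close>] order_tendstoD(2)[OF c2 \<open>e > 0\<close>] by (rule eventually_conj)
  then obtain n where n: "(\<integral>x. \<bar>g x - h n x\<bar> \<partial>lborel) < e" "l2 lborel (\<lambda>x. g x - h n x) < e"
    by (auto simp: eventually_sequentially)
  show ?thesis
  proof (rule that[of "h n" "1 / real (Suc n)"])
    show "integrable lborel (h n)"
      by (rule Bochner_Integration.integrable_bound[OF int0[of M]]) (use hb M0 in auto)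
    have "(h n x)\<^sup>2 \<le> M\<^sup>2 * indicator {0..2 * R} x" for x
      using hb[of n x] abs_le_square_iff[of "h n x" M] M0
      by (auto simp: indicator_def split: if_splits)
    then show "sq_int lborel (h n)"
      unfolding sq_int_def
      by (intro conjI Bochner_Integration.integrable_bound[OF int0[of "M\<^sup>2"]]) (auto simp: M0)
  qed (use hc n cut_small cut_big in \<open>auto simp: h_def\<close>)
qed

text \<open>With \<open>s = exp (- x\<^sup>2 / 2)\<close>, the Gaussian of parameter
  \<open>i + 1\<close> is \<open>s ^ i\<close> times the one of parameter \<open>1\<close>.
  Combinations are thus polynomials in \<open>s\<close> with weight
  \<open>gauss_fun \<alpha> 1\<close>, and since \<open>h\<close> vanishes near \<open>0\<close> and
  from \<open>T\<close> on, \<open>h\<close> divided by the weight is continuous in \<open>s\<close>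
  on \<open>[0, 1]\<close>. The error bound inherits the weight.\<close>

lemma gauss_comb_weierstrass:
  assumes "\<alpha> > -1/2" and h: "continuous_on UNIV h" "\<delta> > 0" "\<And>x. x \<le> \<delta> \<Longrightarrow> h x = 0" "\<And>x. x \<ge> T \<Longrightarrow> h x = 0"
    and "e > 0" "T > 0"
  obtains n a where "\<And>x. \<bar>h x - gauss_comb \<alpha> {..n} a (\<lambda>i. real i + 1) x\<bar> \<le> e * gauss_fun \<alpha> 1 x"
proof -
  define b where "b = \<alpha> + 1/2"
  \<comment> \<open>\<open>Q\<close> is \<open>h\<close> divided by the weight, the maximum with
    \<open>\<delta>\<close> being harmless as \<open>h\<close> vanishes up to
    \<open>\<delta>\<close>. \<open>q\<close> is \<open>Q\<close> read in the variable
    \<open>s\<close>, frozen below \<open>s0\<close>, the value of \<open>s\<close> at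
    \<open>x = T\<close>, where \<open>Q\<close> is already \<open>0\<close>.\<close>
  define Q where "Q x = h x * max x \<delta> powr (- b) * exp (x\<^sup>2 / 2)" for x
  define s0 where "s0 = exp (- (T\<^sup>2 / 2))"
  define q where "q s = Q (sqrt (- 2 * ln (max s s0)))" for s
  have s0: "0 < s0" "s0 \<le> 1" using \<open>T > 0\<close> by (auto simp: s0_def)
  have Qc: "continuous_on UNIV Q"
    unfolding Q_def using \<open>\<delta> > 0\<close> by (intro continuous_intros h(1)) auto
  have "continuous_on {0..1} (\<lambda>s. sqrt (- 2 * ln (max s s0)))"
    using s0 by (intro continuous_intros) auto
  then have qc: "continuous_on {0..1} q"
    unfolding q_def by (rule continuous_on_compose2[OF Qc]) auto
  obtain P where P: "real_polynomial_function P" "\<And>s. s \<in> {0..1} \<Longrightarrow> \<bar>q s - P s\<bar> < e"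
    using Stone_Weierstrass_real_polynomial_function[OF _ qc \<open>e > 0\<close>] by auto
  obtain a n where a: "P = (\<lambda>x. \<Sum>i\<le>n. a i * x ^ i)"
    using P(1) by (auto simp: real_polynomial_function_iff_sum)
  show ?thesis
  proof
    fix x
    show "\<bar>h x - gauss_comb \<alpha> {..n} a (\<lambda>i. real i + 1) x\<bar> \<le> e * gauss_fun \<alpha> 1 x"
    proof (cases "x > 0")
      case False
      then show ?thesis using h(3)[of x] \<open>\<delta> > 0\<close> by (simp add: gauss_comb_def gauss_fun_def)
    next
      case x: True
      define s where "s = exp (- (x\<^sup>2 / 2))"
      have s: "s \<in> {0..1}" by (simp add: s_def)
      have Qz: "Q y = 0" if "y \<ge> T" for y using h(4)[OF that] by (simp add: Q_def)
      have "q s = Q x"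
      proof (cases "x \<le> T")
        case True
        then have "s \<ge> s0" using x by (auto simp: s_def s0_def)
        then show ?thesis using x by (simp add: q_def s_def max_def)
      next
        case False
        then have "s \<le> s0" using x \<open>T > 0\<close> by (auto simp: s_def s0_def)
        then have "q s = Q T" using \<open>T > 0\<close> by (simp add: q_def s0_def max_def)
        then show ?thesis using Qz False by simp
      qed
      then have "\<bar>Q x - P s\<bar> \<le> e" using P(2)[OF s] by simp
      moreover have g: "gauss_fun \<alpha> 1 x \<ge> 0" by (rule gauss_fun_nonneg)
      ultimately have "gauss_fun \<alpha> 1 x * \<bar>Q x - P s\<bar> \<le> gauss_fun \<alpha> 1 x * e" by (intro mult_left_mono)
      moreover have "gauss_fun \<alpha> 1 x * Q x = h x"
      proof (cases "x \<le> \<delta>")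
        case False
        then show ?thesis using x
          by (simp add: gauss_fun_def Q_def b_def max_def powr_minus exp_minus field_simps)
      qed (simp add: Q_def h)
      moreover have "gauss_fun \<alpha> 1 x * P s = gauss_comb \<alpha> {..n} a (\<lambda>i. real i + 1) x"
      proof -
        have "gauss_fun \<alpha> 1 x * s ^ i = gauss_fun \<alpha> (real i + 1) x" for i
        proof -
          have "s ^ i = exp (- real i * x\<^sup>2 / 2)" by (simp add: s_def flip: exp_of_nat_mult)
          moreover have "- (real i + 1) * x\<^sup>2 / 2 = - 1 * x\<^sup>2 / 2 + - real i * x\<^sup>2 / 2" by (simp add: field_simps)
          ultimately show ?thesis using x unfolding gauss_fun_def by (simp only: exp_add) simp
        qed
        then have "gauss_fun \<alpha> 1 x * (a i * s ^ i) = a i * gauss_fun \<alpha> (real i + 1) x" for i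
          by (metis mult.left_commute)
        then show ?thesis by (simp only: a gauss_comb_def sum_distrib_left)
      qed
      moreover have "\<bar>gauss_fun \<alpha> 1 x * Q x - gauss_fun \<alpha> 1 x * P s\<bar> = gauss_fun \<alpha> 1 x * \<bar>Q x - P s\<bar>"
        using g by (simp add: abs_mult flip: right_diff_distrib)
      ultimately show ?thesis by (simp add: mult.commute)
    qed
  qed
qed

lemma gauss_comb_dense:
  assumes "\<alpha> > -1/2" and g: "g \<in> borel_measurable borel" "\<And>x. \<bar>g x\<bar> \<le> M"
    "\<And>x. x \<notin> {0<..R} \<Longrightarrow> g x = 0" and "e > 0"
  obtains n a where "(\<integral>x. \<bar>g x - gauss_comb \<alpha> {..n} a (\<lambda>i. real i + 1) x\<bar> \<partial>lborel) \<le> e"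
    "l2 lborel (\<lambda>x. g x - gauss_comb \<alpha> {..n} a (\<lambda>i. real i + 1) x) \<le> e"
    "integrable lborel g" "sq_int lborel g"
proof -
  define R' where "R' = max R 1"
  have R': "R' > 0" "\<And>x. x \<notin> {0<..R'} \<Longrightarrow> g x = 0"
  proof -
    fix x assume "x \<notin> {0<..R'}"
    then have "x \<notin> {0<..R}" by (auto simp: R'_def)
    then show "g x = 0" by (rule g(3))
  qed (simp add: R'_def)
  define e2 where "e2 = e / 2"
  have e2: "e2 > 0" using \<open>e > 0\<close> by (simp add: e2_def)
  obtain h \<delta> where h: "continuous_on UNIV h" "\<delta> > 0" "\<And>x. x \<le> \<delta> \<Longrightarrow> h x = 0" "\<And>x. x \<ge> 2 * R' \<Longrightarrow> h x = 0"
    "integrable lborel h" "sq_int lborel h"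
    "(\<integral>x. \<bar>g x - h x\<bar> \<partial>lborel) \<le> e2" "l2 lborel (\<lambda>x. g x - h x) \<le> e2"
    using continuous_approx[OF g(1,2) R'(2) R'(1) e2] by blast
  have int0: "integrable lborel (\<lambda>x. c * indicator {0..R'} x :: real)" for c
    by (intro integrable_mult_right integrable_real_indicator) (auto simp: emeasure_lborel_Icc_eq)
  have M0: "M \<ge> 0" using g(2)[of 0] by linarith
  have gb: "\<bar>g x\<bar> \<le> M * indicator {0..R'} x" for x
    using g(2)[of x] R'(2)[of x] by (cases "x \<in> {0<..R'}") (auto simp: indicator_def)
  have gi: "integrable lborel g"
    by (rule Bochner_Integration.integrable_bound[OF int0[of M]]) (use g gb M0 in auto)
  have "(g x)\<^sup>2 \<le> M\<^sup>2 * indicator {0..R'} x" for x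
    using gb[of x] abs_le_square_iff[of "g x" M] M0
    by (auto simp: indicator_def split: if_splits)
  then have gs: "sq_int lborel g"
    unfolding sq_int_def using g(1)
    by (intro conjI Bochner_Integration.integrable_bound[OF int0[of "M\<^sup>2"]]) (auto simp: M0)
  have G: "integrable lborel (gauss_fun \<alpha> 1)" "sq_int lborel (gauss_fun \<alpha> 1)"
    using integrable_gauss_fun[OF assms(1), of 1] has_bochner_integral_gauss_fun_mult[of \<alpha> 1 1] assms(1)
    by (auto simp: sq_int_def has_bochner_integral_iff power2_eq_square)
  \<comment> \<open>\<open>c\<close> dominates both norms of the weight, so one choice of
    \<open>\<eta>\<close> controls both errors; the summand \<open>1\<close> keeps it
    positive.\<close>
  define c where "c = 1 + (\<integral>x. gauss_fun \<alpha> 1 x \<partial>lborel) + l2 lborel (gauss_fun \<alpha> 1)"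
  have c: "c > 0" "(\<integral>x. gauss_fun \<alpha> 1 x \<partial>lborel) \<le> c" "l2 lborel (gauss_fun \<alpha> 1) \<le> c"
    using l2_nonneg[of lborel "gauss_fun \<alpha> 1"] Bochner_Integration.integral_nonneg[of lborel "gauss_fun \<alpha> 1", OF gauss_fun_nonneg]
    by (auto simp: c_def)
  define \<eta> where "\<eta> = e2 / c"
  have \<eta>: "\<eta> > 0" "\<eta> * c = e2" using c e2 by (auto simp: \<eta>_def)
  obtain n a where na: "\<And>x. \<bar>h x - gauss_comb \<alpha> {..n} a (\<lambda>i. real i + 1) x\<bar> \<le> \<eta> * gauss_fun \<alpha> 1 x"
    using gauss_comb_weierstrass[OF assms(1) h(1-4) \<eta>(1) mult_pos_pos[OF zero_less_numeral R'(1)]] by blast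
  define \<phi> where "\<phi> = gauss_comb \<alpha> {..n} a (\<lambda>i. real i + 1)"
  have \<phi>: "integrable lborel \<phi>" "sq_int lborel \<phi>"
    unfolding \<phi>_def by (intro integrable_gauss_comb sq_int_gauss_comb; use assms(1) in simp)+
  have "(\<integral>x. \<bar>g x - \<phi> x\<bar> \<partial>lborel) \<le> (\<integral>x. \<bar>g x - h x\<bar> + \<eta> * gauss_fun \<alpha> 1 x \<partial>lborel)"
  proof (rule integral_mono)
    show "\<bar>g x - \<phi> x\<bar> \<le> \<bar>g x - h x\<bar> + \<eta> * gauss_fun \<alpha> 1 x" for x
      using na[of x] unfolding \<phi>_def by linarith
  qed (use gi h \<phi> G in auto)
  also have "\<dots> = (\<integral>x. \<bar>g x - h x\<bar> \<partial>lborel) + \<eta> * (\<integral>x. gauss_fun \<alpha> 1 x \<partial>lborel)"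
    using gi h G by simp
  also have "\<dots> \<le> e2 + \<eta> * c" using h c \<eta> by (intro add_mono mult_left_mono) auto
  also have "\<dots> = e" by (simp add: \<eta> e2_def)
  finally have A: "(\<integral>x. \<bar>g x - \<phi> x\<bar> \<partial>lborel) \<le> e" .
  have "l2 lborel (\<lambda>x. h x - \<phi> x) \<le> \<eta> * l2 lborel (gauss_fun \<alpha> 1)"
  proof (subst l2_le_iff)
    show "0 \<le> \<eta> * l2 lborel (gauss_fun \<alpha> 1)" using \<eta> by (simp add: l2_nonneg)
    have "(\<integral>x. (h x - \<phi> x)\<^sup>2 \<partial>lborel) \<le> (\<integral>x. \<eta>\<^sup>2 * (gauss_fun \<alpha> 1 x)\<^sup>2 \<partial>lborel)"
    proof (rule integral_mono)
      show "(h x - \<phi> x)\<^sup>2 \<le> \<eta>\<^sup>2 * (gauss_fun \<alpha> 1 x)\<^sup>2" for x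
        using power_mono[OF na[of x], of 2] by (simp add: \<phi>_def power_mult_distrib)
    qed (use sq_int_diff[OF h(6) \<phi>(2)] G in \<open>auto simp: sq_int_def\<close>)
    then show "(\<integral>x. (h x - \<phi> x)\<^sup>2 \<partial>lborel) \<le> (\<eta> * l2 lborel (gauss_fun \<alpha> 1))\<^sup>2"
      by (simp add: power_mult_distrib l2_sq)
  qed
  also have "\<dots> \<le> \<eta> * c" using c \<eta> by (intro mult_left_mono) auto
  finally have "l2 lborel (\<lambda>x. h x - \<phi> x) \<le> e2" using \<eta> by simp
  moreover have "l2 lborel (\<lambda>x. (g x - h x) + (h x - \<phi> x)) \<le> l2 lborel (\<lambda>x. g x - h x) + l2 lborel (\<lambda>x. h x - \<phi> x)"
    by (intro l2_triangle sq_int_diff gs h \<phi>)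
  ultimately have B: "l2 lborel (\<lambda>x. g x - \<phi> x) \<le> e" using h(8) by (simp add: e2_def)
  show ?thesis using that[of n a] A B gi gs by (simp add: \<phi>_def)
qed

section \<open>Duality and density: the isometry for bounded functions of bounded support\<close>

lemma gauss_comb_succ:
  fixes n :: nat and a :: "nat \<Rightarrow> real"
  assumes "\<alpha> > -1/2"
  defines "\<phi> \<equiv> gauss_comb \<alpha> {..n} a (\<lambda>i. real i + 1)"
  shows "integrable lborel \<phi>" "sq_int lborel \<phi>" "integrable lborel (hankel \<alpha> \<phi>)" "sq_int lborel (hankel \<alpha> \<phi>)"
    "l2 lborel (hankel \<alpha> \<phi>) = l2 lborel \<phi>" "hankel \<alpha> (hankel \<alpha> \<phi>) = \<phi>"
proof -
  have p: "real j + 1 > 0" "1 / (real j + 1) > 0" for j :: nat by auto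
  show "integrable lborel \<phi>" "sq_int lborel \<phi>" "l2 lborel (hankel \<alpha> \<phi>) = l2 lborel \<phi>" "hankel \<alpha> (hankel \<alpha> \<phi>) = \<phi>"
    unfolding \<phi>_def using assms(1) p
    by (intro integrable_gauss_comb sq_int_gauss_comb l2_hankel_gauss_comb hankel_hankel_gauss_comb; simp)+
  show "integrable lborel (hankel \<alpha> \<phi>)" "sq_int lborel (hankel \<alpha> \<phi>)"
    unfolding \<phi>_def hankel_gauss_comb[OF assms(1) finite_atMost p(1)]
    by (intro integrable_gauss_comb sq_int_gauss_comb assms(1) p finite_atMost)+
qed

text \<open>Replace \<open>w\<close> by a Gaussian combination and move the transform onto it, where
  its norm is known. The remainder is small in the mean, and \<open>hankel \<alpha> g\<close> is
  bounded, so its contribution is small too.\<close>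

lemma hankel_pairing_bound:
  assumes \<alpha>: "\<alpha> > -1/2" and g: "integrable lborel g" "sq_int lborel g"
    and w: "w \<in> borel_measurable borel" "\<And>x. \<bar>w x\<bar> \<le> M" "\<And>x. x \<notin> {0<..R} \<Longrightarrow> w x = 0"
  shows "\<bar>\<integral>y. hankel \<alpha> g y * w y \<partial>lborel\<bar> \<le> l2 lborel g * l2 lborel w"
proof -
  obtain C where C: "C > 0" "\<And>g y. integrable lborel g \<Longrightarrow> \<bar>hankel \<alpha> g y\<bar> \<le> C * (\<integral>x. \<bar>g x\<bar> \<partial>lborel)"
    using hankel_bounded[OF \<alpha>] by blast
  define D where "D = C * (\<integral>x. \<bar>g x\<bar> \<partial>lborel)"
  have D: "\<bar>hankel \<alpha> g y\<bar> \<le> D" for y using C(2)[OF g(1)] by (simp add: D_def)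
  note [measurable] = hankel_measurable[OF \<alpha> borel_measurable_integrable[OF g(1), simplified]]
  have le: "\<bar>\<integral>y. hankel \<alpha> g y * w y \<partial>lborel\<bar> \<le> l2 lborel g * (l2 lborel w + e) + D * e" if "e > 0" for e
  proof -
    obtain n a where na: "(\<integral>x. \<bar>w x - gauss_comb \<alpha> {..n} a (\<lambda>i. real i + 1) x\<bar> \<partial>lborel) \<le> e"
      "l2 lborel (\<lambda>x. w x - gauss_comb \<alpha> {..n} a (\<lambda>i. real i + 1) x) \<le> e"
      "integrable lborel w" "sq_int lborel w"
      using gauss_comb_dense[OF \<alpha> w \<open>e > 0\<close>] by blast
    define \<phi> where "\<phi> = gauss_comb \<alpha> {..n} a (\<lambda>i. real i + 1)"
    have \<phi>: "integrable lborel \<phi>" "sq_int lborel \<phi>" "l2 lborel (hankel \<alpha> \<phi>) = l2 lborel \<phi>" "sq_int lborel (hankel \<alpha> \<phi>)"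
      unfolding \<phi>_def by (intro gauss_comb_succ \<alpha>)+
    have bm: "integrable lborel (\<lambda>y. hankel \<alpha> g y * f y)" if f: "integrable lborel f" for f
    proof (rule Bochner_Integration.integrable_bound)
      show "integrable lborel (\<lambda>y. D * \<bar>f y\<bar>)" using f by simp
      show "(\<lambda>y. hankel \<alpha> g y * f y) \<in> borel_measurable lborel"
        using borel_measurable_integrable[OF f] by measurable
      show "AE y in lborel. norm (hankel \<alpha> g y * f y) \<le> norm (D * \<bar>f y\<bar>)"
        using order.trans[OF D abs_ge_self] by (auto simp: abs_mult intro!: mult_right_mono)
    qed
    have "(\<integral>y. hankel \<alpha> g y * w y \<partial>lborel) =
        (\<integral>y. hankel \<alpha> g y * \<phi> y \<partial>lborel) + (\<integral>y. hankel \<alpha> g y * (w y - \<phi> y) \<partial>lborel)"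
      using bm[OF na(3)] bm[OF \<phi>(1)] by (simp add: right_diff_distrib)
    moreover have "\<bar>\<integral>y. hankel \<alpha> g y * \<phi> y \<partial>lborel\<bar> \<le> l2 lborel g * (l2 lborel w + e)"
    proof -
      have "\<bar>\<integral>y. hankel \<alpha> g y * \<phi> y \<partial>lborel\<bar> = \<bar>\<integral>x. g x * hankel \<alpha> \<phi> x \<partial>lborel\<bar>"
        by (simp add: hankel_symmetric[OF \<alpha> g(1) \<phi>(1)])
      also have "\<dots> \<le> l2 lborel g * l2 lborel \<phi>"
        using Cauchy_Schwarz_integral[OF g(2) \<phi>(4)] by (simp add: \<phi>(3))
      also have "l2 lborel \<phi> \<le> l2 lborel w + l2 lborel (\<lambda>x. \<phi> x - w x)"
        using l2_triangle[OF na(4) sq_int_diff[OF \<phi>(2) na(4)]] by simp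
      also have "l2 lborel (\<lambda>x. \<phi> x - w x) = l2 lborel (\<lambda>x. w x - \<phi> x)"
        by (simp add: l2_def power2_commute)
      also have "\<dots> \<le> e" using na(2) by (simp add: \<phi>_def)
      finally show ?thesis by (simp add: l2_nonneg mult_left_mono)
    qed
    moreover have "\<bar>\<integral>y. hankel \<alpha> g y * (w y - \<phi> y) \<partial>lborel\<bar> \<le> D * e"
    proof -
      have "\<bar>\<integral>y. hankel \<alpha> g y * (w y - \<phi> y) \<partial>lborel\<bar> \<le> (\<integral>y. \<bar>hankel \<alpha> g y * (w y - \<phi> y)\<bar> \<partial>lborel)"
        by simp
      also have "\<dots> \<le> (\<integral>y. D * \<bar>w y - \<phi> y\<bar> \<partial>lborel)"
      proof (rule integral_mono)
        show "integrable lborel (\<lambda>y. \<bar>hankel \<alpha> g y * (w y - \<phi> y)\<bar>)"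
          using bm[of "\<lambda>y. w y - \<phi> y"] na(3) \<phi>(1) by simp
        show "integrable lborel (\<lambda>y. D * \<bar>w y - \<phi> y\<bar>)" using na(3) \<phi>(1) by simp
        show "\<bar>hankel \<alpha> g y * (w y - \<phi> y)\<bar> \<le> D * \<bar>w y - \<phi> y\<bar>" for y
          unfolding abs_mult by (intro mult_right_mono D) auto
      qed
      also have "\<dots> \<le> D * e"
        using na(1) D[of 0] by (simp add: \<phi>_def mult_left_mono)
      finally show ?thesis .
    qed
    ultimately show ?thesis by linarith
  qed
  have "((\<lambda>e. l2 lborel g * (l2 lborel w + e) + D * e) \<longlongrightarrow> l2 lborel g * (l2 lborel w + 0) + D * 0) (at_right 0)"
    by (intro tendsto_intros)
  then have "\<bar>\<integral>y. hankel \<alpha> g y * w y \<partial>lborel\<bar> \<le> l2 lborel g * (l2 lborel w + 0) + D * 0"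
    by (rule tendsto_lowerbound) (auto simp: eventually_at_right_less intro!: eventually_at_rightI[of 0 1] le)
  then show ?thesis by simp
qed

text \<open>The pairing bound is tested with the transform itself, cut to \<open>(0, n]\<close>: the
  squared norm of the cut function is at most its norm times that of \<open>g\<close>. Monotone
  convergence then gives square integrability together with the bound.\<close>

lemma hankel_contraction:
  assumes \<alpha>: "\<alpha> > -1/2" and g: "integrable lborel g" "sq_int lborel g" "\<And>x. x \<le> 0 \<Longrightarrow> g x = 0"
  shows "sq_int lborel (hankel \<alpha> g)" and "l2 lborel (hankel \<alpha> g) \<le> l2 lborel g"
proof -
  obtain C where C: "C > 0" "\<And>g y. integrable lborel g \<Longrightarrow> \<bar>hankel \<alpha> g y\<bar> \<le> C * (\<integral>x. \<bar>g x\<bar> \<partial>lborel)"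
    using hankel_bounded[OF \<alpha>] by blast
  define D where "D = C * (\<integral>x. \<bar>g x\<bar> \<partial>lborel)"
  have D: "\<bar>hankel \<alpha> g y\<bar> \<le> D" for y using C(2)[OF g(1)] by (simp add: D_def)
  have D0: "D \<ge> 0" using D[of 0] by linarith
  define F where "F = hankel \<alpha> g"
  have [measurable]: "F \<in> borel_measurable borel"
    unfolding F_def using hankel_measurable[OF \<alpha> borel_measurable_integrable[OF g(1), simplified]] .
  define w where "w n y = F y * indicator {0<..real n} y" for n y
  have wm [measurable]: "w n \<in> borel_measurable borel" for n
    unfolding w_def[abs_def] by measurable
  have wb: "\<bar>w n y\<bar> \<le> D" for n y
    using D[of y] D0 by (auto simp: w_def F_def indicator_def)
  have ws: "sq_int lborel (w n)" for n
  proof -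
    have "w n y = 0" if "y \<notin> {0<..real n}" for y using that by (simp add: w_def)
    from gauss_comb_dense[OF \<alpha> wm[of n] wb[of n] this zero_less_one] show ?thesis by blast
  qed
  have le: "(\<integral>y. (w n y)\<^sup>2 \<partial>lborel) \<le> (l2 lborel g)\<^sup>2" for n
  proof -
    have "\<bar>\<integral>y. F y * w n y \<partial>lborel\<bar> \<le> l2 lborel g * l2 lborel (w n)"
      unfolding F_def by (rule hankel_pairing_bound[OF \<alpha> g(1,2) wm[of n] wb[of n], of "real n"]) (simp add: w_def)
    moreover have "F y * w n y = (w n y)\<^sup>2" for y
      by (auto simp: w_def indicator_def power2_eq_square)
    ultimately have "(l2 lborel (w n))\<^sup>2 \<le> l2 lborel g * l2 lborel (w n)" by (simp add: l2_sq)
    then have "l2 lborel (w n) \<le> l2 lborel g"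
      using l2_nonneg[of lborel "w n"] l2_nonneg[of lborel g]
      by (cases "l2 lborel (w n) = 0") (auto simp: power2_eq_square)
    then show ?thesis using l2_nonneg[of lborel g] by (simp add: l2_le_iff)
  qed
  have mono: "mono (\<lambda>n. (w n y)\<^sup>2)" for y
    by (auto simp: mono_def w_def indicator_def)
  have lim: "(\<lambda>n. (w n y)\<^sup>2) \<longlonglongrightarrow> (F y)\<^sup>2" for y
  proof (cases "y \<le> 0")
    case True
    then have "F y = 0" unfolding F_def using g(3) by (intro hankel_nonpos)
    then show ?thesis by (simp add: w_def)
  next
    case False
    obtain n0 :: nat where "real n0 \<ge> y" using real_arch_simple by blast
    then have "(w n y)\<^sup>2 = (F y)\<^sup>2" if "n \<ge> n0" for n
      using that False by (auto simp: w_def indicator_def)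
    then show ?thesis by (intro tendsto_eventually eventually_sequentiallyI[of n0])
  qed
  have "incseq (\<lambda>n. \<integral>y. (w n y)\<^sup>2 \<partial>lborel)"
    using mono ws by (intro monoI integral_mono) (auto simp: sq_int_def mono_def)
  then obtain L where L: "(\<lambda>n. \<integral>y. (w n y)\<^sup>2 \<partial>lborel) \<longlonglongrightarrow> L"
    by (rule incseq_convergent[where B="(l2 lborel g)\<^sup>2"]) (use le in auto)
  have 1: "integrable lborel (\<lambda>y. (F y)\<^sup>2)" and 2: "(\<integral>y. (F y)\<^sup>2 \<partial>lborel) = L"
    using integrable_monotone_convergence[of lborel "\<lambda>n y. (w n y)\<^sup>2" "\<lambda>y. (F y)\<^sup>2" L]
      integral_monotone_convergence[of lborel "\<lambda>n y. (w n y)\<^sup>2" "\<lambda>y. (F y)\<^sup>2" L] ws mono lim L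
    by (auto simp: sq_int_def)
  show "sq_int lborel (hankel \<alpha> g)" using 1 by (simp add: sq_int_def F_def[symmetric])
  have "L \<le> (l2 lborel g)\<^sup>2" using L le by (intro LIMSEQ_le_const2) auto
  then show "l2 lborel (hankel \<alpha> g) \<le> l2 lborel g"
    using 2 by (simp add: l2_le_iff l2_nonneg F_def)
qed

text \<open>The contraction bound for \<open>g - \<phi>\<close> carries the approximation over to
  the transforms. The approximants come with integrable transforms and the inversion formula, from
  which \<open>has_hankel_transform\<close> will be verified.\<close>

lemma hankel_approx:
  assumes \<alpha>: "\<alpha> > -1/2" and g: "g \<in> borel_measurable borel" "\<And>x. \<bar>g x\<bar> \<le> M" "\<And>x. x \<notin> {0<..R} \<Longrightarrow> g x = 0"
    and "e > 0"
  obtains \<phi> where "integrable lborel \<phi>" "sq_int lborel \<phi>" "\<And>x. x \<le> 0 \<Longrightarrow> \<phi> x = 0"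
    "integrable lborel (hankel \<alpha> \<phi>)" "sq_int lborel (hankel \<alpha> \<phi>)" "hankel \<alpha> (hankel \<alpha> \<phi>) = \<phi>"
    "l2 lborel (hankel \<alpha> \<phi>) = l2 lborel \<phi>"
    "l2 lborel (\<lambda>x. g x - \<phi> x) \<le> e" "l2 lborel (\<lambda>x. hankel \<alpha> g x - hankel \<alpha> \<phi> x) \<le> e"
    "integrable lborel g" "sq_int lborel g" "sq_int lborel (hankel \<alpha> g)"
proof -
  obtain n a where na: "l2 lborel (\<lambda>x. g x - gauss_comb \<alpha> {..n} a (\<lambda>i. real i + 1) x) \<le> e"
    "integrable lborel g" "sq_int lborel g"
    using gauss_comb_dense[OF \<alpha> g \<open>e > 0\<close>] by blast
  define \<phi> where "\<phi> = gauss_comb \<alpha> {..n} a (\<lambda>i. real i + 1)"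
  have \<phi>: "integrable lborel \<phi>" "sq_int lborel \<phi>" "l2 lborel (hankel \<alpha> \<phi>) = l2 lborel \<phi>"
     "integrable lborel (hankel \<alpha> \<phi>)" "sq_int lborel (hankel \<alpha> \<phi>)" "hankel \<alpha> (hankel \<alpha> \<phi>) = \<phi>"
    unfolding \<phi>_def by (intro gauss_comb_succ \<alpha>)+
  have g0: "x \<le> 0 \<Longrightarrow> g x = 0" for x using g(3)[of x] by simp
  have \<phi>0: "x \<le> 0 \<Longrightarrow> \<phi> x = 0" for x by (simp add: \<phi>_def gauss_comb_nonpos)
  have "l2 lborel (hankel \<alpha> (\<lambda>x. g x - \<phi> x)) \<le> l2 lborel (\<lambda>x. g x - \<phi> x)"
    using na \<phi> g0 \<phi>0 by (intro hankel_contraction sq_int_diff \<alpha>) auto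
  also have "hankel \<alpha> (\<lambda>x. g x - \<phi> x) = (\<lambda>x. hankel \<alpha> g x - hankel \<alpha> \<phi> x)"
    using hankel_diff[OF \<alpha> na(2) \<phi>(1)] by auto
  finally have "l2 lborel (\<lambda>x. hankel \<alpha> g x - hankel \<alpha> \<phi> x) \<le> e" using na(1) by (simp add: \<phi>_def)
  then show ?thesis
    using that[of \<phi>] na \<phi> \<phi>0 hankel_contraction(1)[OF \<alpha> na(2,3) g0] by (simp add: \<phi>_def)
qed

lemma hankel_isometry:
  assumes \<alpha>: "\<alpha> > -1/2" and g: "g \<in> borel_measurable borel" "\<And>x. \<bar>g x\<bar> \<le> M" "\<And>x. x \<notin> {0<..R} \<Longrightarrow> g x = 0"
  shows "sq_int lborel (hankel \<alpha> g)" and "l2 lborel (hankel \<alpha> g) = l2 lborel g"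
proof -
  have le: "\<bar>l2 lborel (hankel \<alpha> g) - l2 lborel g\<bar> \<le> 2 * e" if e: "e > 0" for e
  proof -
    obtain \<phi> where \<phi>: "integrable lborel \<phi>" "sq_int lborel \<phi>"
      "sq_int lborel (hankel \<alpha> \<phi>)" "l2 lborel (hankel \<alpha> \<phi>) = l2 lborel \<phi>"
      "l2 lborel (\<lambda>x. g x - \<phi> x) \<le> e" "l2 lborel (\<lambda>x. hankel \<alpha> g x - hankel \<alpha> \<phi> x) \<le> e"
      "sq_int lborel g" "sq_int lborel (hankel \<alpha> g)"
      using hankel_approx[OF \<alpha> g e] by blast
    have tri: "\<bar>l2 lborel f - l2 lborel h\<bar> \<le> l2 lborel (\<lambda>x. f x - h x)" if "sq_int lborel f" "sq_int lborel h" for f h :: "real \<Rightarrow> real"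
    proof -
      have "l2 lborel (\<lambda>x. h x - f x) = l2 lborel (\<lambda>x. f x - h x)"
        by (simp add: l2_def power2_commute)
      then show ?thesis
        using l2_triangle[OF that(2) sq_int_diff[OF that]] l2_triangle[OF that(1) sq_int_diff[OF that(2,1)]]
        by simp
    qed
    show ?thesis using tri[OF \<phi>(7,2)] tri[OF \<phi>(8,3)] \<phi>(4-6) by linarith
  qed
  have "\<bar>l2 lborel (hankel \<alpha> g) - l2 lborel g\<bar> \<le> e" if "e > 0" for e
    using le[of "e / 2"] that by simp
  then have "\<bar>l2 lborel (hankel \<alpha> g) - l2 lborel g\<bar> \<le> 0" by (rule field_le_epsilon[of _ 0, simplified])
  then show "l2 lborel (hankel \<alpha> g) = l2 lborel g" by simp
  show "sq_int lborel (hankel \<alpha> g)" using hankel_approx[OF \<alpha> g zero_less_one] by blast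
qed

section \<open>Orthonormal systems for semidefinite forms\<close>

text \<open>Degeneracy is allowed because functions that agree on \<open>S\<close> cannot be told
  apart by integration over \<open>S\<close>. Linearity in the second argument follows from
  symmetry.\<close>

definition psd_form :: "('v::real_vector \<Rightarrow> 'v \<Rightarrow> real) \<Rightarrow> bool" where
  "psd_form b \<longleftrightarrow> (\<forall>v. linear (\<lambda>u. b u v)) \<and> (\<forall>u v. b u v = b v u) \<and> (\<forall>u. b u u \<ge> 0)"

definition orthonormal_wrt :: "('v::real_vector \<Rightarrow> 'v \<Rightarrow> real) \<Rightarrow> 'v set \<Rightarrow> bool" where
  "orthonormal_wrt b E \<longleftrightarrow> finite E \<and> (\<forall>e\<in>E. \<forall>f\<in>E. b e f = (if e = f then 1 else 0))"

definition proj_wrt :: "('v::real_vector \<Rightarrow> 'v \<Rightarrow> real) \<Rightarrow> 'v set \<Rightarrow> 'v \<Rightarrow> 'v" where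
  "proj_wrt b E v = (\<Sum>e\<in>E. b v e *\<^sub>R e)"

context
  fixes b :: "'v::real_vector \<Rightarrow> 'v \<Rightarrow> real"
  assumes b: "psd_form b"
begin

lemma psd_linear: "linear (\<lambda>u. b u v)"
  and psd_sym: "b u v = b v u"
  and psd_nonneg: "b u u \<ge> 0"
  using b unfolding psd_form_def by blast+

lemma psd_simps:
  "b (u + v) w = b u w + b v w" "b w (u + v) = b w u + b w v"
  "b (u - v) w = b u w - b v w" "b w (u - v) = b w u - b w v"
  "b (r *\<^sub>R u) w = r * b u w" "b w (r *\<^sub>R u) = r * b w u"
  "b 0 w = 0" "b w 0 = 0"
proof -
  show *: "b (u + v) w = b u w + b v w" "b (u - v) w = b u w - b v w" "b (r *\<^sub>R u) w = r * b u w" "b 0 w = 0"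
    for u v w r
    using linear_add[OF psd_linear, of u v w] linear_diff[OF psd_linear, of u v w]
      linear_cmul[OF psd_linear, of r u w] linear_0[OF psd_linear, of w] by simp_all
  show "b w (u + v) = b w u + b w v" "b w (u - v) = b w u - b w v" "b w (r *\<^sub>R u) = r * b w u" "b w 0 = 0"
    unfolding psd_sym[of w] by (rule *)+
qed

lemma psd_sum: "b (\<Sum>i\<in>I. f i) w = (\<Sum>i\<in>I. b (f i) w)" "b w (\<Sum>i\<in>I. f i) = (\<Sum>i\<in>I. b w (f i))"
proof -
  show *: "b (\<Sum>i\<in>I. f i) w = (\<Sum>i\<in>I. b (f i) w)" for w by (rule linear_sum[OF psd_linear])
  show "b w (\<Sum>i\<in>I. f i) = (\<Sum>i\<in>I. b w (f i))" using *[of w] by (simp add: psd_sym[of w])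
qed

lemma psd_Cauchy_Schwarz: "(b u v)\<^sup>2 \<le> b u u * b v v"
proof (rule discriminant_nonneg)
  fix t
  have "b (u - t *\<^sub>R v) (u - t *\<^sub>R v) = b u u - 2 * t * b u v + t\<^sup>2 * b v v"
    by (simp add: psd_simps psd_sym[of v u] power2_eq_square algebra_simps)
  then show "b u u - 2 * t * b u v + t\<^sup>2 * b v v \<ge> 0" using psd_nonneg by metis
qed

lemma psd_null: "b u u = 0 \<Longrightarrow> b u v = 0"
  using psd_Cauchy_Schwarz[of u v] by simp

lemma linear_proj_wrt: "linear (proj_wrt b E)"
  unfolding proj_wrt_def
  by (rule linearI) (simp_all add: psd_simps scaleR_left_distrib sum.distrib scaleR_sum_right)

lemma proj_wrt_in_span: "proj_wrt b E v \<in> span E"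
  unfolding proj_wrt_def by (intro span_sum span_scale span_base)

lemma residual_orthogonal:
  assumes "orthonormal_wrt b E" "e \<in> E"
  shows "b (v - proj_wrt b E v) e = 0"
proof -
  have fin: "finite E" and on: "\<And>f. f \<in> E \<Longrightarrow> b f e = (if f = e then 1 else 0)"
    using assms unfolding orthonormal_wrt_def by auto
  have "b (proj_wrt b E v) e = (\<Sum>f\<in>E. b v f * b f e)"
    by (simp add: proj_wrt_def psd_sum psd_simps)
  also have "\<dots> = (\<Sum>f\<in>E. if f = e then b v f else 0)"
    by (intro sum.cong) (auto simp: on)
  also have "\<dots> = b v e" using fin assms(2) by simp
  finally show ?thesis by (simp add: psd_simps)
qed

lemma residual_orthogonal_span:
  assumes "orthonormal_wrt b E" "w \<in> span E"
  shows "b (v - proj_wrt b E v) w = 0"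
  using assms(2)
  by (induction rule: span_induct_alt) (simp_all add: psd_simps(2,6,8) residual_orthogonal[OF assms(1)])

lemma residual_sq:
  assumes "orthonormal_wrt b E"
  shows "b (v - proj_wrt b E v) (v - proj_wrt b E v) = b v v - (\<Sum>e\<in>E. (b v e)\<^sup>2)"
proof -
  have "b (v - proj_wrt b E v) (v - proj_wrt b E v) = b (v - proj_wrt b E v) v"
    using residual_orthogonal_span[OF assms proj_wrt_in_span[of E v], of v] psd_simps(4) by simp
  also have "\<dots> = b v v - b (proj_wrt b E v) v" by (simp add: psd_simps)
  also have "b (proj_wrt b E v) v = (\<Sum>e\<in>E. (b v e)\<^sup>2)"
    by (simp add: proj_wrt_def psd_sum psd_simps psd_sym[of _ v] power2_eq_square)
  finally show ?thesis .
qed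

lemma psd_Bessel: "orthonormal_wrt b E \<Longrightarrow> (\<Sum>e\<in>E. (b v e)\<^sup>2) \<le> b v v"
  using residual_sq[of E v] psd_nonneg[of "v - proj_wrt b E v"] by simp

text \<open>Pythagoras, the residual being orthogonal to the span. As the form may be degenerate,
  the competitor \<open>u\<close> is allowed to differ from a vector \<open>u'\<close> of the span
  by a null vector.\<close>

lemma residual_minimal:
  assumes "orthonormal_wrt b E" "\<And>w. b (u - u') w = 0" "u' \<in> span E"
  shows "b (v - proj_wrt b E v) (v - proj_wrt b E v) \<le> b (v - u) (v - u)"
proof -
  define r where "r = v - proj_wrt b E v"
  define s where "s = proj_wrt b E v - u'"
  have "s \<in> span E" unfolding s_def by (intro span_diff proj_wrt_in_span assms)
  then have rs: "b r s = 0" unfolding r_def using assms(1) by (intro residual_orthogonal_span)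
  define q where "q = u - u'"
  have q: "b q w = 0" "b w q = 0" for w
    using assms(2)[of w] psd_sym[of w] by (simp_all add: q_def)
  have eq: "v - u = (r + s) - q" by (simp add: r_def s_def q_def)
  have "b (v - u) (v - u) = b r r + b s s"
    unfolding eq by (simp add: psd_simps q rs psd_sym[of s r])
  then show ?thesis using psd_nonneg[of s] by (simp add: r_def)
qed

text \<open>A vector whose residual has norm zero adds nothing: by Cauchy-Schwarz that residual is
  orthogonal to everything. This is why vectors of \<open>span X\<close> are reproduced only up to
  null vectors.\<close>

lemma Gram_Schmidt_wrt:
  assumes "finite X"
  shows "\<exists>E. orthonormal_wrt b E \<and> E \<subseteq> span X \<and> card E \<le> card X \<and>
           (\<forall>x\<in>span X. \<forall>w. b (x - proj_wrt b E x) w = 0)"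
proof -
  have "\<exists>E. orthonormal_wrt b E \<and> E \<subseteq> span X \<and> card E \<le> card X \<and>
           (\<forall>x\<in>X. \<forall>w. b (x - proj_wrt b E x) w = 0)"
    using assms
  proof (induction X rule: finite_induct)
    case empty
    show ?case by (intro exI[of _ "{}"]) (simp add: orthonormal_wrt_def)
  next
    case (insert x X)
    then obtain E where E: "orthonormal_wrt b E" "E \<subseteq> span X" "card E \<le> card X"
      "\<And>y w. y \<in> X \<Longrightarrow> b (y - proj_wrt b E y) w = 0" by blast
    have fin: "finite E" using E(1) by (simp add: orthonormal_wrt_def)
    have sub: "span X \<subseteq> span (insert x X)" by (intro span_mono) auto
    define z where "z = x - proj_wrt b E x"
    have pE: "proj_wrt b E y \<in> span X" for y
      using proj_wrt_in_span span_mono[OF E(2)] by (auto simp: span_span)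
    show ?case
    proof (cases "b z z = 0")
      case True
      then show ?thesis using E sub insert psd_null[OF True]
        by (intro exI[of _ E]) (auto simp: z_def)
    next
      case False
      then have zp: "b z z > 0" using psd_nonneg[of z] by simp
      define f where "f = (1 / sqrt (b z z)) *\<^sub>R z"
      have fe: "b f e = 0" "b e f = 0" if "e \<in> E" for e
        using residual_orthogonal[OF E(1) that, of x] psd_sym[of e f]
        by (simp_all add: f_def z_def psd_simps)
      have ff: "b f f = 1" using zp by (simp add: f_def psd_simps)
      have fE: "f \<notin> E" using fe(1) ff by fastforce
      have on: "orthonormal_wrt b (insert f E)"
        using E(1) fe ff unfolding orthonormal_wrt_def by auto
      have pr: "proj_wrt b (insert f E) y = b y f *\<^sub>R f + proj_wrt b E y" for y
        using fin fE by (simp add: proj_wrt_def)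
      have "f \<in> span (insert x X)"
        unfolding f_def z_def using pE sub by (intro span_scale span_diff) (auto intro: span_base)
      moreover have "b (y - proj_wrt b (insert f E) y) w = 0" if "y \<in> insert x X" for y w
      proof (cases "y = x")
        case True
        have "b (proj_wrt b E x) f = 0"
          using fe by (simp add: proj_wrt_def psd_sum psd_simps)
        then have "b x f = b z f" by (simp add: z_def psd_simps)
        also have "\<dots> = sqrt (b z z)" using zp by (simp add: f_def psd_simps real_div_sqrt)
        finally have "b x f *\<^sub>R f = z" using zp by (simp add: f_def)
        then have "x - proj_wrt b (insert f E) x = 0" by (simp add: pr z_def)
        then show ?thesis using True by (simp add: psd_simps)
      next
        case False
        with that have y: "y \<in> X" by simp
        have "b (proj_wrt b E y) f = 0"
          using fe by (simp add: proj_wrt_def psd_sum psd_simps)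
        then have "b y f = 0" using E(4)[OF y, of f] by (simp add: psd_simps)
        then show ?thesis using E(4)[OF y] by (simp add: pr)
      qed
      moreover have "card (insert f E) \<le> card (insert x X)" using E(3) fin fE insert by simp
      ultimately show ?thesis using on E(2) sub by (intro exI[of _ "insert f E"]) auto
    qed
  qed
  then obtain E where E: "orthonormal_wrt b E" "E \<subseteq> span X" "card E \<le> card X"
      "\<And>y w. y \<in> X \<Longrightarrow> b (y - proj_wrt b E y) w = 0" by blast
  have "b (x - proj_wrt b E x) w = 0" if "x \<in> span X" for x w
    using that
  proof (induction rule: span_induct_alt)
    case base then show ?case using linear_0[OF linear_proj_wrt] by (simp add: psd_simps)
  next
    case (step c x y)
    have eq: "c *\<^sub>R x + y - proj_wrt b E (c *\<^sub>R x + y) = c *\<^sub>R (x - proj_wrt b E x) + (y - proj_wrt b E y)"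
      by (simp add: linear_add[OF linear_proj_wrt] linear_cmul[OF linear_proj_wrt] algebra_simps)
    show ?case unfolding eq using E(4) step by (simp add: psd_simps(1,5))
  qed
  with E show ?thesis by blast
qed

end

text \<open>If a vector is annihilated by the functionals \<open>l j\<close>, its \<open>b\<close>-norm is controlled by \<open>c\<close>.
  The complement, with respect to the form \<open>(\<Sum>j\<in>J. l j u * l j v) + c u v\<close>, of the space of such vectors is spanned
  by the Riesz representatives of the \<open>l j\<close>.\<close>

lemma low_rank_approximation:
  fixes b c :: "'v::real_vector \<Rightarrow> 'v \<Rightarrow> real"
  assumes b: "psd_form b" and c: "psd_form c" and l: "\<And>j. j \<in> J \<Longrightarrow> linear (l j)" and "finite J" "finite X" "A > 0"
    and le: "\<And>u. A * b u u \<le> (\<Sum>j\<in>J. (l j u)\<^sup>2) + c u u"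
  shows "\<exists>W. orthonormal_wrt b W \<and> card W \<le> card J \<and>
    (\<forall>v\<in>X. b (v - proj_wrt b W v) (v - proj_wrt b W v) \<le> c v v / A)"
proof -
  define d where "d u v = (\<Sum>j\<in>J. l j u * l j v) + c u v" for u v
  have d: "psd_form d"
    unfolding psd_form_def
  proof (intro conjI allI)
    show "linear (\<lambda>u. d u v)" for v
    proof (rule linearI)
      fix u u' :: 'v and r :: real
      have "(\<Sum>j\<in>J. l j (u + u') * l j v) = (\<Sum>j\<in>J. l j u * l j v + l j u' * l j v)"
        by (intro sum.cong refl) (simp add: linear_add[OF l] distrib_right)
      then show "d (u + u') v = d u v + d u' v"
        by (simp add: d_def psd_simps[OF c] sum.distrib)
      have "(\<Sum>j\<in>J. l j (r *\<^sub>R u) * l j v) = (\<Sum>j\<in>J. r * (l j u * l j v))"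
        by (intro sum.cong refl) (simp add: linear_cmul[OF l])
      then show "d (r *\<^sub>R u) v = r *\<^sub>R d u v"
        by (simp add: d_def psd_simps[OF c] sum_distrib_left distrib_left)
    qed
    show "d u v = d v u" for u v
      unfolding d_def by (simp add: psd_sym[OF c, of u v] mult.commute)
    show "d u u \<ge> 0" for u
      unfolding d_def using psd_nonneg[OF c] by (auto intro!: add_nonneg_nonneg sum_nonneg)
  qed
  note ds = psd_simps[OF d] psd_sum[OF d]
  have bd: "A * b u u \<le> d u u" for u
    using le[of u] by (simp add: d_def power2_eq_square)
  have ld: "(l j u)\<^sup>2 \<le> d u u" if "j \<in> J" for j u
  proof -
    have "(l j u)\<^sup>2 \<le> (\<Sum>j\<in>J. (l j u)\<^sup>2)" using that \<open>finite J\<close> by (intro member_le_sum) auto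
    then show ?thesis using psd_nonneg[OF c, of u] by (simp add: d_def power2_eq_square)
  qed
  \<comment> \<open>Restricting to the span of the finite set \<open>X\<close> makes the Riesz
    representation a finite sum over an orthonormal system.\<close>
  obtain E where E: "orthonormal_wrt d E" "E \<subseteq> span X" "\<And>x w. x \<in> span X \<Longrightarrow> d (x - proj_wrt d E x) w = 0"
    using Gram_Schmidt_wrt[OF d \<open>finite X\<close>] by blast
  define h where "h j = (\<Sum>e\<in>E. l j e *\<^sub>R e)" for j
  have hl: "d v (h j) = l j v" if "v \<in> span X" "j \<in> J" for v j
  proof -
    \<comment> \<open>The functional is bounded by the \<open>d\<close>-norm and hence kills
      \<open>d\<close>-null vectors.\<close>
    have "l j (v - proj_wrt d E v) = 0"
      using ld[OF that(2), of "v - proj_wrt d E v"] E(3)[OF that(1)] by simp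
    then have "l j v = l j (proj_wrt d E v)" by (simp add: linear_diff[OF l[OF that(2)]])
    also have "\<dots> = (\<Sum>e\<in>E. d v e * l j e)"
      by (simp add: proj_wrt_def linear_sum[OF l[OF that(2)]] linear_cmul[OF l[OF that(2)]])
    also have "\<dots> = d v (h j)" by (simp add: h_def ds mult.commute)
    finally show ?thesis ..
  qed
  have hX: "h ` J \<subseteq> span X"
    unfolding h_def using E(2) by (auto intro!: span_sum span_scale)
  obtain F where F: "orthonormal_wrt d F" "F \<subseteq> span (h ` J)" "card F \<le> card (h ` J)"
     "\<And>x w. x \<in> span (h ` J) \<Longrightarrow> d (x - proj_wrt d F x) w = 0"
    using Gram_Schmidt_wrt[OF d finite_imageI[OF \<open>finite J\<close>]] by blast
  have FX: "span F \<subseteq> span X"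
    using F(2) hX by (meson order.trans span_minimal subspace_span)
  have finF: "finite F" using F(1) by (simp add: orthonormal_wrt_def)
  \<comment> \<open>\<open>F\<close> is orthonormal for \<open>d\<close>. Orthonormalising again for
    \<open>b\<close> does not increase the number of vectors, and every vector of
    \<open>span F\<close> stays reproduced up to \<open>b\<close>-null vectors.\<close>
  obtain W where W: "orthonormal_wrt b W" "card W \<le> card F" "W \<subseteq> span F" "\<And>x w. x \<in> span F \<Longrightarrow> b (x - proj_wrt b W x) w = 0"
    using Gram_Schmidt_wrt[OF b finF] by blast
  have "b (v - proj_wrt b W v) (v - proj_wrt b W v) \<le> c v v / A" if "v \<in> X" for v
  proof -
    define p where "p = proj_wrt d F v"
    have pF: "p \<in> span F" unfolding p_def by (rule proj_wrt_in_span[OF d])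
    have vX: "v - p \<in> span X" using that FX pF by (intro span_diff) (auto intro: span_base)
    have l0: "l j (v - p) = 0" if "j \<in> J" for j
    proof -
      have hj: "h j \<in> span (h ` J)" using that by (auto intro: span_base)
      have "l j (v - p) = d (v - p) (h j)" using hl[OF vX that] by simp
      also have "\<dots> = d (v - p) (h j - proj_wrt d F (h j)) + d (v - p) (proj_wrt d F (h j))"
        by (simp add: ds)
      also have "d (v - p) (h j - proj_wrt d F (h j)) = 0"
        using F(4)[OF hj] psd_sym[OF d] by metis
      also have "d (v - p) (proj_wrt d F (h j)) = 0"
        unfolding p_def using F(1) by (intro residual_orthogonal_span[OF d] proj_wrt_in_span[OF d])
      finally show ?thesis by simp
    qed
    \<comment> \<open>As the functionals vanish at \<open>v - p\<close>, both
      \<open>d (v - p) (v - p)\<close> and \<open>d (v - p) v\<close> reduce to values of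
      \<open>c\<close>. Cauchy-Schwarz for \<open>c\<close> then bounds the squared
      \<open>d\<close>-distance by \<open>c v v\<close>.\<close>
    have "d (v - p) (v - p) = d (v - p) v"
      using residual_orthogonal_span[OF d F(1) pF, of v] by (simp add: p_def[symmetric] ds)
    also have "\<dots> = c (v - p) v" using l0 by (simp add: d_def)
    finally have dc: "d (v - p) (v - p) = c (v - p) v" .
    have "(d (v - p) (v - p))\<^sup>2 \<le> c (v - p) (v - p) * c v v"
      unfolding dc by (rule psd_Cauchy_Schwarz[OF c])
    also have "c (v - p) (v - p) = d (v - p) (v - p)" using l0 by (simp add: d_def)
    finally have "d (v - p) (v - p) \<le> c v v"
      using psd_nonneg[OF d, of "v - p"] psd_nonneg[OF c, of v]
      by (cases "d (v - p) (v - p) = 0") (auto simp: power2_eq_square)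
    then have "b (v - p) (v - p) \<le> c v v / A"
      using bd[of "v - p"] \<open>A > 0\<close> by (simp add: field_simps)
    moreover have "b (v - proj_wrt b W v) (v - proj_wrt b W v) \<le> b (v - p) (v - p)"
      by (rule residual_minimal[OF b W(1) W(4)[OF pF] proj_wrt_in_span[OF b]])
    ultimately show ?thesis by simp
  qed
  moreover have "card W \<le> card J"
    using W(2) F(3) card_image_le[OF \<open>finite J\<close>, of h] by simp
  ultimately show ?thesis using W(1) by blast
qed

section \<open>Reproducing kernels and the mean square constant\<close>

text \<open>Bounded continuous functions form a vector space containing every kernel, and their
  products are integrable over bounded Borel sets \<open>S\<close>.\<close>

definition inner_on :: "real set \<Rightarrow> (real \<Rightarrow>\<^sub>C real) \<Rightarrow> (real \<Rightarrow>\<^sub>C real) \<Rightarrow> real" where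
  "inner_on S u v = (\<integral>x. indicator S x * (apply_bcontfun u x * apply_bcontfun v x) \<partial>lborel)"

definition kern :: "real \<Rightarrow> real \<Rightarrow> (real \<Rightarrow>\<^sub>C real)" where
  "kern \<alpha> y = Bcontfun (\<lambda>x. sqrt_bessel \<alpha> (y * x))"

lemma apply_kern:
  assumes "\<alpha> > -1/2"
  shows "apply_bcontfun (kern \<alpha> y) x = sqrt_bessel \<alpha> (y * x)"
proof -
  obtain C where "\<And>z. \<bar>sqrt_bessel \<alpha> z\<bar> \<le> C" using sqrt_bessel_bound[OF assms] by blast
  then have "(\<lambda>x. sqrt_bessel \<alpha> (y * x)) \<in> bcontfun"
    using continuous_on_sqrt_bessel_mult[OF assms] by (intro bcontfun_normI[of _ C]) auto
  then show ?thesis by (simp add: kern_def Bcontfun_inverse)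
qed

lemma apply_bcontfun_measurable [measurable]: "apply_bcontfun (u :: real \<Rightarrow>\<^sub>C real) \<in> borel_measurable borel"
  by (intro borel_measurable_continuous_onI) simp

lemma abs_apply_bcontfun_le: "\<bar>apply_bcontfun (u :: real \<Rightarrow>\<^sub>C real) x\<bar> \<le> norm u"
  using norm_bounded[of u x] by simp

lemma integrable_indicator_bounded:
  fixes f :: "real \<Rightarrow> real"
  assumes "S \<in> sets borel" "S \<subseteq> {0<..R}" and [measurable]: "f \<in> borel_measurable borel" and f: "\<And>x. x \<in> S \<Longrightarrow> \<bar>f x\<bar> \<le> M"
  shows "integrable lborel (\<lambda>x. indicator S x * f x)"
proof (rule Bochner_Integration.integrable_bound)
  note [measurable] = assms(1)
  show "integrable lborel (\<lambda>x. \<bar>M\<bar> * indicator {0..R} x :: real)"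
    by (intro integrable_mult_right integrable_real_indicator) (auto simp: emeasure_lborel_Icc_eq)
  show "(\<lambda>x. indicator S x * f x) \<in> borel_measurable lborel" by measurable
  have "\<bar>f x\<bar> \<le> \<bar>M\<bar>" if "x \<in> S" for x using f[OF that] by linarith
  then show "AE x in lborel. norm (indicator S x * f x) \<le> norm (\<bar>M\<bar> * indicator {0..R} x :: real)"
    using assms(2) by (fastforce simp: indicator_def)
qed

lemma integrable_inner_on:
  fixes u v :: "real \<Rightarrow>\<^sub>C real"
  assumes "S \<in> sets borel" "S \<subseteq> {0<..R}"
  shows "integrable lborel (\<lambda>x. indicator S x * (apply_bcontfun u x * apply_bcontfun v x))"
proof (rule integrable_indicator_bounded[OF assms])
  show "\<bar>apply_bcontfun u x * apply_bcontfun v x\<bar> \<le> norm u * norm v" for x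
    unfolding abs_mult by (intro mult_mono abs_apply_bcontfun_le) auto
qed measurable

lemma psd_inner_on:
  assumes "S \<in> sets borel" "S \<subseteq> {0<..R}"
  shows "psd_form (inner_on S)"
  unfolding psd_form_def
proof (intro conjI allI)
  show "linear (\<lambda>u. inner_on S u v)" for v
  proof (rule linearI)
    fix u w :: "real \<Rightarrow>\<^sub>C real" and r :: real
    show "inner_on S (u + w) v = inner_on S u v + inner_on S w v"
      unfolding inner_on_def using integrable_inner_on[OF assms, of u v] integrable_inner_on[OF assms, of w v]
      by (simp add: plus_bcontfun.rep_eq distrib_right distrib_left flip: Bochner_Integration.integral_add)
    have "indicator S x * (apply_bcontfun (r *\<^sub>R u) x * apply_bcontfun v x)
       = r * (indicator S x * (apply_bcontfun u x * apply_bcontfun v x))" for x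
      by (simp add: scaleR_bcontfun.rep_eq)
    then show "inner_on S (r *\<^sub>R u) v = r *\<^sub>R inner_on S u v" unfolding inner_on_def by (simp only: integral_mult_right_zero real_scaleR_def)
  qed
  show "inner_on S u v = inner_on S v u" for u v by (simp add: inner_on_def mult.commute)
  show "inner_on S u u \<ge> 0" for u unfolding inner_on_def by (intro Bochner_Integration.integral_nonneg) (simp add: indicator_def)
qed

lemma inner_on_eq_integral:
  assumes "0 \<le> p" "p \<le> q"
  shows "inner_on {p<..q} u v = integral {p..q} (\<lambda>x. apply_bcontfun u x * apply_bcontfun v x)"
proof -
  have "inner_on {p<..q} u v = (\<integral>x. indicator {p..q} x *\<^sub>R (apply_bcontfun u x * apply_bcontfun v x) \<partial>lborel)"
    unfolding inner_on_def
  proof (rule integral_cong_AE)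
    have "AE x in lborel. x \<noteq> p" by (rule AE_lborel_singleton)
    then show "AE x in lborel. indicator {p<..q} x * (apply_bcontfun u x * apply_bcontfun v x)
       = indicator {p..q} x *\<^sub>R (apply_bcontfun u x * apply_bcontfun v x)"
      by eventually_elim (auto simp: indicator_def)
  qed measurable
  also have "\<dots> = integral {p..q} (\<lambda>x. apply_bcontfun u x * apply_bcontfun v x)"
    using set_borel_integral_eq_integral(2)[OF borel_integrable_atLeastAtMost'[of p q "\<lambda>x. apply_bcontfun u x * apply_bcontfun v x"]]
    by (simp add: set_lebesgue_integral_def continuous_on_mult)
  finally show ?thesis .
qed

lemma hankel_cut: "\<alpha> > -1/2 \<Longrightarrow> hankel \<alpha> (\<lambda>x. indicator S x * apply_bcontfun u x) y = inner_on S u (kern \<alpha> y)"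
  by (simp add: hankel_def inner_on_def apply_kern mult.assoc)

lemma inner_on_kern_isometry:
  assumes "\<alpha> > -1/2" "S \<in> sets borel" "S \<subseteq> {0<..R}"
  shows "sq_int lborel (\<lambda>y. inner_on S u (kern \<alpha> y))" "(\<integral>y. (inner_on S u (kern \<alpha> y))\<^sup>2 \<partial>lborel) = inner_on S u u"
proof -
  define g where "g x = indicator S x * apply_bcontfun u x" for x
  note [measurable] = assms(2)
  have g: "g \<in> borel_measurable borel" "\<And>x. \<bar>g x\<bar> \<le> norm u" "\<And>x. x \<notin> {0<..R} \<Longrightarrow> g x = 0"
    using abs_apply_bcontfun_le[of u] assms(3) by (auto simp: g_def[abs_def] indicator_def norm_ge_zero)
  have h: "hankel \<alpha> g = (\<lambda>y. inner_on S u (kern \<alpha> y))"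
    using hankel_cut[OF assms(1)] by (simp add: g_def[abs_def] fun_eq_iff)
  show "sq_int lborel (\<lambda>y. inner_on S u (kern \<alpha> y))"
    using hankel_isometry(1)[OF assms(1) g] by (simp add: h)
  have "(l2 lborel (hankel \<alpha> g))\<^sup>2 = (l2 lborel g)\<^sup>2"
    using hankel_isometry(2)[OF assms(1) g] by simp
  then have "(\<integral>y. (inner_on S u (kern \<alpha> y))\<^sup>2 \<partial>lborel) = (\<integral>x. (g x)\<^sup>2 \<partial>lborel)"
    by (simp add: l2_sq h)
  also have "(\<lambda>x. (g x)\<^sup>2) = (\<lambda>x. indicator S x * (apply_bcontfun u x * apply_bcontfun u x))"
    by (auto simp: g_def indicator_def power2_eq_square)
  finally show "(\<integral>y. (inner_on S u (kern \<alpha> y))\<^sup>2 \<partial>lborel) = inner_on S u u" by (simp add: inner_on_def)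
qed

lemma inner_on_kern_nonpos:
  assumes "\<alpha> > -1/2" "S \<subseteq> {0<..R}" "y \<le> 0"
  shows "inner_on S u (kern \<alpha> y) = 0"
proof -
  have "indicator S x * (apply_bcontfun u x * apply_bcontfun (kern \<alpha> y) x) = 0" for x
  proof (cases "x \<in> S")
    case True
    then have "y * x \<le> 0" using assms by (auto simp: mult_nonpos_nonneg)
    then show ?thesis by (simp add: apply_kern[OF assms(1)])
  qed simp
  then show ?thesis unfolding inner_on_def by (simp only: Bochner_Integration.integral_zero)
qed

lemma inner_on_kern_lommel:
  assumes "\<alpha> > -1/2" "0 \<le> p" "p \<le> q" "y > 0" "s > 0" "y \<noteq> s"
  shows "inner_on {p<..q} (kern \<alpha> y) (kern \<alpha> s) = (lommel \<alpha> y s q - lommel \<alpha> y s p) / (s\<^sup>2 - y\<^sup>2)"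
  using has_integral_sqrt_bessel_prod[OF assms] assms
  by (simp add: inner_on_eq_integral apply_kern integral_unique)

lemma inner_on_kern_diagonal:
  assumes "\<alpha> > -1/2" "0 \<le> p" "p \<le> q" "y > 0"
  shows "inner_on {p<..q} (kern \<alpha> y) (kern \<alpha> y) = (sqrt_bessel_sq_primitive \<alpha> (y * q) - sqrt_bessel_sq_primitive \<alpha> (y * p)) / y"
proof -
  have "((\<lambda>x. (sqrt_bessel \<alpha> (y * x))\<^sup>2) has_integral (sqrt_bessel_sq_primitive \<alpha> (y * q) / y - sqrt_bessel_sq_primitive \<alpha> (y * p) / y)) {p..q}"
  proof (rule fundamental_theorem_of_calculus_interior[OF assms(3)])
    show "continuous_on {p..q} (\<lambda>x. sqrt_bessel_sq_primitive \<alpha> (y * x) / y)"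
      unfolding sqrt_bessel_sq_primitive_def[abs_def] using assms
      by (intro continuous_intros continuous_on_sqrt_bessel_mult) auto
    fix x assume "x \<in> {p<..<q}"
    then have "((\<lambda>x. sqrt_bessel_sq_primitive \<alpha> (y * x) / y) has_real_derivative (sqrt_bessel \<alpha> (y * x))\<^sup>2 * y / y) (at x)"
      using assms
      by (intro DERIV_cdivide DERIV_chain2[OF DERIV_sqrt_bessel_sq_primitive]) (auto intro!: derivative_eq_intros)
    then show "((\<lambda>x. sqrt_bessel_sq_primitive \<alpha> (y * x) / y) has_vector_derivative (sqrt_bessel \<alpha> (y * x))\<^sup>2) (at x)"
      using assms by (simp add: has_real_derivative_iff_has_vector_derivative)
  qed
  then show ?thesis
    using assms by (simp add: inner_on_eq_integral apply_kern integral_unique diff_divide_distrib flip: power2_eq_square)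
qed

lemma emeasure_subset_Ioc_finite:
  assumes "S \<subseteq> {0<..R::real}"
  shows "emeasure lborel S < \<infinity>"
proof (rule emeasure_bounded_finite)
  have "S \<subseteq> {0..R}" using assms by auto
  then show "bounded S" by (rule bounded_subset[OF bounded_closed_interval])
qed

lemma inner_on_kern_le_measure:
  assumes \<alpha>: "\<alpha> > -1/2" and D: "\<And>z. \<bar>sqrt_bessel \<alpha> z\<bar> \<le> D" and S: "S \<in> sets borel" "S \<subseteq> {0<..R}"
  shows "inner_on S (kern \<alpha> y) (kern \<alpha> y) \<le> D\<^sup>2 * measure lborel S"
proof -
  have fin: "emeasure lborel S < \<infinity>"
    using S(2) by (rule emeasure_subset_Ioc_finite)
  have "inner_on S (kern \<alpha> y) (kern \<alpha> y) \<le> (\<integral>x. indicator S x * D\<^sup>2 \<partial>lborel)"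
    unfolding inner_on_def
  proof (rule integral_mono[OF integrable_inner_on[OF S]])
    show "integrable lborel (\<lambda>x. indicator S x * D\<^sup>2)"
      by (rule integrable_indicator_bounded[OF S, of _ "D\<^sup>2"]) auto
    fix x
    have "sqrt_bessel \<alpha> (y * x) * sqrt_bessel \<alpha> (y * x) \<le> D\<^sup>2"
      using abs_le_square_iff[of "sqrt_bessel \<alpha> (y * x)" D] D[of "y * x"] by (simp add: power2_eq_square)
    then show "indicator S x * (apply_bcontfun (kern \<alpha> y) x * apply_bcontfun (kern \<alpha> y) x) \<le> indicator S x * D\<^sup>2"
      by (auto simp: apply_kern[OF \<alpha>] indicator_def)
  qed
  also have "\<dots> = D\<^sup>2 * measure lborel S" using S fin by simp
  finally show ?thesis .
qed

section \<open>Zeros of the kernel and the lower bound for its mean square\<close>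

lemma sqrt_bessel_sq_primitive_0: "sqrt_bessel_sq_primitive \<alpha> 0 = 0"
  by (simp add: sqrt_bessel_sq_primitive_def)

lemma lommel_0: "lommel \<alpha> y s 0 = 0"
  by (simp add: lommel_def)

text \<open>Sturm comparison with \<open>sin (\<omega> * (z - p))\<close>.\<close>

lemma sqrt_bessel_zero_exists:
  assumes \<alpha>: "\<alpha> > -1/2" and T: "T > pi"
  obtains z0 where "z0 > 0" "\<And>p. p \<ge> z0 \<Longrightarrow> \<exists>z. p \<le> z \<and> z < p + T \<and> sqrt_bessel \<alpha> z = 0"
proof -
  define b where "b = \<alpha> + 1/2"
  \<comment> \<open>Half a period of the comparison function is
    \<open>pi / \<omega> = (pi + T) / 2\<close>, below \<open>T\<close>, while
    \<open>\<omega> < 1\<close>. Both inequalities use \<open>T > pi\<close>.\<close>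
  define \<omega> where "\<omega> = 2 * pi / (pi + T)"
  have om: "0 < \<omega>" "\<omega> < 1" "pi / \<omega> < T" using T pi_gt_zero
    by (simp_all add: \<omega>_def pos_divide_less_eq add_pos_pos less_trans[OF pi_gt_zero])
  have om2: "1 - \<omega>\<^sup>2 > 0" using om by (simp add: abs_square_less_1)
  \<comment> \<open>The kernel solves \<open>k'' = - (1 - (b\<^sup>2 - b) / z\<^sup>2) * k\<close>;
    from \<open>z0\<close> on the coefficient in parentheses is at least
    \<open>\<omega>\<^sup>2\<close>.\<close>
  define z0 where "z0 = 1 + \<bar>b\<^sup>2 - b\<bar> / (1 - \<omega>\<^sup>2)"
  have z0: "z0 \<ge> 1" using om2 by (simp add: z0_def)
  have qpos: "\<omega>\<^sup>2 \<le> 1 - (b\<^sup>2 - b) / z\<^sup>2" if "z \<ge> z0" for z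
  proof -
    have "\<bar>b\<^sup>2 - b\<bar> / (1 - \<omega>\<^sup>2) \<le> z" using that by (simp add: z0_def)
    moreover have "z * 1 \<le> z * z" using that z0 by (intro mult_left_mono) auto
    ultimately have "\<bar>b\<^sup>2 - b\<bar> / (1 - \<omega>\<^sup>2) \<le> z\<^sup>2" by (simp add: power2_eq_square)
    then have "\<bar>b\<^sup>2 - b\<bar> \<le> z\<^sup>2 * (1 - \<omega>\<^sup>2)" using om2 by (simp add: pos_divide_le_eq)
    then have "b\<^sup>2 - b \<le> (1 - \<omega>\<^sup>2) * z\<^sup>2" by (simp add: mult.commute)
    moreover have "z\<^sup>2 > 0" using that z0 by (intro zero_less_power) auto
    ultimately have "(b\<^sup>2 - b) / z\<^sup>2 \<le> 1 - \<omega>\<^sup>2" by (simp add: pos_divide_le_eq)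
    then show ?thesis by simp
  qed
  have "\<exists>z. p \<le> z \<and> z \<le> p + pi / \<omega> \<and> sqrt_bessel \<alpha> z = 0" if p: "p \<ge> z0" for p
  proof (rule ccontr)
    assume "\<not> ?thesis"
    then have nz: "sqrt_bessel \<alpha> z \<noteq> 0" if "z \<in> {p..p + pi / \<omega>}" for z using that by auto
    define e where "e = p + pi / \<omega>"
    have pe: "p < e" using om by (simp add: e_def)
    define s where "s = sgn (sqrt_bessel \<alpha> p)"
    have sgn: "s * sqrt_bessel \<alpha> z > 0" if zz: "z \<in> {p..e}" for z
    proof (rule ccontr)
      assume "\<not> s * sqrt_bessel \<alpha> z > 0"
      then have "s * sqrt_bessel \<alpha> z \<le> 0" by simp
      moreover have "s * sqrt_bessel \<alpha> p \<ge> 0" by (simp add: s_def sgn_real_def)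
      moreover have "continuous_on {p..z} (\<lambda>z. s * sqrt_bessel \<alpha> z)"
        by (intro continuous_intros continuous_on_sqrt_bessel \<alpha>)
      ultimately obtain x where "p \<le> x" "x \<le> z" "s * sqrt_bessel \<alpha> x = 0"
        using IVT2'[of "\<lambda>z. s * sqrt_bessel \<alpha> z" z 0 p] zz by auto
      moreover have "s \<noteq> 0" using nz[of p] om by (simp add: s_def sgn_zero_iff)
      ultimately show False using nz[of x] zz by (auto simp: e_def)
    qed
    define m where "m z = b * sqrt_bessel \<alpha> z / z - sqrt_bessel (\<alpha> + 1) z" for z
    \<comment> \<open>The Wronskian of the sine and the kernel, signed so that the kernel is
      positive on the interval. Its derivative is nonpositive there, yet it would have to pass from
      a negative value at \<open>p\<close> to a positive one at \<open>e\<close>.\<close>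
    define D where "D z = s * (m z * sin (\<omega> * (z - p)) - sqrt_bessel \<alpha> z * (\<omega> * cos (\<omega> * (z - p))))" for z
    have "D e \<le> D p"
    proof (rule DERIV_nonpos_imp_nonincreasing[of p e D])
      show "p \<le> e" using pe by simp
      fix z assume z: "p \<le> z" "z \<le> e"
      then have zp: "z > 0" using p z0 by linarith
      have dk: "(sqrt_bessel \<alpha> has_real_derivative m z) (at z)"
        using DERIV_sqrt_bessel[of \<alpha> z] \<alpha> zp by (simp add: m_def b_def)
      have dl: "(sqrt_bessel (\<alpha> + 1) has_real_derivative sqrt_bessel \<alpha> z - b * sqrt_bessel (\<alpha> + 1) z / z) (at z)"
        using DERIV_sqrt_bessel_Suc[of \<alpha> z] \<alpha> zp by (simp add: b_def)
      have "((\<lambda>z. b * sqrt_bessel \<alpha> z / z) has_real_derivative (b * m z * z - b * sqrt_bessel \<alpha> z * 1) / (z * z)) (at z)"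
        by (rule DERIV_divide[OF DERIV_cmult[OF dk] DERIV_ident]) (use zp in simp)
      then have "(m has_real_derivative (b * m z * z - b * sqrt_bessel \<alpha> z) / (z * z) - (sqrt_bessel \<alpha> z - b * sqrt_bessel (\<alpha> + 1) z / z)) (at z)"
        unfolding m_def[abs_def] using DERIV_diff[OF _ dl] by simp
      moreover have "(b * m z * z - b * sqrt_bessel \<alpha> z) / (z * z) - (sqrt_bessel \<alpha> z - b * sqrt_bessel (\<alpha> + 1) z / z)
          = - (1 - (b\<^sup>2 - b) / z\<^sup>2) * sqrt_bessel \<alpha> z"
        using zp by (simp add: m_def divide_simps power2_eq_square) (simp add: algebra_simps)
      ultimately have dm: "(m has_real_derivative - (1 - (b\<^sup>2 - b) / z\<^sup>2) * sqrt_bessel \<alpha> z) (at z)" by simp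
      have ds: "((\<lambda>z. sin (\<omega> * (z - p))) has_real_derivative \<omega> * cos (\<omega> * (z - p))) (at z)"
        "((\<lambda>z. \<omega> * cos (\<omega> * (z - p))) has_real_derivative - \<omega>\<^sup>2 * sin (\<omega> * (z - p))) (at z)"
        by (auto intro!: derivative_eq_intros simp: power2_eq_square)
      have "(D has_real_derivative s * ((- (1 - (b\<^sup>2 - b) / z\<^sup>2) * sqrt_bessel \<alpha> z * sin (\<omega> * (z - p)) + \<omega> * cos (\<omega> * (z - p)) * m z)
         - (m z * (\<omega> * cos (\<omega> * (z - p))) + - \<omega>\<^sup>2 * sin (\<omega> * (z - p)) * sqrt_bessel \<alpha> z))) (at z)"
        unfolding D_def[abs_def] by (intro DERIV_cmult DERIV_diff DERIV_mult dm dk ds)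
      moreover have "s * ((- (1 - (b\<^sup>2 - b) / z\<^sup>2) * sqrt_bessel \<alpha> z * sin (\<omega> * (z - p)) + \<omega> * cos (\<omega> * (z - p)) * m z)
         - (m z * (\<omega> * cos (\<omega> * (z - p))) + - \<omega>\<^sup>2 * sin (\<omega> * (z - p)) * sqrt_bessel \<alpha> z))
         = (\<omega>\<^sup>2 - (1 - (b\<^sup>2 - b) / z\<^sup>2)) * ((s * sqrt_bessel \<alpha> z) * sin (\<omega> * (z - p)))"
        by (simp add: algebra_simps)
      moreover have "(\<omega>\<^sup>2 - (1 - (b\<^sup>2 - b) / z\<^sup>2)) * ((s * sqrt_bessel \<alpha> z) * sin (\<omega> * (z - p))) \<le> 0"
      proof (rule mult_nonpos_nonneg)
        show "\<omega>\<^sup>2 - (1 - (b\<^sup>2 - b) / z\<^sup>2) \<le> 0" using qpos[of z] z p by simp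
        have "\<omega> * (z - p) \<le> pi" using z om by (simp add: e_def field_simps)
        then have "sin (\<omega> * (z - p)) \<ge> 0" using z om by (intro sin_ge_zero) auto
        then show "s * sqrt_bessel \<alpha> z * sin (\<omega> * (z - p)) \<ge> 0" using sgn[of z] z by simp
      qed
      ultimately show "\<exists>y. (D has_real_derivative y) (at z) \<and> y \<le> 0" by (auto simp: algebra_simps)
    qed
    moreover have "D p = - (\<omega> * (s * sqrt_bessel \<alpha> p))" by (simp add: D_def)
    moreover have "\<omega> * (e - p) = pi" using om by (simp add: e_def)
    then have "D e = \<omega> * (s * sqrt_bessel \<alpha> e)" by (simp add: D_def)
    moreover have "\<omega> * (s * sqrt_bessel \<alpha> p) > 0" "\<omega> * (s * sqrt_bessel \<alpha> e) > 0"
      using sgn[of p] sgn[of e] pe om by auto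
    ultimately show False by linarith
  qed
  then show ?thesis using that[of z0] z0 om(3) by (smt (verit))
qed

text \<open>Otherwise the kernel vanishes on \<open>[0, j]\<close>, and so does the entire factor to
  the right of \<open>0\<close>, against its nonzero constant coefficient. At a zero
  \<open>j\<close> of the kernel the primitive is \<open>j / 2\<close> times the square of the
  kernel of order \<open>\<alpha> + 1\<close>, which is therefore nonzero there; this permits
  normalisation.\<close>

lemma sqrt_bessel_sq_primitive_pos:
  assumes \<alpha>: "\<alpha> > -1/2" and j: "j > 0"
  shows "sqrt_bessel_sq_primitive \<alpha> j > 0"
proof -
  have hi: "((\<lambda>z. (sqrt_bessel \<alpha> z)\<^sup>2) has_integral sqrt_bessel_sq_primitive \<alpha> j) {0..j}"
    using has_integral_sqrt_bessel_sq[OF \<alpha>, of 0 j] j by (simp add: sqrt_bessel_sq_primitive_0)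
  then have "sqrt_bessel_sq_primitive \<alpha> j \<ge> 0" by (rule has_integral_nonneg) simp
  moreover have "sqrt_bessel_sq_primitive \<alpha> j \<noteq> 0"
  proof
    assume 0: "sqrt_bessel_sq_primitive \<alpha> j = 0"
    have hz: "sqrt_bessel \<alpha> z = 0" if "z \<in> {0..j}" for z
    proof -
      have "(sqrt_bessel \<alpha> z)\<^sup>2 = 0"
      proof (rule has_integral_0_cbox_imp_0[of 0 j "\<lambda>z. (sqrt_bessel \<alpha> z)\<^sup>2"])
        show "continuous_on (cbox 0 j) (\<lambda>z. (sqrt_bessel \<alpha> z)\<^sup>2)"
          by (intro continuous_intros continuous_on_sqrt_bessel \<alpha>)
        show "((\<lambda>z. (sqrt_bessel \<alpha> z)\<^sup>2) has_integral 0) (cbox 0 j)" using hi 0 by simp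
      qed (use that j in auto)
      then show ?thesis by simp
    qed
    have bz: "bessel_entire \<alpha> w = 0" if "0 < w" "w < j\<^sup>2" for w
    proof -
      have w: "(sqrt w)\<^sup>2 = w" "sqrt w > 0" "sqrt w < j" using that j by (auto simp: real_less_lsqrt)
      have "sqrt w powr (\<alpha> + 1/2) * bessel_entire \<alpha> ((sqrt w)\<^sup>2) = 0"
        using hz[of "sqrt w"] w \<alpha> by (subst sqrt_bessel_eq[symmetric]) auto
      then show ?thesis using w by simp
    qed
    have "isCont (bessel_entire \<alpha>) 0"
      by (rule DERIV_isCont[OF DERIV_bessel_entire]) (use \<alpha> in simp)
    then have "(bessel_entire \<alpha> \<longlongrightarrow> bessel_entire \<alpha> 0) (at_right 0)"
      by (simp add: isCont_def filterlim_at_split)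
    moreover have "eventually (\<lambda>w. bessel_entire \<alpha> w = 0) (at_right 0)"
      using j bz by (intro eventually_at_rightI[of 0 "j\<^sup>2"]) auto
    then have "(bessel_entire \<alpha> \<longlongrightarrow> 0) (at_right 0)" by (simp add: tendsto_eventually)
    ultimately have "bessel_entire \<alpha> 0 = 0" by (intro tendsto_unique[of "at_right (0::real)"]) auto
    moreover have "bessel_entire \<alpha> 0 = bessel_coeff \<alpha> 0" by (simp add: bessel_entire_def powser_zero)
    moreover have "bessel_coeff \<alpha> 0 > 0" using \<alpha> by (simp add: bessel_coeff_def Gamma_real_pos)
    ultimately show False by simp
  qed
  ultimately show ?thesis by simp
qed

lemma nn_integral_inverse_square_tail:
  assumes "j < (R::real)" "c \<ge> 0"
  shows "(\<integral>\<^sup>+y. ennreal (c / (y - j)\<^sup>2) * indicator {R..} y \<partial>lborel) = ennreal (c / (R - j))"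
proof -
  have "(\<integral>\<^sup>+y. ennreal (c / (y - j)\<^sup>2) * indicator {R..} y \<partial>lborel) = ennreal (0 - (- c / (R - j)))"
  proof (rule nn_integral_FTC_atLeast)
    show "(\<lambda>y. c / (y - j)\<^sup>2) \<in> borel_measurable borel" by measurable
    show "((\<lambda>y. - c / (y - j)) has_real_derivative c / (x - j)\<^sup>2) (at x)" if "R \<le> x" for x
      using that assms by (auto intro!: derivative_eq_intros simp: power2_eq_square)
    show "((\<lambda>y. - c / (y - j)) \<longlongrightarrow> 0) at_top"
      by (intro real_tendsto_divide_at_top[OF tendsto_const] filterlim_tendsto_add_at_top[OF tendsto_const, of _ _ "-j", simplified add.commute, simplified] filterlim_ident)
  qed (use assms in auto)
  then show ?thesis by simp
qed

lemma integral_tail_le: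
  fixes f :: "real \<Rightarrow> real"
  assumes "integrable lborel f" "\<And>y. y > R \<Longrightarrow> f y \<le> c / (y - j)\<^sup>2" "\<And>y. f y \<ge> 0" "j < R" "c \<ge> 0"
  shows "(\<integral>y. indicator {R<..} y * f y \<partial>lborel) \<le> c / (R - j)"
proof -
  have i: "integrable lborel (\<lambda>y. indicator {R<..} y * f y)"
    using integrable_mult_indicator[OF _ assms(1), of "{R<..}"] by simp
  have "ennreal (\<integral>y. indicator {R<..} y * f y \<partial>lborel) = (\<integral>\<^sup>+y. ennreal (indicator {R<..} y * f y) \<partial>lborel)"
    using i assms(3) by (intro nn_integral_eq_integral[symmetric]) auto
  also have "\<dots> \<le> (\<integral>\<^sup>+y. ennreal (c / (y - j)\<^sup>2) * indicator {R..} y \<partial>lborel)"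
    using assms(2) by (intro nn_integral_mono) (auto simp: indicator_def intro!: ennreal_leI)
  also have "\<dots> = ennreal (c / (R - j))" by (rule nn_integral_inverse_square_tail[OF assms(4,5)])
  finally show ?thesis using assms(4,5) by (simp add: ennreal_le_iff)
qed

text \<open>At \<open>x = 1\<close> each term of Lommel's boundary expression contains the kernel at
  one of the two zeros; this is the orthogonality on \<open>(0, 1]\<close>. Each normalised kernel
  contributes total mass \<open>1\<close>, of which at most \<open>2 * D\<^sup>2 / \<delta>\<close>
  lies beyond \<open>R\<close>, since its zero is at most \<open>R - \<delta>\<close>. By Bessel's
  inequality the sum of the mass densities is at most the trace density, which is at most
  \<open>D\<^sup>2\<close> up to \<open>Y\<close> and at most \<open>L + C / Y\<close>
  afterwards.\<close>

lemma zero_count_bound: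
  fixes z :: "nat \<Rightarrow> real"
  assumes \<alpha>: "\<alpha> > -1/2" and D: "\<And>z. \<bar>sqrt_bessel \<alpha> z\<bar> \<le> D"
    and LC: "\<And>z. z \<ge> 0 \<Longrightarrow> \<bar>sqrt_bessel_sq_primitive \<alpha> z - L * z\<bar> \<le> C"
    and z: "\<And>m. m < N \<Longrightarrow> z m > 0" "\<And>m. m < N \<Longrightarrow> z m \<le> R - \<delta>" "\<And>m. m < N \<Longrightarrow> sqrt_bessel \<alpha> (z m) = 0" "inj_on z {..<N}"
    and "\<delta> > 0" "Y > 0" "R > 0"
  shows "real N * (1 - 2 * D\<^sup>2 / \<delta>) \<le> D\<^sup>2 * Y + (L + C / Y) * R"
proof -
  define S where "S = {0<..1::real}"
  have S: "S \<in> sets borel" "S \<subseteq> {0<..1}" by (auto simp: S_def)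
  note psd = psd_inner_on[OF S]
  note ps = psd_simps[OF psd]
  define l where "l m = sqrt_bessel (\<alpha> + 1) (z m)" for m
  have diag: "inner_on S (kern \<alpha> y) (kern \<alpha> y) = sqrt_bessel_sq_primitive \<alpha> y / y" if "y > 0" for y
    using inner_on_kern_diagonal[OF \<alpha>, of 0 1 y] that by (simp add: S_def sqrt_bessel_sq_primitive_0)
  have offd: "inner_on S (kern \<alpha> (z m)) (kern \<alpha> y) = - z m * l m * sqrt_bessel \<alpha> y / (y\<^sup>2 - (z m)\<^sup>2)"
    if "m < N" "y > 0" "y \<noteq> z m" for m y
    using inner_on_kern_lommel[OF \<alpha>, of 0 1 "z m" y] that z(1,3)[of m] by (simp add: S_def lommel_def l_def)
  have zz: "inner_on S (kern \<alpha> (z m)) (kern \<alpha> (z m)) = (l m)\<^sup>2 / 2" if "m < N" for m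
    using diag[of "z m"] z(1,3)[OF that] by (simp add: sqrt_bessel_sq_primitive_def l_def)
  have l0: "l m \<noteq> 0" if "m < N" for m
    using sqrt_bessel_sq_primitive_pos[OF \<alpha> z(1)[OF that]] z(3)[OF that] by (auto simp: sqrt_bessel_sq_primitive_def l_def)
  \<comment> \<open>The factor comes from the squared norm \<open>(l m)\<^sup>2 / 2\<close> of the
    kernel at a zero.\<close>
  define e where "e m = (sqrt 2 / l m) *\<^sub>R kern \<alpha> (z m)" for m
  have e: "inner_on S (e m) (e n) = (if m = n then 1 else 0)" if "m < N" "n < N" for m n
  proof (cases "m = n")
    case True
    have s2: "sqrt 2 * (sqrt 2 * x) = 2 * x" for x :: real by (simp flip: mult.assoc)
    have "inner_on S (e n) (e n) = 1"
      using l0[OF that(2)] unfolding e_def ps zz[OF that(2)] by (simp add: s2 power2_eq_square)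
    then show ?thesis using True by simp
  next
    case False
    then have "z n \<noteq> z m" using that z(4) by (auto dest: inj_onD)
    then show ?thesis using False offd[OF that(1) z(1)[OF that(2)]] z(3)[OF that(2)] by (simp add: e_def ps)
  qed
  have inj: "inj_on e {..<N}"
  proof (rule inj_onI)
    fix m n assume "m \<in> {..<N}" "n \<in> {..<N}" "e m = e n"
    then show "m = n" using e[of m m] e[of m n] by (auto split: if_splits)
  qed
  have on: "orthonormal_wrt (inner_on S) (e ` {..<N})"
    unfolding orthonormal_wrt_def using e inj by (auto simp: inj_on_eq_iff)
  define f where "f m y = (inner_on S (e m) (kern \<alpha> y))\<^sup>2" for m y
  have bessel: "(\<Sum>m<N. f m y) \<le> inner_on S (kern \<alpha> y) (kern \<alpha> y)" for y
  proof -
    have "(\<Sum>m<N. f m y) = (\<Sum>x\<in>e ` {..<N}. (inner_on S (kern \<alpha> y) x)\<^sup>2)"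
      by (subst sum.reindex[OF inj]) (simp add: f_def psd_sym[OF psd, of "kern \<alpha> y"])
    also have "\<dots> \<le> inner_on S (kern \<alpha> y) (kern \<alpha> y)" by (rule psd_Bessel[OF psd on])
    finally show ?thesis .
  qed
  have ub1: "inner_on S (kern \<alpha> y) (kern \<alpha> y) \<le> D\<^sup>2" for y
    using inner_on_kern_le_measure[OF \<alpha> D S, of y] by (simp add: S_def)
  have C0: "C \<ge> 0" using LC[of 0] by (simp add: sqrt_bessel_sq_primitive_0)
  have ub2: "inner_on S (kern \<alpha> y) (kern \<alpha> y) \<le> L + C / Y" if "y \<ge> Y" for y
  proof -
    have y: "y > 0" using that \<open>Y > 0\<close> by simp
    have "sqrt_bessel_sq_primitive \<alpha> y \<le> L * y + C" using LC[of y] y by (simp add: abs_le_iff)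
    then have "sqrt_bessel_sq_primitive \<alpha> y / y \<le> L + C / y" using y by (simp add: field_simps)
    also have "C / y \<le> C / Y" using that \<open>Y > 0\<close> C0 y by (intro divide_left_mono) auto
    finally show ?thesis using diag[OF y] by simp
  qed
  have LCY: "L + C / Y \<ge> 0" using ub2[of Y] psd_nonneg[OF psd, of "kern \<alpha> Y"] by simp
  have fi: "integrable lborel (f m)" and f1: "m < N \<Longrightarrow> (\<integral>y. f m y \<partial>lborel) = 1" for m
    using inner_on_kern_isometry[OF \<alpha> S, of "e m"] e[of m m] by (auto simp: f_def[abs_def] sq_int_def)
  have f0: "f m y \<ge> 0" for m y by (simp add: f_def)
  have fneg: "f m y = 0" if "y \<le> 0" for m y
    using inner_on_kern_nonpos[OF \<alpha> S(2) that] by (simp add: f_def)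
  have tail: "(\<integral>y. indicator {R<..} y * f m y \<partial>lborel) \<le> 2 * D\<^sup>2 / \<delta>" if m: "m < N" for m
  proof -
    have zm: "0 < z m" "z m \<le> R - \<delta>" "z m < R" using z(1,2)[OF m] \<open>\<delta> > 0\<close> by auto
    have "(\<integral>y. indicator {R<..} y * f m y \<partial>lborel) \<le> 2 * D\<^sup>2 / (R - z m)"
    proof (rule integral_tail_le[OF fi])
      fix y assume y: "y > R"
      then have yp: "y > 0" "y > z m" "y - z m > 0" using zm \<open>R > 0\<close> by auto
      \<comment> \<open>The factor \<open>y + z m\<close> offsets the growing numerator
        \<open>z m\<close>, so that the decay depends only on the distance to the zero.\<close>
      have "y\<^sup>2 - (z m)\<^sup>2 = (y - z m) * (y + z m)" by (simp add: power2_eq_square algebra_simps)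
      then have "inner_on S (e m) (kern \<alpha> y) = - sqrt 2 * sqrt_bessel \<alpha> y * (z m / (y + z m)) / (y - z m)"
        using offd[OF m yp(1)] yp l0[OF m] by (simp add: e_def ps mult_ac)
      then have "f m y = 2 * (sqrt_bessel \<alpha> y)\<^sup>2 * (z m / (y + z m))\<^sup>2 / (y - z m)\<^sup>2"
        by (simp add: f_def power_mult_distrib power_divide)
      also have "\<dots> \<le> 2 * D\<^sup>2 * 1 / (y - z m)\<^sup>2"
      proof (intro divide_right_mono mult_mono)
        show "(sqrt_bessel \<alpha> y)\<^sup>2 \<le> D\<^sup>2" using abs_le_square_iff[of "sqrt_bessel \<alpha> y" D] D[of y] by simp
        show "(z m / (y + z m))\<^sup>2 \<le> 1" using yp zm by (intro power_le_one) auto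
      qed auto
      finally show "f m y \<le> 2 * D\<^sup>2 / (y - z m)\<^sup>2" by simp
    qed (use f0 zm in auto)
    also have "\<dots> \<le> 2 * D\<^sup>2 / \<delta>" using zm \<open>\<delta> > 0\<close> by (intro divide_left_mono) auto
    finally show ?thesis .
  qed
  have ii: "integrable lborel (\<lambda>y. indicator A y * f m y)" if "A \<in> sets borel" for A m
    using integrable_mult_indicator[OF _ fi, of A] that by simp
  have "1 - 2 * D\<^sup>2 / \<delta> \<le> (\<integral>y. indicator {0<..R} y * f m y \<partial>lborel)" if m: "m < N" for m
  proof -
    have "f m y = indicator {0<..R} y * f m y + indicator {R<..} y * f m y" for y
      using fneg[of y m] \<open>R > 0\<close> by (auto simp: indicator_def)
    then have "(\<integral>y. f m y \<partial>lborel) = (\<integral>y. indicator {0<..R} y * f m y + indicator {R<..} y * f m y \<partial>lborel)"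
      by simp
    also have "\<dots> = (\<integral>y. indicator {0<..R} y * f m y \<partial>lborel) + (\<integral>y. indicator {R<..} y * f m y \<partial>lborel)"
      by (intro Bochner_Integration.integral_add ii) auto
    finally show ?thesis using tail[OF m] f1[OF m] by simp
  qed
  then have "(\<Sum>m<N. 1 - 2 * D\<^sup>2 / \<delta>) \<le> (\<Sum>m<N. \<integral>y. indicator {0<..R} y * f m y \<partial>lborel)"
    by (intro sum_mono) auto
  also have "\<dots> = (\<integral>y. (\<Sum>m<N. indicator {0<..R} y * f m y) \<partial>lborel)"
    by (intro Bochner_Integration.integral_sum[symmetric] ii) auto
  also have "\<dots> \<le> (\<integral>y. D\<^sup>2 * indicator {0<..Y} y + (L + C / Y) * indicator {0<..R} y \<partial>lborel)"
  proof (rule integral_mono)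
    show "integrable lborel (\<lambda>y. \<Sum>m<N. indicator {0<..R} y * f m y)"
      by (intro Bochner_Integration.integrable_sum ii) auto
    show "integrable lborel (\<lambda>y. D\<^sup>2 * indicator {0<..Y} y + (L + C / Y) * indicator {0<..R} y)"
      using \<open>Y > 0\<close> \<open>R > 0\<close>
      by (intro Bochner_Integration.integrable_add integrable_mult_right integrable_real_indicator) auto
    fix y
    have "(\<Sum>m<N. indicator {0<..R} y * f m y) = indicator {0<..R} y * (\<Sum>m<N. f m y)"
      by (simp add: sum_distrib_left)
    also have "\<dots> \<le> D\<^sup>2 * indicator {0<..Y} y + (L + C / Y) * indicator {0<..R} y"
      using order.trans[OF bessel ub1, of y] order.trans[OF bessel ub2, of y] LCY
      by (auto simp: indicator_def)
    finally show "(\<Sum>m<N. indicator {0<..R} y * f m y) \<le> D\<^sup>2 * indicator {0<..Y} y + (L + C / Y) * indicator {0<..R} y" .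
  qed
  also have "\<dots> = D\<^sup>2 * Y + (L + C / Y) * R"
    using \<open>Y > 0\<close> \<open>R > 0\<close> by (subst Bochner_Integration.integral_add) auto
  finally show ?thesis by simp
qed

lemma affine_le_imp_slope_le:
  fixes a b c d :: real
  assumes "\<And>r. r \<ge> r0 \<Longrightarrow> a * r + b \<le> c * r + d"
  shows "a \<le> c"
proof (rule ccontr)
  assume "\<not> a \<le> c"
  then have "a - c > 0" by simp
  define r where "r = max r0 ((d - b + 1) / (a - c))"
  have "(a - c) * ((d - b + 1) / (a - c)) = d - b + 1" using \<open>a - c > 0\<close> by simp
  moreover have "(a - c) * r \<ge> (a - c) * ((d - b + 1) / (a - c))"
    using \<open>a - c > 0\<close> by (intro mult_left_mono) (auto simp: r_def)
  ultimately have "(a - c) * r \<ge> d - b + 1" by simp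
  with assms[of r] show False by (simp add: r_def algebra_simps)
qed

text \<open>Choosing one zero in each of the consecutive intervals of length \<open>T > pi\<close>
  gives about \<open>r / T\<close> zeros below \<open>r\<close>. Comparing the slopes in
  \<open>r\<close> leaves an inequality in \<open>T\<close>, \<open>\<delta>\<close> and
  \<open>Y\<close>.\<close>

lemma sqrt_bessel_mean_square_ge:
  assumes \<alpha>: "\<alpha> > -1/2" and LC: "\<And>z. z \<ge> 0 \<Longrightarrow> \<bar>sqrt_bessel_sq_primitive \<alpha> z - L * z\<bar> \<le> C"
  shows "L \<ge> 1 / pi"
proof -
  obtain D where D: "D > 0" "\<And>z. \<bar>sqrt_bessel \<alpha> z\<bar> \<le> D" using sqrt_bessel_bound[OF \<alpha>] by blast
  have slope: "(1 - 2 * D\<^sup>2 / \<delta>) / T \<le> L + C / Y" if T: "T > pi" and d: "\<delta> > 2 * D\<^sup>2" and Y: "Y > 0" for T \<delta> Y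
  proof -
    have T0: "T > 0" using T pi_gt_zero by linarith
    have d0: "\<delta> > 0" using d by (meson order.strict_trans1 zero_le_mult_iff zero_le_numeral zero_le_power2)
    obtain z0 where z0: "z0 > 0" "\<And>p. p \<ge> z0 \<Longrightarrow> \<exists>z. p \<le> z \<and> z < p + T \<and> sqrt_bessel \<alpha> z = 0"
      using sqrt_bessel_zero_exists[OF \<alpha> T] by blast
    have "\<exists>z. z0 + real m * T \<le> z \<and> z < z0 + real m * T + T \<and> sqrt_bessel \<alpha> z = 0" for m :: nat
      using T0 by (intro z0(2)) auto
    then obtain z where z: "\<And>m::nat. z0 + real m * T \<le> z m" "\<And>m. z m < z0 + real m * T + T" "\<And>m. sqrt_bessel \<alpha> (z m) = 0"
      by metis
    have zless: "z m < z n" if "m < n" for m n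
    proof -
      have "(real m + 1) * T \<le> real n * T" using that T0 by (intro mult_right_mono) auto
      then show ?thesis using z(2)[of m] z(1)[of n] by (simp add: algebra_simps)
    qed
    have inj: "inj_on z A" for A
      by (rule inj_onI) (metis less_irrefl linorder_neqE_nat zless)
    define q where "q = 1 - 2 * D\<^sup>2 / \<delta>"
    have q: "q > 0" using d d0 by (simp add: q_def)
    have "(q / T) * r + (- (q / T) * (\<delta> + z0) - q) \<le> (L + C / Y) * r + D\<^sup>2 * Y" if r: "r \<ge> \<delta> + z0 + 1" for r
    proof -
      \<comment> \<open>The zero number \<open>m\<close> lies below \<open>z0 + (m + 1) * T\<close>,
        so the first \<open>N\<close> of them stay below \<open>r - \<delta>\<close>.\<close>
      define N where "N = nat \<lfloor>(r - \<delta> - z0) / T\<rfloor>"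
      have rp: "(r - \<delta> - z0) / T \<ge> 0" using r T0 by simp
      then have N: "real N \<le> (r - \<delta> - z0) / T" "real N \<ge> (r - \<delta> - z0) / T - 1"
        unfolding N_def by linarith+
      have "real N * q \<le> D\<^sup>2 * Y + (L + C / Y) * r"
        unfolding q_def
      proof (rule zero_count_bound[OF \<alpha> D(2) LC])
        fix m assume m: "m < N"
        show "z m > 0" using z(1)[of m] z0(1) T0 by (smt (verit) mult_nonneg_nonneg of_nat_0_le_iff)
        have "(real m + 1) * T \<le> real N * T" using m T0 by (intro mult_right_mono) auto
        also have "\<dots> \<le> r - \<delta> - z0" using N(1) T0 by (simp add: field_simps)
        finally show "z m \<le> r - \<delta>" using z(2)[of m] by (simp add: algebra_simps)
      qed (use z inj d0 Y r z0 in auto)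
      moreover have "((r - \<delta> - z0) / T - 1) * q \<le> real N * q" using N(2) q by (intro mult_right_mono) auto
      ultimately show ?thesis by (simp add: algebra_simps diff_divide_distrib add_divide_distrib)
    qed
    then show ?thesis unfolding q_def by (rule affine_le_imp_slope_le)
  qed
  \<comment> \<open>All three parameters move at once: \<open>T = pi + 1 / x\<close> and
    \<open>\<delta> = Y = x\<close> with \<open>x\<close> tending to infinity.\<close>
  have "((\<lambda>x::real. (1 - 2 * D\<^sup>2 * inverse x) / (pi + inverse x)) \<longlongrightarrow> (1 - 2 * D\<^sup>2 * 0) / (pi + 0)) at_top"
    by (intro tendsto_intros tendsto_inverse_0_at_top filterlim_ident) auto
  moreover have "((\<lambda>x. L + C * inverse x) \<longlongrightarrow> L + C * 0) at_top"
    by (intro tendsto_intros tendsto_inverse_0_at_top filterlim_ident)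
  moreover have "eventually (\<lambda>x. (1 - 2 * D\<^sup>2 * inverse x) / (pi + inverse x) \<le> L + C * inverse x) at_top"
    using eventually_gt_at_top[of "2 * D\<^sup>2"] eventually_gt_at_top[of 0]
  proof eventually_elim
    case (elim x)
    then show ?case using slope[of "pi + inverse x" x x] by (simp add: divide_inverse)
  qed
  ultimately have "(1 - 2 * D\<^sup>2 * 0) / (pi + 0) \<le> L + C * 0"
    by (intro tendsto_le[OF trivial_limit_at_top_linorder])
  then show ?thesis by simp
qed

section \<open>Sampled values: Plancherel-Polya inequality and tails\<close>

text \<open>Intervals of length \<open>d\<close> attached to the points are disjoint. They are taken
  half-open because two points may be exactly \<open>d\<close> apart.\<close>

lemma separated_sum_integral_le:
  fixes t :: "'i \<Rightarrow> real" and f :: "real \<Rightarrow> real"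
  assumes "finite J" and sep: "\<And>m n. m \<in> J \<Longrightarrow> n \<in> J \<Longrightarrow> m \<noteq> n \<Longrightarrow> d \<le> \<bar>t m - t n\<bar>"
    and f: "integrable lborel f" "\<And>s. f s \<ge> 0"
  shows "(\<Sum>n\<in>J. \<integral>s. indicator {t n..<t n + d} s * f s \<partial>lborel) \<le> (\<integral>s. f s \<partial>lborel)"
proof -
  have i: "integrable lborel (\<lambda>s. indicator {t n..<t n + d} s * f s)" for n
    using integrable_mult_indicator[OF _ f(1), of "{t n..<t n + d}"] by simp
  have "(\<Sum>n\<in>J. \<integral>s. indicator {t n..<t n + d} s * f s \<partial>lborel)
     = (\<integral>s. (\<Sum>n\<in>J. indicator {t n..<t n + d} s * f s) \<partial>lborel)"
    using i by (intro Bochner_Integration.integral_sum[symmetric])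
  also have "\<dots> \<le> (\<integral>s. f s \<partial>lborel)"
  proof (rule integral_mono)
    show "integrable lborel (\<lambda>s. \<Sum>n\<in>J. indicator {t n..<t n + d} s * f s)"
      using i by (intro Bochner_Integration.integrable_sum)
    fix s
    have "(\<Sum>n\<in>J. indicator {t n..<t n + d} s) \<le> (1 :: real)"
    proof (cases "\<exists>m\<in>J. s \<in> {t m..<t m + d}")
      case True
      then obtain m where m: "m \<in> J" "s \<in> {t m..<t m + d}" by blast
      have "indicator {t n..<t n + d} s = (if n = m then 1 else 0 :: real)" if "n \<in> J" for n
        using sep[OF m(1) that] m(2) by (auto simp: indicator_def)
      then have "(\<Sum>n\<in>J. indicator {t n..<t n + d} s) = (\<Sum>n\<in>J. if n = m then 1 else 0 :: real)"
        by (intro sum.cong) auto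
      then show ?thesis using m \<open>finite J\<close> by simp
    next
      case False
      then have "(\<Sum>n\<in>J. indicator {t n..<t n + d} s :: real) = 0"
        by (intro sum.neutral) (auto simp: indicator_def)
      then show ?thesis by simp
    qed
    then have "(\<Sum>n\<in>J. indicator {t n..<t n + d} s) * f s \<le> 1 * f s"
      using f(2) by (intro mult_right_mono)
    then show "(\<Sum>n\<in>J. indicator {t n..<t n + d} s * f s) \<le> f s"
      by (simp add: sum_distrib_right)
  qed (rule f)
  finally show ?thesis .
qed

text \<open>The derivative of the kernel in \<open>\<tau>\<close> is integrated under the transform,
  with Fubini. The derivative of the transform is thereby expressed through the transform itself and
  one of order \<open>\<alpha> + 1\<close>, and both have controlled norms.\<close>

lemma hankel_increment:
  assumes \<alpha>: "\<alpha> > -1/2" and g: "g \<in> borel_measurable borel" "\<And>x. \<bar>g x\<bar> \<le> M" "\<And>x. x \<notin> {0<..R} \<Longrightarrow> g x = 0"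
    and ts: "0 < t" "t \<le> s"
  shows "hankel \<alpha> g s - hankel \<alpha> g t
    = (\<integral>\<tau>. indicator {t..s} \<tau> * ((\<alpha> + 1/2) / \<tau> * hankel \<alpha> g \<tau> - hankel (\<alpha> + 1) (\<lambda>x. x * g x) \<tau>) \<partial>lborel)"
proof -
  have \<alpha>1: "\<alpha> + 1 > -1/2" using \<alpha> by simp
  obtain D where D: "D > 0" "\<And>z. \<bar>sqrt_bessel \<alpha> z\<bar> \<le> D" "\<And>z. \<bar>sqrt_bessel (\<alpha> + 1) z\<bar> \<le> D"
    using sqrt_bessel_bounded[OF \<alpha>] by blast
  define b where "b = \<alpha> + 1/2"
  have b: "b > 0" using \<alpha> by (simp add: b_def)
  define q where "q x \<tau> = indicator {t..s} \<tau> * (g x * (b * sqrt_bessel \<alpha> (\<tau> * x) / \<tau> - x * sqrt_bessel (\<alpha> + 1) (\<tau> * x)))" for x \<tau>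
  note [measurable] = sqrt_bessel_borel_measurable[OF \<alpha>] sqrt_bessel_borel_measurable[OF \<alpha>1] g(1)
  have gi: "integrable lborel g" "integrable lborel (\<lambda>x. x * g x)"
  proof -
    have "g = (\<lambda>x. indicator {0<..R} x * g x)" "(\<lambda>x. x * g x) = (\<lambda>x. indicator {0<..R} x * (x * g x))"
      using g(3) by (auto simp: fun_eq_iff indicator_def)
    moreover have "integrable lborel (\<lambda>x. indicator {0<..R} x * g x)"
      by (rule integrable_indicator_bounded[of _ R _ M]) (use g in auto)
    moreover have "\<bar>x * g x\<bar> \<le> R * M" if "x \<in> {0<..R}" for x
      unfolding abs_mult using that g(2)[of x] by (intro mult_mono) auto
    then have "integrable lborel (\<lambda>x. indicator {0<..R} x * (x * g x))"
      by (intro integrable_indicator_bounded[of _ R _ "R * M"]) auto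
    ultimately show "integrable lborel g" "integrable lborel (\<lambda>x. x * g x)" by simp_all
  qed
  have qx: "(\<integral>\<tau>. q x \<tau> \<partial>lborel) = g x * (sqrt_bessel \<alpha> (s * x) - sqrt_bessel \<alpha> (t * x))" for x
  proof (cases "x > 0")
    case True
    have "((\<lambda>\<tau>. b * sqrt_bessel \<alpha> (\<tau> * x) / \<tau> - x * sqrt_bessel (\<alpha> + 1) (\<tau> * x)) has_integral (sqrt_bessel \<alpha> (s * x) - sqrt_bessel \<alpha> (t * x))) {t..s}"
    proof (rule fundamental_theorem_of_calculus[OF ts(2)])
      fix \<tau> assume "\<tau> \<in> {t..s}"
      then have \<tau>: "\<tau> > 0" using ts by simp
      have "((\<lambda>\<tau>. sqrt_bessel \<alpha> (\<tau> * x)) has_real_derivative (b * sqrt_bessel \<alpha> (\<tau> * x) / (\<tau> * x) - sqrt_bessel (\<alpha> + 1) (\<tau> * x)) * x) (at \<tau> within {t..s})"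
        unfolding b_def using \<tau> True \<alpha>
        by (intro DERIV_subset[OF DERIV_chain2[OF DERIV_sqrt_bessel]]) (auto intro!: derivative_eq_intros)
      then show "((\<lambda>\<tau>. sqrt_bessel \<alpha> (\<tau> * x)) has_vector_derivative b * sqrt_bessel \<alpha> (\<tau> * x) / \<tau> - x * sqrt_bessel (\<alpha> + 1) (\<tau> * x)) (at \<tau> within {t..s})"
        using True \<tau> by (simp add: has_real_derivative_iff_has_vector_derivative algebra_simps)
    qed
    then have "integral {t..s} (\<lambda>\<tau>. b * sqrt_bessel \<alpha> (\<tau> * x) / \<tau> - x * sqrt_bessel (\<alpha> + 1) (\<tau> * x)) = sqrt_bessel \<alpha> (s * x) - sqrt_bessel \<alpha> (t * x)"
      by (rule integral_unique)
    moreover have "continuous_on {t..s} (\<lambda>\<tau>. b * sqrt_bessel \<alpha> (\<tau> * x) / \<tau> - x * sqrt_bessel (\<alpha> + 1) (\<tau> * x))"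
      unfolding mult.commute[of _ x] using ts
      by (intro continuous_intros continuous_on_sqrt_bessel_mult \<alpha> \<alpha>1) auto
    note set_borel_integral_eq_integral(2)[OF borel_integrable_atLeastAtMost'[OF this]]
    ultimately have "(LINT \<tau>:{t..s}|lborel. b * sqrt_bessel \<alpha> (\<tau> * x) / \<tau> - x * sqrt_bessel (\<alpha> + 1) (\<tau> * x)) = sqrt_bessel \<alpha> (s * x) - sqrt_bessel \<alpha> (t * x)"
      by (simp only:)
    moreover have "q x = (\<lambda>\<tau>. g x * (indicator {t..s} \<tau> *\<^sub>R (b * sqrt_bessel \<alpha> (\<tau> * x) / \<tau> - x * sqrt_bessel (\<alpha> + 1) (\<tau> * x))))"
      by (simp add: q_def fun_eq_iff mult_ac)
    ultimately show ?thesis by (simp add: set_lebesgue_integral_def)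
  next
    case False
    then have "g x = 0" using g(3)[of x] by simp
    then show ?thesis by (simp add: q_def)
  qed
  have qt: "(\<integral>x. q x \<tau> \<partial>lborel) = indicator {t..s} \<tau> * (b / \<tau> * hankel \<alpha> g \<tau> - hankel (\<alpha> + 1) (\<lambda>x. x * g x) \<tau>)" for \<tau>
  proof -
    have "q x \<tau> = indicator {t..s} \<tau> * (b / \<tau> * (g x * sqrt_bessel \<alpha> (\<tau> * x)) - (x * g x) * sqrt_bessel (\<alpha> + 1) (\<tau> * x))" for x
      by (simp add: q_def algebra_simps)
    then show ?thesis
      using integrable_mult_sqrt_bessel[OF \<alpha> gi(1), of \<tau>] integrable_mult_sqrt_bessel[OF \<alpha>1 gi(2), of \<tau>]
      by (simp add: hankel_def)
  qed
  have "integrable (lborel \<Otimes>\<^sub>M lborel) (case_prod q)"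
  proof (rule Bochner_Integration.integrable_bound)
    have i0: "integrable lborel (\<lambda>x. \<bar>g x\<bar> * (b * D / t) + \<bar>x * g x\<bar> * D)" using gi by simp
    have i1: "integrable lborel (indicator {t..s} :: real \<Rightarrow> real)" using ts by (auto simp: emeasure_lborel_Icc_eq intro!: integrable_real_indicator)
    show "integrable (lborel \<Otimes>\<^sub>M lborel) (\<lambda>(x, \<tau>). (\<bar>g x\<bar> * (b * D / t) + \<bar>x * g x\<bar> * D) * indicator {t..s} \<tau>)"
      using i0 i1 by (intro lborel_pair.Fubini_integrable) (auto simp: abs_mult)
    show "case_prod q \<in> borel_measurable (lborel \<Otimes>\<^sub>M lborel)" unfolding q_def by measurable
    have "\<bar>q x \<tau>\<bar> \<le> (\<bar>g x\<bar> * (b * D / t) + \<bar>x * g x\<bar> * D) * indicator {t..s} \<tau>" for x \<tau>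
    proof (cases "\<tau> \<in> {t..s}")
      case True
      have "\<bar>b * sqrt_bessel \<alpha> (\<tau> * x) / \<tau>\<bar> \<le> b * D / t"
        unfolding abs_mult abs_divide using True ts b D by (intro frac_le mult_mono) auto
      moreover have "\<bar>x * sqrt_bessel (\<alpha> + 1) (\<tau> * x)\<bar> \<le> \<bar>x\<bar> * D"
        unfolding abs_mult using D by (intro mult_left_mono) auto
      ultimately have "\<bar>b * sqrt_bessel \<alpha> (\<tau> * x) / \<tau> - x * sqrt_bessel (\<alpha> + 1) (\<tau> * x)\<bar> \<le> b * D / t + \<bar>x\<bar> * D" by linarith
      then have "\<bar>g x\<bar> * \<bar>b * sqrt_bessel \<alpha> (\<tau> * x) / \<tau> - x * sqrt_bessel (\<alpha> + 1) (\<tau> * x)\<bar> \<le> \<bar>g x\<bar> * (b * D / t + \<bar>x\<bar> * D)"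
        by (intro mult_left_mono) auto
      also have "\<dots> = \<bar>g x\<bar> * (b * D / t) + \<bar>x * g x\<bar> * D" by (simp add: abs_mult algebra_simps)
      finally show ?thesis using True by (simp add: q_def abs_mult)
    qed (simp add: q_def)
    then show "AE z in lborel \<Otimes>\<^sub>M lborel. norm (case_prod q z)
       \<le> norm (case z of (x, \<tau>) \<Rightarrow> (\<bar>g x\<bar> * (b * D / t) + \<bar>x * g x\<bar> * D) * indicator {t..s} \<tau>)"
      by (auto intro!: AE_I2 intro: order.trans[OF _ abs_ge_self])
  qed
  from lborel_pair.Fubini_integral[OF this]
  have "(\<integral>\<tau>. (\<integral>x. q x \<tau> \<partial>lborel) \<partial>lborel) = (\<integral>x. (\<integral>\<tau>. q x \<tau> \<partial>lborel) \<partial>lborel)" .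
  also have "\<dots> = hankel \<alpha> g s - hankel \<alpha> g t"
    unfolding qx hankel_def using integrable_mult_sqrt_bessel[OF \<alpha> gi(1)] by (simp add: right_diff_distrib)
  finally show ?thesis by (simp add: qt b_def)
qed

text \<open>A sample is bounded by the mean of \<open>F\<^sup>2\<close> over an adjacent interval
  plus the variation of \<open>F\<close> there. The latter is controlled in mean square: the
  transform of \<open>x * g x\<close> has norm at most \<open>R\<close> times that of
  \<open>g\<close>, and \<open>(\<alpha> + 1/2) / y\<close> is bounded for
  \<open>y \<ge> \<tau>\<close>. The quantifier order makes \<open>B\<close> common to all
  \<open>S\<close>.\<close>

lemma plancherel_polya:
  fixes t :: "nat \<Rightarrow> real"
  assumes \<alpha>: "\<alpha> > -1/2" and \<tau>: "\<tau> > 0" "\<And>n. t n \<ge> \<tau>" and d: "d > 0" "\<And>m n. m \<noteq> n \<Longrightarrow> d \<le> \<bar>t m - t n\<bar>"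
  shows "\<exists>B>0. \<forall>S u J. S \<in> sets borel \<longrightarrow> S \<subseteq> {0<..R} \<longrightarrow> finite J \<longrightarrow>
      (\<Sum>n\<in>J. (inner_on S u (kern \<alpha> (t n)))\<^sup>2) \<le> B * inner_on S u u"
proof -
  define b where "b = (\<alpha> + 1/2) / \<tau>"
  have b0: "b > 0" using \<alpha> \<tau> by (simp add: b_def)
  \<comment> \<open>The first \<open>2\<close> accounts for the mean of \<open>F\<^sup>2\<close>,
    the factor \<open>2 * d\<^sup>2\<close> for the Cauchy-Schwarz bound of the increment, and
    \<open>2 * b\<^sup>2 + 2 * R\<^sup>2\<close> bounds the squared norm of
    \<open>Q\<close>.\<close>
  define B where "B = (2 + 2 * d\<^sup>2 * (2 * b\<^sup>2 + 2 * R\<^sup>2)) / d"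
  have "2 + 2 * d\<^sup>2 * (2 * b\<^sup>2 + 2 * R\<^sup>2) > 0" by (intro add_pos_nonneg) auto
  then have B: "B > 0" using d by (simp add: B_def)
  have dB: "d * B = 2 + 2 * d\<^sup>2 * (2 * b\<^sup>2 + 2 * R\<^sup>2)" using d by (simp add: B_def)
  have \<alpha>1: "\<alpha> + 1 > -1/2" using \<alpha> by simp
  have "(\<Sum>n\<in>J. (inner_on S u (kern \<alpha> (t n)))\<^sup>2) \<le> B * inner_on S u u"
    if S: "S \<in> sets borel" "S \<subseteq> {0<..R}" and J: "finite J" for S u J
  proof -
    define g where "g x = indicator S x * apply_bcontfun u x" for x
    note [measurable] = S(1)
    have g: "g \<in> borel_measurable borel" "\<And>x. \<bar>g x\<bar> \<le> norm u" "\<And>x. x \<notin> {0<..R} \<Longrightarrow> g x = 0"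
      using abs_apply_bcontfun_le[of u] S(2) by (auto simp: g_def[abs_def] indicator_def norm_ge_zero)
    have g': "(\<lambda>x. x * g x) \<in> borel_measurable borel" "\<And>x. \<bar>x * g x\<bar> \<le> \<bar>R\<bar> * norm u" "\<And>x. x \<notin> {0<..R} \<Longrightarrow> x * g x = 0"
    proof -
      show "\<bar>x * g x\<bar> \<le> \<bar>R\<bar> * norm u" for x
        using g(2,3)[of x] by (cases "x \<in> {0<..R}") (auto simp: abs_mult intro!: mult_mono)
    qed (use g in auto)
    define F H where "F = hankel \<alpha> g" and "H = hankel (\<alpha> + 1) (\<lambda>x. x * g x)"
    have F: "F y = inner_on S u (kern \<alpha> y)" for y unfolding F_def g_def by (rule hankel_cut[OF \<alpha>])
    define N where "N = inner_on S u u"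
    have FF: "sq_int lborel F" "(\<integral>y. (F y)\<^sup>2 \<partial>lborel) = N"
      using inner_on_kern_isometry[OF \<alpha> S, of u] by (simp_all add: F[abs_def] N_def)
    have gg: "(\<integral>x. (g x)\<^sup>2 \<partial>lborel) = N" "integrable lborel (\<lambda>x. (g x)\<^sup>2)"
    proof -
      have "(\<lambda>x. (g x)\<^sup>2) = (\<lambda>x. indicator S x * (apply_bcontfun u x * apply_bcontfun u x))"
        by (auto simp: g_def indicator_def power2_eq_square)
      then show "(\<integral>x. (g x)\<^sup>2 \<partial>lborel) = N" "integrable lborel (\<lambda>x. (g x)\<^sup>2)"
        using integrable_inner_on[OF S, of u u] by (simp_all add: N_def inner_on_def)
    qed
    have N0: "N \<ge> 0" using psd_nonneg[OF psd_inner_on[OF S]] by (simp add: N_def)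
    have H1: "sq_int lborel H" using hankel_isometry(1)[OF \<alpha>1 g'] by (simp add: H_def)
    have H2: "(\<integral>y. (H y)\<^sup>2 \<partial>lborel) \<le> R\<^sup>2 * N"
    proof -
      have "(l2 lborel H)\<^sup>2 = (l2 lborel (\<lambda>x. x * g x))\<^sup>2"
        using hankel_isometry(2)[OF \<alpha>1 g'] by (simp add: H_def)
      then have "(\<integral>y. (H y)\<^sup>2 \<partial>lborel) = (\<integral>x. (x * g x)\<^sup>2 \<partial>lborel)" by (simp add: l2_sq)
      also have "\<dots> \<le> (\<integral>x. R\<^sup>2 * (g x)\<^sup>2 \<partial>lborel)"
      proof (rule integral_mono')
        show "integrable lborel (\<lambda>x. R\<^sup>2 * (g x)\<^sup>2)" using gg by simp
        show "(x * g x)\<^sup>2 \<le> R\<^sup>2 * (g x)\<^sup>2" for x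
          using g(3)[of x] by (cases "x \<in> {0<..R}") (auto simp: power_mult_distrib intro!: mult_right_mono power_mono)
      qed simp
      finally show ?thesis using gg by simp
    qed
    \<comment> \<open>The derivative of \<open>F\<close>, set to \<open>0\<close> below
      \<open>\<tau>\<close> so that its coefficient is at most \<open>b\<close>.\<close>
    define Q where "Q y = indicator {\<tau>..} y * ((\<alpha> + 1/2) / y * F y - H y)" for y
    have Qle: "(Q y)\<^sup>2 \<le> 2 * b\<^sup>2 * (F y)\<^sup>2 + 2 * (H y)\<^sup>2" for y
    proof (cases "y \<ge> \<tau>")
      case True
      have "((\<alpha> + 1/2) / y)\<^sup>2 \<le> b\<^sup>2"
        unfolding b_def using True \<tau> \<alpha> by (intro power_mono divide_left_mono) auto
      then have "((\<alpha> + 1/2) / y)\<^sup>2 * (F y)\<^sup>2 \<le> b\<^sup>2 * (F y)\<^sup>2" by (intro mult_right_mono) auto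
      moreover have "(p - q)\<^sup>2 \<le> 2 * p\<^sup>2 + 2 * q\<^sup>2" for p q :: real
        using zero_le_power2[of "p + q"] by (simp add: power2_sum power2_diff)
      from this[of "(\<alpha> + 1/2) / y * F y" "H y"]
      have "(Q y)\<^sup>2 \<le> 2 * (((\<alpha> + 1/2) / y)\<^sup>2 * (F y)\<^sup>2) + 2 * (H y)\<^sup>2"
        using True by (simp add: Q_def power_mult_distrib power_divide)
      ultimately show ?thesis by simp
    qed (simp add: Q_def)
    note [measurable] = sq_int_measurable[OF FF(1)] sq_int_measurable[OF H1]
    have Qi: "integrable lborel (\<lambda>y. (Q y)\<^sup>2)"
    proof (rule Bochner_Integration.integrable_bound)
      show "integrable lborel (\<lambda>y. 2 * b\<^sup>2 * (F y)\<^sup>2 + 2 * (H y)\<^sup>2)" using FF H1 by (simp add: sq_int_def)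
      show "(\<lambda>y. (Q y)\<^sup>2) \<in> borel_measurable lborel" unfolding Q_def by measurable
      show "AE y in lborel. norm ((Q y)\<^sup>2) \<le> norm (2 * b\<^sup>2 * (F y)\<^sup>2 + 2 * (H y)\<^sup>2)"
        using Qle by (auto intro: order.trans[OF _ abs_ge_self])
    qed
    have QI: "(\<integral>y. (Q y)\<^sup>2 \<partial>lborel) \<le> (2 * b\<^sup>2 + 2 * R\<^sup>2) * N"
    proof -
      have "(\<integral>y. (Q y)\<^sup>2 \<partial>lborel) \<le> (\<integral>y. 2 * b\<^sup>2 * (F y)\<^sup>2 + 2 * (H y)\<^sup>2 \<partial>lborel)"
        using FF H1 Qi Qle by (intro integral_mono) (auto simp: sq_int_def)
      also have "\<dots> = 2 * b\<^sup>2 * N + 2 * (\<integral>y. (H y)\<^sup>2 \<partial>lborel)"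
        using FF H1 by (simp add: sq_int_def)
      also have "\<dots> \<le> 2 * b\<^sup>2 * N + 2 * (R\<^sup>2 * N)" using H2 by simp
      finally show ?thesis by (simp add: algebra_simps)
    qed
    define I where "I n = {t n..<t n + d}" for n
    have I_int: "integrable lborel (\<lambda>y. indicator (I n) y * f y)" if "integrable lborel f" for f :: "real \<Rightarrow> real" and n
      using integrable_mult_indicator[OF _ that, of "I n"] by (simp add: I_def)
    have Iset [measurable]: "I n \<in> sets borel" for n by (simp add: I_def)
    have Iind: "integrable lborel (\<lambda>y. indicator (I n) y * c)" for n and c :: real
      using d by (intro integrable_mult_left integrable_real_indicator) (auto simp: I_def)
    have pt: "d * (F (t n))\<^sup>2 \<le> 2 * (\<integral>y. indicator (I n) y * (F y)\<^sup>2 \<partial>lborel) + 2 * d\<^sup>2 * (\<integral>y. indicator (I n) y * (Q y)\<^sup>2 \<partial>lborel)" for n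
    proof -
      define W where "W = (\<integral>y. indicator (I n) y * (Q y)\<^sup>2 \<partial>lborel)"
      have W0: "W \<ge> 0" unfolding W_def by (intro Bochner_Integration.integral_nonneg) (auto simp: indicator_def)
      have inc: "(F (t n))\<^sup>2 \<le> 2 * (F s)\<^sup>2 + 2 * (d * W)" if s: "s \<in> I n" for s
      proof -
        have ts: "0 < t n" "t n \<le> s" using \<tau>(1) \<tau>(2)[of n] s by (auto simp: I_def)
        have "F s - F (t n) = (\<integral>y. indicator {t n..s} y * Q y \<partial>lborel)"
        proof -
          have "indicator {t n..s} y * ((\<alpha> + 1/2) / y * F y - H y) = indicator {t n..s} y * Q y" for y
            using \<tau>(2)[of n] by (auto simp: Q_def indicator_def)
          then show ?thesis
            using hankel_increment[OF \<alpha> g ts] by (simp only: F_def[symmetric] H_def[symmetric])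
        qed
        moreover have "\<bar>\<integral>y. indicator {t n..s} y * Q y \<partial>lborel\<bar> \<le> sqrt (d * W)"
        proof -
          have isq: "(\<lambda>y. (indicator A y :: real)\<^sup>2) = indicator A" for A :: "real set"
            by (auto simp: indicator_def)
          have 1: "sq_int lborel (\<lambda>y. indicator {t n..s} y :: real)"
            unfolding sq_int_def isq by (auto simp: emeasure_lborel_Icc_eq intro!: integrable_real_indicator)
          have Qsq: "(\<lambda>y. (indicator (I n) y * Q y)\<^sup>2) = (\<lambda>y. indicator (I n) y * (Q y)\<^sup>2)" by (auto simp: indicator_def)
          have [measurable]: "Q \<in> borel_measurable borel" unfolding Q_def[abs_def] by measurable
          have 2: "sq_int lborel (\<lambda>y. indicator (I n) y * Q y)"
            unfolding sq_int_def Qsq using I_int[OF Qi, of n] by simp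
          have "(\<integral>y. indicator {t n..s} y * Q y \<partial>lborel) = (\<integral>y. indicator {t n..s} y * (indicator (I n) y * Q y) \<partial>lborel)"
            using s by (intro Bochner_Integration.integral_cong) (auto simp: I_def indicator_def)
          also have "\<bar>\<dots>\<bar> \<le> l2 lborel (\<lambda>y. indicator {t n..s} y :: real) * l2 lborel (\<lambda>y. indicator (I n) y * Q y)"
            by (rule Cauchy_Schwarz_integral[OF 1 2])
          also have "l2 lborel (\<lambda>y. indicator {t n..s} y :: real) = sqrt (s - t n)"
            using ts by (simp add: l2_def isq)
          also have "l2 lborel (\<lambda>y. indicator (I n) y * Q y) = sqrt W"
            by (simp add: l2_def W_def Qsq)
          also have "sqrt (s - t n) * sqrt W \<le> sqrt d * sqrt W"
            using s W0 by (intro mult_right_mono) (auto simp: I_def)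
          finally show ?thesis by (simp add: real_sqrt_mult)
        qed
        ultimately have "(F s - F (t n))\<^sup>2 \<le> (sqrt (d * W))\<^sup>2"
          by (simp add: abs_le_square_iff[symmetric])
        then have "(F s - F (t n))\<^sup>2 \<le> d * W" using W0 d by simp
        moreover have "p\<^sup>2 \<le> 2 * q\<^sup>2 + 2 * (q - p)\<^sup>2" for p q :: real
          using zero_le_power2[of "2 * q - p"] by (simp add: power2_eq_square algebra_simps)
        from this[of "F (t n)" "F s"] have "(F (t n))\<^sup>2 \<le> 2 * (F s)\<^sup>2 + 2 * (F s - F (t n))\<^sup>2" .
        ultimately show ?thesis by linarith
      qed
      have "d * (F (t n))\<^sup>2 = (\<integral>y. indicator (I n) y * (F (t n))\<^sup>2 \<partial>lborel)"
        using d by (simp add: I_def)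
      also have "\<dots> \<le> (\<integral>y. 2 * (indicator (I n) y * (F y)\<^sup>2) + indicator (I n) y * (2 * (d * W)) \<partial>lborel)"
      proof (rule integral_mono)
        show "integrable lborel (\<lambda>y. 2 * (indicator (I n) y * (F y)\<^sup>2) + indicator (I n) y * (2 * (d * W)))"
          using FF(1) by (intro Bochner_Integration.integrable_add integrable_mult_right I_int Iind) (simp add: sq_int_def)
        show "indicator (I n) y * (F (t n))\<^sup>2 \<le> 2 * (indicator (I n) y * (F y)\<^sup>2) + indicator (I n) y * (2 * (d * W))" for y
          using inc[of y] by (auto simp: indicator_def)
      qed (rule Iind)
      also have "\<dots> = 2 * (\<integral>y. indicator (I n) y * (F y)\<^sup>2 \<partial>lborel) + (\<integral>y. indicator (I n) y * (2 * (d * W)) \<partial>lborel)"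
        using FF(1) I_int[of "\<lambda>y. (F y)\<^sup>2" n]
        by (subst Bochner_Integration.integral_add[OF _ Iind]) (auto simp: sq_int_def)
      also have "(\<integral>y. indicator (I n) y * (2 * (d * W)) \<partial>lborel) = 2 * d\<^sup>2 * W"
        using d by (simp add: I_def power2_eq_square)
      finally show ?thesis by (simp add: W_def)
    qed
    have "d * (\<Sum>n\<in>J. (F (t n))\<^sup>2) = (\<Sum>n\<in>J. d * (F (t n))\<^sup>2)" by (simp add: sum_distrib_left)
    also have "\<dots> \<le> (\<Sum>n\<in>J. 2 * (\<integral>y. indicator (I n) y * (F y)\<^sup>2 \<partial>lborel) + 2 * d\<^sup>2 * (\<integral>y. indicator (I n) y * (Q y)\<^sup>2 \<partial>lborel))"
      by (intro sum_mono pt)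
    also have "\<dots> = 2 * (\<Sum>n\<in>J. \<integral>y. indicator (I n) y * (F y)\<^sup>2 \<partial>lborel) + 2 * d\<^sup>2 * (\<Sum>n\<in>J. \<integral>y. indicator (I n) y * (Q y)\<^sup>2 \<partial>lborel)"
      by (simp add: sum.distrib sum_distrib_left)
    also have "\<dots> \<le> 2 * (\<integral>y. (F y)\<^sup>2 \<partial>lborel) + 2 * d\<^sup>2 * (\<integral>y. (Q y)\<^sup>2 \<partial>lborel)"
      unfolding I_def using J d(2) FF(1) Qi
      by (intro add_mono mult_left_mono separated_sum_integral_le) (auto simp: sq_int_def)
    also have "\<dots> \<le> 2 * N + 2 * d\<^sup>2 * ((2 * b\<^sup>2 + 2 * R\<^sup>2) * N)"
      using FF(2) QI by (intro add_mono mult_left_mono) auto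
    also have "\<dots> = (d * B) * N" unfolding dB by (simp add: algebra_simps)
    also have "\<dots> = d * (B * N)" by simp
    finally show ?thesis using d by (simp add: F N_def)
  qed
  with B show ?thesis by blast
qed

text \<open>Comparison with an integral. Since \<open>2 * d \<le> \<delta>\<close>, moving from
  \<open>t n\<close> by at most \<open>d\<close> at most doubles the distance to \<open>y\<close>
  and keeps it at least \<open>\<delta> / 2\<close>; the comparison function has integral
  \<open>8 / \<delta>\<close> on each side of \<open>y\<close>.\<close>

lemma separated_inverse_square_sum:
  fixes t :: "nat \<Rightarrow> real"
  assumes d: "d > 0" "\<And>m n. m \<noteq> n \<Longrightarrow> d \<le> \<bar>t m - t n\<bar>" and "finite J" and \<delta>: "\<delta> \<ge> 2 * d"
    and J: "\<And>n. n \<in> J \<Longrightarrow> \<bar>t n - y\<bar> > \<delta>"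
  shows "(\<Sum>n\<in>J. 1 / (t n - y)\<^sup>2) \<le> 16 / (d * \<delta>)"
proof -
  define f where "f s = (if \<bar>s - y\<bar> \<ge> \<delta> / 2 then 4 / (s - y)\<^sup>2 else 0)" for s
  have \<delta>0: "\<delta> > 0" using d \<delta> by linarith
  have [measurable]: "f \<in> borel_measurable borel" unfolding f_def[abs_def] by measurable
  have half: "(\<integral>\<^sup>+s. ennreal (4 / (s - y)\<^sup>2) * indicator {y + \<delta> / 2..} s \<partial>lborel) = ennreal (8 / \<delta>)"
    using nn_integral_inverse_square_tail[of y "y + \<delta> / 2" 4] \<delta>0 by simp
  have "(\<integral>\<^sup>+s. ennreal (4 / (s - y)\<^sup>2) * indicator {..y - \<delta> / 2} s \<partial>lborel)
     = (\<integral>\<^sup>+s. ennreal (4 / ((2 * y + (-1) * s) - y)\<^sup>2) * indicator {..y - \<delta> / 2} (2 * y + (-1) * s) \<partial>lborel)"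
    by (subst nn_integral_real_affine[where c="-1" and t="2 * y"]) auto
  also have "\<dots> = (\<integral>\<^sup>+s. ennreal (4 / (s - y)\<^sup>2) * indicator {y + \<delta> / 2..} s \<partial>lborel)"
    by (intro nn_integral_cong) (auto simp: indicator_def power2_commute)
  finally have half': "(\<integral>\<^sup>+s. ennreal (4 / (s - y)\<^sup>2) * indicator {..y - \<delta> / 2} s \<partial>lborel) = ennreal (8 / \<delta>)"
    using half by simp
  have "(\<integral>\<^sup>+s. ennreal (f s) \<partial>lborel)
     = (\<integral>\<^sup>+s. ennreal (4 / (s - y)\<^sup>2) * indicator {y + \<delta> / 2..} s + ennreal (4 / (s - y)\<^sup>2) * indicator {..y - \<delta> / 2} s \<partial>lborel)"
    using \<delta>0 by (intro nn_integral_cong) (auto simp: f_def indicator_def abs_if split: if_splits)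
  also have "\<dots> = ennreal (8 / \<delta>) + ennreal (8 / \<delta>)"
    by (subst nn_integral_add) (auto simp: half half')
  also have "\<dots> = ennreal (16 / \<delta>)" using \<delta>0 by (simp flip: ennreal_plus)
  finally have nn: "(\<integral>\<^sup>+s. ennreal (f s) \<partial>lborel) = ennreal (16 / \<delta>)" .
  have f0: "f s \<ge> 0" for s by (simp add: f_def)
  have fi: "integrable lborel f" "(\<integral>s. f s \<partial>lborel) = 16 / \<delta>"
    using nn f0 \<delta>0 by (auto intro!: integrableI_nonneg integral_eq_nn_integral[THEN trans] AE_I2)
  have "d * (1 / (t n - y)\<^sup>2) \<le> (\<integral>s. indicator {t n..<t n + d} s * f s \<partial>lborel)" if n: "n \<in> J" for n
  proof -
    have "d * (1 / (t n - y)\<^sup>2) = (\<integral>s. indicator {t n..<t n + d} s * (1 / (t n - y)\<^sup>2) \<partial>lborel)"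
      using d by simp
    also have "\<dots> \<le> (\<integral>s. indicator {t n..<t n + d} s * f s \<partial>lborel)"
    proof (rule integral_mono)
      show "integrable lborel (\<lambda>s. indicator {t n..<t n + d} s * (1 / (t n - y)\<^sup>2))"
        using d by (intro integrable_mult_left integrable_real_indicator) auto
      show "integrable lborel (\<lambda>s. indicator {t n..<t n + d} s * f s)"
        using integrable_mult_indicator[OF _ fi(1), of "{t n..<t n + d}"] by simp
      fix s
      show "indicator {t n..<t n + d} s * (1 / (t n - y)\<^sup>2) \<le> indicator {t n..<t n + d} s * f s"
      proof (cases "s \<in> {t n..<t n + d}")
        case True
        have 1: "\<bar>s - y\<bar> \<le> 2 * \<bar>t n - y\<bar>" "\<bar>s - y\<bar> \<ge> \<delta> / 2" "\<bar>s - y\<bar> > 0"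
        proof -
          have "\<bar>s - t n\<bar> \<le> d" using True by auto
          then have "\<bar>s - y\<bar> \<le> \<bar>t n - y\<bar> + d" "\<bar>t n - y\<bar> \<le> \<bar>s - y\<bar> + d" by linarith+
          moreover have "p \<le> 2 * q \<and> p \<ge> \<delta> / 2 \<and> p > 0" if "p \<le> q + d" "q \<le> p + d" "q > \<delta>" for p q
            using that \<delta> d(1) by auto
          ultimately show "\<bar>s - y\<bar> \<le> 2 * \<bar>t n - y\<bar>" "\<bar>s - y\<bar> \<ge> \<delta> / 2" "\<bar>s - y\<bar> > 0"
            using J[OF n] by blast+
        qed
        have "(s - y)\<^sup>2 \<le> 4 * (t n - y)\<^sup>2" using power_mono[OF 1(1), of 2] by (simp add: power_mult_distrib)
        moreover have "(s - y)\<^sup>2 > 0" "(t n - y)\<^sup>2 > 0" using 1 J[OF n] \<delta>0 by auto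
        ultimately have "1 / (t n - y)\<^sup>2 \<le> 4 / (s - y)\<^sup>2" by (simp add: field_simps)
        then show ?thesis using 1 True by (simp add: f_def)
      qed simp
    qed
    finally show ?thesis .
  qed
  then have "(\<Sum>n\<in>J. d * (1 / (t n - y)\<^sup>2)) \<le> (\<Sum>n\<in>J. \<integral>s. indicator {t n..<t n + d} s * f s \<partial>lborel)"
    by (intro sum_mono)
  also have "\<dots> \<le> (\<integral>s. f s \<partial>lborel)"
    using d(2) fi(1) f0 \<open>finite J\<close> by (intro separated_sum_integral_le) auto
  finally have "d * (\<Sum>n\<in>J. 1 / (t n - y)\<^sup>2) \<le> 16 / \<delta>" by (simp add: fi sum_distrib_left)
  then show ?thesis using d \<delta>0 by (simp add: field_simps)
qed

text \<open>Lommel's boundary term is at most \<open>(s + y) * D\<^sup>2\<close>, and the factor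
  \<open>s + y\<close> cancels against \<open>s\<^sup>2 - y\<^sup>2\<close>.\<close>

lemma inner_on_kern_interval_le:
  assumes \<alpha>: "\<alpha> > -1/2" and D: "\<And>z. \<bar>sqrt_bessel \<alpha> z\<bar> \<le> D" "\<And>z. \<bar>sqrt_bessel (\<alpha> + 1) z\<bar> \<le> D"
    and q: "0 \<le> q" and ys: "y > 0" "s > 0" "y \<noteq> s"
  shows "(inner_on {0<..q} (kern \<alpha> y) (kern \<alpha> s))\<^sup>2 \<le> D ^ 4 * (1 / (s - y)\<^sup>2)"
proof -
  have D0: "D \<ge> 0" using D(1)[of 0] by linarith
  have kl: "\<bar>sqrt_bessel \<alpha> z * sqrt_bessel (\<alpha> + 1) w\<bar> \<le> D * D" for z w
    unfolding abs_mult using D D0 by (intro mult_mono) auto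
  have "\<bar>lommel \<alpha> y s q\<bar> \<le> s * (D * D) + y * (D * D)"
  proof -
    have "\<bar>s * (sqrt_bessel \<alpha> (y * q) * sqrt_bessel (\<alpha> + 1) (s * q))\<bar> \<le> s * (D * D)"
      unfolding abs_mult[of s] using kl[of "y * q" "s * q"] ys by simp
    moreover have "\<bar>y * (sqrt_bessel \<alpha> (s * q) * sqrt_bessel (\<alpha> + 1) (y * q))\<bar> \<le> y * (D * D)"
      unfolding abs_mult[of y] using kl[of "s * q" "y * q"] ys by simp
    moreover have "lommel \<alpha> y s q = s * (sqrt_bessel \<alpha> (y * q) * sqrt_bessel (\<alpha> + 1) (s * q)) - y * (sqrt_bessel \<alpha> (s * q) * sqrt_bessel (\<alpha> + 1) (y * q))"
      by (simp add: lommel_def)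
    ultimately show ?thesis by linarith
  qed
  then have "\<bar>lommel \<alpha> y s q\<bar> \<le> (s + y) * D\<^sup>2" by (simp add: power2_eq_square algebra_simps)
  moreover have "s\<^sup>2 - y\<^sup>2 = (s + y) * (s - y)" by (simp add: power2_eq_square algebra_simps)
  moreover have "\<bar>(s + y) * (s - y)\<bar> = (s + y) * \<bar>s - y\<bar>" using ys by (simp add: abs_mult)
  ultimately have "\<bar>lommel \<alpha> y s q / (s\<^sup>2 - y\<^sup>2)\<bar> \<le> (s + y) * D\<^sup>2 / ((s + y) * \<bar>s - y\<bar>)"
    using ys by (simp only: abs_divide) (intro divide_right_mono, auto)
  also have "\<dots> = D\<^sup>2 / \<bar>s - y\<bar>" using ys by simp
  finally have "\<bar>inner_on {0<..q} (kern \<alpha> y) (kern \<alpha> s)\<bar> \<le> D\<^sup>2 / \<bar>s - y\<bar>"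
    using inner_on_kern_lommel[OF \<alpha>, of 0 q y s] q ys by (simp add: lommel_0)
  then have "\<bar>inner_on {0<..q} (kern \<alpha> y) (kern \<alpha> s)\<bar>\<^sup>2 \<le> (D\<^sup>2 / \<bar>s - y\<bar>)\<^sup>2"
    by (intro power_mono) auto
  then show ?thesis by (simp add: power_divide flip: power_mult)
qed

section \<open>Uniformly small far samples, from intervals to Borel sets\<close>

lemma inner_on_Un:
  assumes "A \<in> sets borel" "B \<in> sets borel" "A \<subseteq> {0<..R}" "B \<subseteq> {0<..R}" "A \<inter> B = {}"
  shows "inner_on (A \<union> B) u v = inner_on A u v + inner_on B u v"
proof -
  have "inner_on (A \<union> B) u v = (\<integral>x. indicator A x * (apply_bcontfun u x * apply_bcontfun v x)
     + indicator B x * (apply_bcontfun u x * apply_bcontfun v x) \<partial>lborel)"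
    unfolding inner_on_def using assms(5) by (intro Bochner_Integration.integral_cong) (auto simp: indicator_def)
  also have "\<dots> = inner_on A u v + inner_on B u v"
    unfolding inner_on_def using assms by (intro Bochner_Integration.integral_add integrable_inner_on)
  finally show ?thesis .
qed

text \<open>One \<open>\<delta>\<close> serves every \<open>y\<close>; this uniformity later frees
  the counting error from the position of the interval. Finite index sets stand for the infinite
  sums.\<close>

definition small_tails :: "real \<Rightarrow> (nat \<Rightarrow> real) \<Rightarrow> real set \<Rightarrow> bool" where
  "small_tails \<alpha> t S \<longleftrightarrow> (\<forall>\<eta>>0. \<exists>\<delta>. \<forall>y>0. \<forall>J. finite J \<longrightarrow> (\<forall>n\<in>J. \<bar>t n - y\<bar> > \<delta>) \<longrightarrow>
     (\<Sum>n\<in>J. (inner_on S (kern \<alpha> y) (kern \<alpha> (t n)))\<^sup>2) \<le> \<eta>)"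

lemma sum_sq_le: "(\<Sum>n\<in>J. (f n + g n)\<^sup>2) \<le> 2 * (\<Sum>n\<in>J. (f n)\<^sup>2) + 2 * (\<Sum>n\<in>J. (g n :: real)\<^sup>2)"
proof -
  have "(p + q)\<^sup>2 \<le> 2 * p\<^sup>2 + 2 * q\<^sup>2" for p q :: real
    using zero_le_power2[of "p - q"] by (simp add: power2_sum power2_diff)
  then have "(\<Sum>n\<in>J. (f n + g n)\<^sup>2) \<le> (\<Sum>n\<in>J. 2 * (f n)\<^sup>2 + 2 * (g n)\<^sup>2)" by (intro sum_mono)
  then show ?thesis by (simp add: sum.distrib sum_distrib_left)
qed

text \<open>The sign \<open>c = 1\<close> handles disjoint unions and \<open>c = -1\<close> relative
  complements. The factors \<open>2\<close> from squaring a sum are the reason for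
  \<open>\<eta> / 4\<close>.\<close>

lemma small_tails_combine:
  assumes "small_tails \<alpha> t A" "small_tails \<alpha> t B"
    and "\<And>u v. inner_on S u v = inner_on A u v + c * inner_on B u v" "c\<^sup>2 = 1"
  shows "small_tails \<alpha> t S"
  unfolding small_tails_def
proof (intro allI impI)
  fix \<eta> :: real assume "\<eta> > 0"
  then have "\<eta> / 4 > 0" by simp
  obtain \<delta>1 where 1: "\<And>y J. y > 0 \<Longrightarrow> finite J \<Longrightarrow> \<forall>n\<in>J. \<bar>t n - y\<bar> > \<delta>1 \<Longrightarrow>
     (\<Sum>n\<in>J. (inner_on A (kern \<alpha> y) (kern \<alpha> (t n)))\<^sup>2) \<le> \<eta> / 4"
    using assms(1) \<open>\<eta> / 4 > 0\<close> unfolding small_tails_def by meson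
  obtain \<delta>2 where 2: "\<And>y J. y > 0 \<Longrightarrow> finite J \<Longrightarrow> \<forall>n\<in>J. \<bar>t n - y\<bar> > \<delta>2 \<Longrightarrow>
     (\<Sum>n\<in>J. (inner_on B (kern \<alpha> y) (kern \<alpha> (t n)))\<^sup>2) \<le> \<eta> / 4"
    using assms(2) \<open>\<eta> / 4 > 0\<close> unfolding small_tails_def by meson
  show "\<exists>\<delta>. \<forall>y>0. \<forall>J. finite J \<longrightarrow> (\<forall>n\<in>J. \<bar>t n - y\<bar> > \<delta>) \<longrightarrow>
     (\<Sum>n\<in>J. (inner_on S (kern \<alpha> y) (kern \<alpha> (t n)))\<^sup>2) \<le> \<eta>"
  proof (intro exI[of _ "max \<delta>1 \<delta>2"] allI impI)
    fix y :: real and J assume J: "y > 0" "finite J" "\<forall>n\<in>J. \<bar>t n - y\<bar> > max \<delta>1 \<delta>2"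
    have "(\<Sum>n\<in>J. (inner_on S (kern \<alpha> y) (kern \<alpha> (t n)))\<^sup>2)
      \<le> 2 * (\<Sum>n\<in>J. (inner_on A (kern \<alpha> y) (kern \<alpha> (t n)))\<^sup>2) + 2 * (\<Sum>n\<in>J. (c * inner_on B (kern \<alpha> y) (kern \<alpha> (t n)))\<^sup>2)"
      unfolding assms(3) by (rule sum_sq_le)
    also have "\<dots> = 2 * (\<Sum>n\<in>J. (inner_on A (kern \<alpha> y) (kern \<alpha> (t n)))\<^sup>2) + 2 * (\<Sum>n\<in>J. (inner_on B (kern \<alpha> y) (kern \<alpha> (t n)))\<^sup>2)"
      by (simp add: power_mult_distrib assms(4))
    also have "\<dots> \<le> \<eta>" using 1[of y J] 2[of y J] J by simp
    finally show "(\<Sum>n\<in>J. (inner_on S (kern \<alpha> y) (kern \<alpha> (t n)))\<^sup>2) \<le> \<eta>" .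
  qed
qed

lemma small_tails_interval:
  assumes \<alpha>: "\<alpha> > -1/2" and t0: "\<And>n. t n > 0" and d: "d > 0" "\<And>m n. m \<noteq> n \<Longrightarrow> d \<le> \<bar>t m - t n\<bar>"
  shows "small_tails \<alpha> t {0<..q}"
proof -
  obtain D where D: "D > 0" "\<And>z. \<bar>sqrt_bessel \<alpha> z\<bar> \<le> D" "\<And>z. \<bar>sqrt_bessel (\<alpha> + 1) z\<bar> \<le> D"
    using sqrt_bessel_bounded[OF \<alpha>] by blast
  define q' where "q' = max 0 q"
  have q': "{0<..q} = {0<..q'}" "q' \<ge> 0" by (auto simp: q'_def)
  show ?thesis unfolding small_tails_def q'(1)
  proof (intro allI impI)
    fix \<eta> :: real assume \<eta>: "\<eta> > 0"
    \<comment> \<open>The second entry makes \<open>D ^ 4 * (16 / (d * \<delta>))\<close> at most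
      \<open>\<eta>\<close>; the first meets the requirement of the inverse-square sum.\<close>
    define \<delta> where "\<delta> = max (2 * d) (16 * D ^ 4 / (d * \<eta>))"
    have \<delta>: "\<delta> \<ge> 2 * d" "\<delta> > 0" "\<delta> \<ge> 16 * D ^ 4 / (d * \<eta>)" using d by (auto simp: \<delta>_def)
    show "\<exists>\<delta>. \<forall>y>0. \<forall>J. finite J \<longrightarrow> (\<forall>n\<in>J. \<bar>t n - y\<bar> > \<delta>) \<longrightarrow>
       (\<Sum>n\<in>J. (inner_on {0<..q'} (kern \<alpha> y) (kern \<alpha> (t n)))\<^sup>2) \<le> \<eta>"
    proof (intro exI[of _ \<delta>] allI impI)
      fix y :: real and J assume J: "y > 0" "finite J" "\<forall>n\<in>J. \<bar>t n - y\<bar> > \<delta>"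
      have "(\<Sum>n\<in>J. (inner_on {0<..q'} (kern \<alpha> y) (kern \<alpha> (t n)))\<^sup>2) \<le> (\<Sum>n\<in>J. D ^ 4 * (1 / (t n - y)\<^sup>2))"
      proof (rule sum_mono)
        fix n assume "n \<in> J"
        then have "y \<noteq> t n" using J(3) \<delta>(2) by force
        then show "(inner_on {0<..q'} (kern \<alpha> y) (kern \<alpha> (t n)))\<^sup>2 \<le> D ^ 4 * (1 / (t n - y)\<^sup>2)"
          by (intro inner_on_kern_interval_le[OF \<alpha> D(2,3) q'(2) J(1) t0])
      qed
      also have "\<dots> = D ^ 4 * (\<Sum>n\<in>J. 1 / (t n - y)\<^sup>2)" by (simp add: sum_distrib_left)
      also have "\<dots> \<le> D ^ 4 * (16 / (d * \<delta>))"
        using J D by (intro mult_left_mono separated_inverse_square_sum[where t=t, OF d _ \<delta>(1)]) auto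
      also have "\<dots> \<le> \<eta>" using \<delta> d \<eta> by (simp add: field_simps)
      finally show "(\<Sum>n\<in>J. (inner_on {0<..q'} (kern \<alpha> y) (kern \<alpha> (t n)))\<^sup>2) \<le> \<eta>" .
    qed
  qed
qed

text \<open>Induction over complements and countable disjoint unions, starting from rays, whose
  traces on \<open>(0, R]\<close> are intervals. In a countable union finitely many pieces are
  treated exactly.\<close>

lemma small_tails_borel:
  assumes \<alpha>: "\<alpha> > -1/2" and \<tau>: "\<tau> > 0" "\<And>n. t n \<ge> \<tau>" and d: "d > 0" "\<And>m n. m \<noteq> n \<Longrightarrow> d \<le> \<bar>t m - t n\<bar>"
    and A: "A \<in> sets borel"
  shows "small_tails \<alpha> t (A \<inter> {0<..R})"
proof -
  obtain D where D: "D > 0" "\<And>z. \<bar>sqrt_bessel \<alpha> z\<bar> \<le> D" using sqrt_bessel_bound[OF \<alpha>] by blast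
  have "\<exists>B>0. \<forall>S u J. S \<in> sets borel \<longrightarrow> S \<subseteq> {0<..R} \<longrightarrow> finite J \<longrightarrow>
      (\<Sum>n\<in>J. (inner_on S u (kern \<alpha> (t n)))\<^sup>2) \<le> B * inner_on S u u"
    by (rule plancherel_polya[OF \<alpha> \<tau> d])
  then obtain B where B0: "B > 0" and B1: "\<forall>S u J. S \<in> sets borel \<longrightarrow> S \<subseteq> {0<..R} \<longrightarrow> finite J \<longrightarrow>
      (\<Sum>n\<in>J. (inner_on S u (kern \<alpha> (t n)))\<^sup>2) \<le> B * inner_on S u u"
    by (elim exE conjE)
  note B = B0 B1[rule_format]
  have t0: "t n > 0" for n using \<tau>(1) \<tau>(2)[of n] by simp
  have st: "small_tails \<alpha> t {0<..q}" for q
    by (rule small_tails_interval[OF \<alpha> t0 d])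
  have sb: "sets borel = sigma_sets UNIV (range (\<lambda>a. {..a::real}))"
    by (subst borel_eq_atMost) (simp add: sets_measure_of)
  have "Int_stable (range (\<lambda>a. {..a::real}))"
    unfolding Int_stable_def
  proof safe
    fix a b :: real
    have "{..a} \<inter> {..b} = {..min a b}" by auto
    then show "{..a} \<inter> {..b} \<in> range (\<lambda>a. {..a::real})" by (simp only: range_eqI[OF refl])
  qed
  moreover have "range (\<lambda>a. {..a::real}) \<subseteq> Pow UNIV" by simp
  moreover have "A \<in> sigma_sets UNIV (range (\<lambda>a. {..a::real}))" using A sb by simp
  ultimately show ?thesis
  proof (induction rule: sigma_sets_induct_disjoint)
    case (basic A)
    then obtain a where "A = {..a}" by auto
    then have "A \<inter> {0<..R} = {0<..min a R}" by auto
    then show ?case using st by simp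
  next
    case empty
    show ?case by (auto simp: small_tails_def inner_on_def)
  next
    case (compl A)
    have Ab: "A \<in> sets borel" using compl(1) sb by simp
    have "inner_on {0<..R} u v = inner_on ((UNIV - A) \<inter> {0<..R}) u v + inner_on (A \<inter> {0<..R}) u v" for u v
      using Ab by (subst inner_on_Un[of _ _ R, symmetric]) (auto intro!: arg_cong[where f="\<lambda>S. inner_on S u v"])
    then have "inner_on ((UNIV - A) \<inter> {0<..R}) u v = inner_on {0<..R} u v + (-1) * inner_on (A \<inter> {0<..R}) u v" for u v
      by simp
    then show ?case
      by (rule small_tails_combine[OF st compl(2)]) simp
  next
    case (union A)
    have Ab: "A i \<in> sets borel" for i using union(2) sb by blast
    define P where "P N = (\<Union>i<N. A i) \<inter> {0<..R}" for N
    have Pb: "P N \<in> sets borel" for N unfolding P_def using Ab by auto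
    have PN: "small_tails \<alpha> t (P N)" for N
    proof (induction N)
      case 0
      show ?case by (auto simp: small_tails_def inner_on_def P_def)
    next
      case (Suc N)
      have "inner_on (P (Suc N)) u v = inner_on (P N) u v + 1 * inner_on (A N \<inter> {0<..R}) u v" for u v
      proof -
        have "P (Suc N) = P N \<union> (A N \<inter> {0<..R})" by (auto simp: P_def less_Suc_eq)
        moreover have "P N \<inter> (A N \<inter> {0<..R}) = {}"
        proof -
          have "A i \<inter> A N = {}" if "i < N" for i
            using that by (intro disjoint_family_onD[OF union(1)]) auto
          then show ?thesis unfolding P_def by blast
        qed
        moreover have "P N \<subseteq> {0<..R}" "A N \<inter> {0<..R} \<in> sets borel" using Ab[of N] by (auto simp: P_def)
        ultimately show ?thesis using inner_on_Un[OF Pb, of "A N \<inter> {0<..R}" N R u v] by simp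
      qed
      then show ?case by (rule small_tails_combine[OF Suc union(3)]) simp
    qed
    define E where "E N = ((\<Union>i. A i) \<inter> {0<..R}) - P N" for N
    have Eb: "E N \<in> sets borel" for N unfolding E_def using Ab Pb by auto
    have ER: "E N \<subseteq> {0<..R}" for N by (auto simp: E_def)
    have "(\<lambda>N. measure lborel (E N)) \<longlonglongrightarrow> measure lborel (\<Inter>N. E N)"
    proof (rule Lim_measure_decseq)
      show "decseq E" unfolding decseq_def E_def P_def by (auto intro: less_le_trans)
      show "emeasure lborel (E i) \<noteq> \<infinity>" for i
        using emeasure_subset_Ioc_finite[OF ER[of i]] by simp
    qed (use Eb in auto)
    moreover have "(\<Inter>N. E N) = {}" by (auto simp: E_def P_def)
    ultimately have E0: "(\<lambda>N. measure lborel (E N)) \<longlonglongrightarrow> 0" by simp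
    show ?case unfolding small_tails_def
    proof (intro allI impI)
      fix \<eta> :: real assume \<eta>: "\<eta> > 0"
      \<comment> \<open>The far samples on \<open>E N\<close> have sum of squares at most
        \<open>B * D\<^sup>2\<close> times its measure. Since \<open>B\<close> does not depend on
        the set nor \<open>D\<close> on \<open>y\<close>, \<open>N\<close> can be fixed before
        \<open>y\<close>.\<close>
      have "\<eta> / (4 * B * D\<^sup>2) > 0" using \<eta> B D by simp
      from order_tendstoD(2)[OF E0 this] obtain N where N: "measure lborel (E N) < \<eta> / (4 * B * D\<^sup>2)"
        by (auto simp: eventually_sequentially)
      have "\<eta> / 4 > 0" using \<eta> by simp
      then have "\<exists>\<delta>. \<forall>y>0. \<forall>J. finite J \<longrightarrow> (\<forall>n\<in>J. \<bar>t n - y\<bar> > \<delta>) \<longrightarrow>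
         (\<Sum>n\<in>J. (inner_on (P N) (kern \<alpha> y) (kern \<alpha> (t n)))\<^sup>2) \<le> \<eta> / 4"
        using PN[of N] unfolding small_tails_def by (elim allE[of _ "\<eta> / 4"] impE)
      then obtain \<delta> where \<delta>: "\<forall>y>0. \<forall>J. finite J \<longrightarrow> (\<forall>n\<in>J. \<bar>t n - y\<bar> > \<delta>) \<longrightarrow>
         (\<Sum>n\<in>J. (inner_on (P N) (kern \<alpha> y) (kern \<alpha> (t n)))\<^sup>2) \<le> \<eta> / 4" by (elim exE)
      have split: "inner_on ((\<Union>i. A i) \<inter> {0<..R}) u v = inner_on (P N) u v + inner_on (E N) u v" for u v
      proof -
        have "(\<Union>i. A i) \<inter> {0<..R} = P N \<union> E N" by (auto simp: E_def P_def)
        moreover have "P N \<inter> E N = {}" by (auto simp: E_def)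
        moreover have "P N \<subseteq> {0<..R}" by (auto simp: P_def)
        ultimately show ?thesis using inner_on_Un[OF Pb Eb _ ER] by simp
      qed
      show "\<exists>\<delta>. \<forall>y>0. \<forall>J. finite J \<longrightarrow> (\<forall>n\<in>J. \<bar>t n - y\<bar> > \<delta>) \<longrightarrow>
         (\<Sum>n\<in>J. (inner_on ((\<Union>i. A i) \<inter> {0<..R}) (kern \<alpha> y) (kern \<alpha> (t n)))\<^sup>2) \<le> \<eta>"
      proof (intro exI[of _ \<delta>] allI impI)
        fix y :: real and J assume J: "y > 0" "finite J" "\<forall>n\<in>J. \<bar>t n - y\<bar> > \<delta>"
        have "(\<Sum>n\<in>J. (inner_on ((\<Union>i. A i) \<inter> {0<..R}) (kern \<alpha> y) (kern \<alpha> (t n)))\<^sup>2)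
           \<le> 2 * (\<Sum>n\<in>J. (inner_on (P N) (kern \<alpha> y) (kern \<alpha> (t n)))\<^sup>2) + 2 * (\<Sum>n\<in>J. (inner_on (E N) (kern \<alpha> y) (kern \<alpha> (t n)))\<^sup>2)"
          unfolding split by (rule sum_sq_le)
        moreover have "(\<Sum>n\<in>J. (inner_on (E N) (kern \<alpha> y) (kern \<alpha> (t n)))\<^sup>2) \<le> \<eta> / 4"
        proof -
          have "(\<Sum>n\<in>J. (inner_on (E N) (kern \<alpha> y) (kern \<alpha> (t n)))\<^sup>2) \<le> B * inner_on (E N) (kern \<alpha> y) (kern \<alpha> y)"
            by (rule B(2)[OF Eb ER J(2)])
          also have "\<dots> \<le> B * (D\<^sup>2 * measure lborel (E N))"
            using B by (intro mult_left_mono inner_on_kern_le_measure[OF \<alpha> D(2) Eb ER]) auto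
          also have "\<dots> \<le> \<eta> / 4" using N B D by (simp add: field_simps)
          finally show ?thesis .
        qed
        ultimately show "(\<Sum>n\<in>J. (inner_on ((\<Union>i. A i) \<inter> {0<..R}) (kern \<alpha> y) (kern \<alpha> (t n)))\<^sup>2) \<le> \<eta>"
          using \<delta>[rule_format, OF J(1,2)] J(3) by fastforce
      qed
    qed
  qed
qed

section \<open>Complex-valued functions on the half line\<close>

lemma half_line_integral:
  fixes h :: "real \<Rightarrow> 'b::{banach, second_countable_topology}"
  assumes "h \<in> borel_measurable borel" "\<And>x. x \<le> 0 \<Longrightarrow> h x = 0"
  shows "(\<integral>x. h x \<partial>half_line) = (\<integral>x. h x \<partial>lborel)"
    and "integrable half_line h \<longleftrightarrow> integrable lborel h"
proof -
  have e: "(\<lambda>x. indicator {0<..} x *\<^sub>R h x) = h"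
    using assms(2) by (auto simp: indicator_def fun_eq_iff not_less)
  have m: "h \<in> lborel \<rightarrow>\<^sub>M borel" using assms(1) by simp
  show "(\<integral>x. h x \<partial>half_line) = (\<integral>x. h x \<partial>lborel)"
    by (subst integral_restrict_space) (simp_all add: e integral_completion[OF m])
  show "integrable half_line h \<longleftrightarrow> integrable lborel h"
    by (subst integrable_restrict_space) (simp_all add: e integrable_completion[OF m])
qed

lemma half_line_measurable:
  assumes "h \<in> borel_measurable borel"
  shows "h \<in> borel_measurable half_line"
  using assms by (intro measurable_restrict_space1 measurable_completion) simp

lemma L2_sqnorm_of_real:
  assumes "sq_int lborel h" "\<And>x. x \<le> 0 \<Longrightarrow> h x = 0"
  shows "L2_sqnorm (\<lambda>x. complex_of_real (h x)) = ennreal (\<integral>x. (h x)\<^sup>2 \<partial>lborel)"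
proof -
  have m: "h \<in> borel_measurable borel" using assms(1) by (simp add: sq_int_def)
  have "L2_sqnorm (\<lambda>x. complex_of_real (h x)) = (\<integral>\<^sup>+x. ennreal ((h x)\<^sup>2) \<partial>half_line)"
    by (simp add: L2_sqnorm_def)
  also have "\<dots> = ennreal (\<integral>x. (h x)\<^sup>2 \<partial>half_line)"
    using assms m half_line_integral(2)[of "\<lambda>x. (h x)\<^sup>2"]
    by (intro nn_integral_eq_integral) (auto simp: sq_int_def)
  also have "(\<integral>x. (h x)\<^sup>2 \<partial>half_line) = (\<integral>x. (h x)\<^sup>2 \<partial>lborel)"
    using assms m by (intro half_line_integral) auto
  finally show ?thesis .
qed

lemma square_integrable_of_real:
  assumes "sq_int lborel h" "\<And>x. x \<le> 0 \<Longrightarrow> h x = 0"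
  shows "square_integrable (\<lambda>x. complex_of_real (h x))"
proof -
  have m: "h \<in> borel_measurable borel" using assms(1) by (simp add: sq_int_def)
  have "integrable half_line (\<lambda>x. (h x)\<^sup>2)"
    using assms m half_line_integral(2)[of "\<lambda>x. (h x)\<^sup>2"] by (auto simp: sq_int_def)
  moreover have "(\<lambda>x. complex_of_real (h x)) \<in> borel_measurable half_line"
    using m by (intro half_line_measurable) simp
  ultimately show ?thesis by (simp add: square_integrable_def)
qed

lemma hankel_kernel_eq_sqrt_bessel: "x * y > 0 \<Longrightarrow> hankel_kernel \<alpha> x y = sqrt_bessel \<alpha> (x * y)"
  by (simp add: hankel_kernel_def sqrt_bessel_def)

lemma hankel_integral_of_real:
  assumes \<alpha>: "\<alpha> > -1/2" and h: "h \<in> borel_measurable borel" "\<And>x. x \<le> 0 \<Longrightarrow> h x = 0" and y: "y > 0"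
  shows "hankel_integral \<alpha> (\<lambda>x. complex_of_real (h x)) y = complex_of_real (hankel \<alpha> h y)"
proof -
  note [measurable] = h(1) sqrt_bessel_borel_measurable[OF \<alpha>]
  have "hankel_integral \<alpha> (\<lambda>x. complex_of_real (h x)) y
     = (\<integral>x. complex_of_real (h x * sqrt_bessel \<alpha> (y * x)) \<partial>half_line)"
    unfolding hankel_integral_def
    by (intro Bochner_Integration.integral_cong refl) (use y in \<open>simp add: hankel_kernel_eq_sqrt_bessel\<close>)
  also have "\<dots> = (\<integral>x. complex_of_real (h x * sqrt_bessel \<alpha> (y * x)) \<partial>lborel)"
    using h(2) by (intro half_line_integral) auto
  also have "\<dots> = complex_of_real (hankel \<alpha> h y)" by (simp only: integral_complex_of_real hankel_def)
  finally show ?thesis .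
qed

text \<open>The definition asks for integrable approximants of \<open>hankel \<alpha> g\<close>.
  Transforms of Gaussian combinations serve: inversion is known for these, so their own transforms
  are the combinations, which approach \<open>g\<close>.\<close>

lemma has_hankel_transform_hankel:
  assumes \<alpha>: "\<alpha> > -1/2" and g: "g \<in> borel_measurable borel" "\<And>x. \<bar>g x\<bar> \<le> M" "\<And>x. x \<notin> {0<..R} \<Longrightarrow> g x = 0"
  shows "has_hankel_transform \<alpha> (\<lambda>x. complex_of_real (hankel \<alpha> g x)) (\<lambda>x. complex_of_real (g x))"
proof -
  have g0: "x \<le> 0 \<Longrightarrow> g x = 0" for x using g(3)[of x] by simp
  have ex: "\<exists>\<phi>. integrable lborel \<phi> \<and> sq_int lborel \<phi> \<and> (\<forall>x\<le>0. \<phi> x = 0) \<and>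
    integrable lborel (hankel \<alpha> \<phi>) \<and> sq_int lborel (hankel \<alpha> \<phi>) \<and> hankel \<alpha> (hankel \<alpha> \<phi>) = \<phi> \<and>
    l2 lborel (\<lambda>x. g x - \<phi> x) \<le> e \<and> l2 lborel (\<lambda>x. hankel \<alpha> g x - hankel \<alpha> \<phi> x) \<le> e" if e: "e > 0" for e
    by (rule hankel_approx[OF \<alpha> g e]) blast+
  define e where "e n = inverse (real (Suc n))" for n
  have "\<forall>n. \<exists>\<phi>. integrable lborel \<phi> \<and> sq_int lborel \<phi> \<and> (\<forall>x\<le>0. \<phi> x = 0) \<and>
    integrable lborel (hankel \<alpha> \<phi>) \<and> sq_int lborel (hankel \<alpha> \<phi>) \<and> hankel \<alpha> (hankel \<alpha> \<phi>) = \<phi> \<and>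
    l2 lborel (\<lambda>x. g x - \<phi> x) \<le> e n \<and> l2 lborel (\<lambda>x. hankel \<alpha> g x - hankel \<alpha> \<phi> x) \<le> e n"
    by (intro allI ex) (simp add: e_def)
  from choice[OF this] obtain \<phi> where "\<forall>n. integrable lborel (\<phi> n) \<and> sq_int lborel (\<phi> n) \<and> (\<forall>x\<le>0. \<phi> n x = 0) \<and>
    integrable lborel (hankel \<alpha> (\<phi> n)) \<and> sq_int lborel (hankel \<alpha> (\<phi> n)) \<and> hankel \<alpha> (hankel \<alpha> (\<phi> n)) = \<phi> n \<and>
    l2 lborel (\<lambda>x. g x - \<phi> n x) \<le> e n \<and> l2 lborel (\<lambda>x. hankel \<alpha> g x - hankel \<alpha> (\<phi> n) x) \<le> e n"
    by (elim exE)
  then have \<phi>: "\<And>n. integrable lborel (\<phi> n)" "\<And>n. sq_int lborel (\<phi> n)" "\<And>n x. x \<le> 0 \<Longrightarrow> \<phi> n x = 0"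
    "\<And>n. integrable lborel (hankel \<alpha> (\<phi> n))" "\<And>n. sq_int lborel (hankel \<alpha> (\<phi> n))" "\<And>n. hankel \<alpha> (hankel \<alpha> (\<phi> n)) = \<phi> n"
    "\<And>n. l2 lborel (\<lambda>x. g x - \<phi> n x) \<le> e n" "\<And>n. l2 lborel (\<lambda>x. hankel \<alpha> g x - hankel \<alpha> (\<phi> n) x) \<le> e n"
    by blast+
  have gs: "sq_int lborel g" "sq_int lborel (hankel \<alpha> g)"
    using hankel_approx[OF \<alpha> g zero_less_one] hankel_isometry(1)[OF \<alpha> g] by blast+
  have hz: "hankel \<alpha> g y = 0" "hankel \<alpha> (\<phi> n) y = 0" if "y \<le> 0" for y n
    using that g0 \<phi>(3) by (auto intro!: hankel_nonpos)
  have "(\<lambda>n. ennreal ((e n)\<^sup>2)) \<longlonglongrightarrow> ennreal (0\<^sup>2)"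
    unfolding e_def by (intro tendsto_ennrealI tendsto_power LIMSEQ_inverse_real_of_nat)
  then have e0: "(\<lambda>n. ennreal ((e n)\<^sup>2)) \<longlonglongrightarrow> 0" by simp
  have squeeze: "(\<lambda>n. L2_sqnorm (\<lambda>x. complex_of_real (h n x))) \<longlonglongrightarrow> 0"
    if "\<And>n. sq_int lborel (h n)" "\<And>n x. x \<le> 0 \<Longrightarrow> h n x = 0" "\<And>n. l2 lborel (h n) \<le> e n" for h
  proof (rule tendsto_sandwich[OF _ _ tendsto_const e0])
    show "\<forall>\<^sub>F n in sequentially. L2_sqnorm (\<lambda>x. complex_of_real (h n x)) \<le> ennreal ((e n)\<^sup>2)"
      using that(3) l2_nonneg[of lborel]
      by (intro always_eventually allI)
         (auto simp: L2_sqnorm_of_real[OF that(1,2)] l2_sq[symmetric] intro!: ennreal_leI power_mono)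
  qed auto
  have conv1: "(\<lambda>n. L2_sqnorm (\<lambda>x. complex_of_real (hankel \<alpha> (\<phi> n) x) - complex_of_real (hankel \<alpha> g x))) \<longlonglongrightarrow> 0"
  proof -
    have "l2 lborel (\<lambda>x. hankel \<alpha> (\<phi> n) x - hankel \<alpha> g x) \<le> e n" for n
      using \<phi>(8)[of n] by (simp add: l2_def power2_commute)
    then have "(\<lambda>n. L2_sqnorm (\<lambda>x. complex_of_real (hankel \<alpha> (\<phi> n) x - hankel \<alpha> g x))) \<longlonglongrightarrow> 0"
      using \<phi>(5) gs hz by (intro squeeze sq_int_diff) auto
    then show ?thesis by simp
  qed
  have conv2: "(\<lambda>n. L2_sqnorm (\<lambda>x. hankel_integral \<alpha> (\<lambda>x. complex_of_real (hankel \<alpha> (\<phi> n) x)) x - complex_of_real (g x))) \<longlonglongrightarrow> 0"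
  proof -
    have "l2 lborel (\<lambda>x. \<phi> n x - g x) \<le> e n" for n
      using \<phi>(7)[of n] by (simp add: l2_def power2_commute)
    then have "(\<lambda>n. L2_sqnorm (\<lambda>x. complex_of_real (\<phi> n x - g x))) \<longlonglongrightarrow> 0"
      using \<phi>(2,3) gs g0 by (intro squeeze sq_int_diff) auto
    moreover have "L2_sqnorm (\<lambda>x. hankel_integral \<alpha> (\<lambda>x. complex_of_real (hankel \<alpha> (\<phi> n) x)) x - complex_of_real (g x))
       = L2_sqnorm (\<lambda>x. complex_of_real (\<phi> n x - g x))" for n
      unfolding L2_sqnorm_def
    proof (intro nn_integral_cong)
      fix y :: real assume "y \<in> space half_line"
      then have y: "y > 0" by simp
      have "hankel \<alpha> (\<phi> n) \<in> borel_measurable borel" using \<phi>(5)[of n] by (simp add: sq_int_def)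
      then have "hankel_integral \<alpha> (\<lambda>x. complex_of_real (hankel \<alpha> (\<phi> n) x)) y = complex_of_real (\<phi> n y)"
        using hankel_integral_of_real[OF \<alpha> _ hz(2) y] \<phi>(6) by simp
      then show "ennreal ((norm (hankel_integral \<alpha> (\<lambda>x. complex_of_real (hankel \<alpha> (\<phi> n) x)) y - complex_of_real (g y)))\<^sup>2)
         = ennreal ((norm (complex_of_real (\<phi> n y - g y)))\<^sup>2)" by simp
    qed
    ultimately show ?thesis by simp
  qed
  have "integrable half_line (\<lambda>x. complex_of_real (hankel \<alpha> (\<phi> n) x))" for n
  proof (subst half_line_integral(2))
    show "(\<lambda>x. complex_of_real (hankel \<alpha> (\<phi> n) x)) \<in> borel_measurable borel"
    proof -
      have "(\<lambda>x. complex_of_real (h x)) \<in> borel_measurable borel" if "h \<in> borel_measurable borel" for h :: "real \<Rightarrow> real"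
        using that by simp
      from this[of "hankel \<alpha> (\<phi> n)"] show ?thesis using sq_int_measurable[OF \<phi>(5)[of n]] by simp
    qed
  qed (use \<phi>(4) hz in auto)
  then show ?thesis
    unfolding has_hankel_transform_def
    using square_integrable_of_real[OF gs(1) g0] square_integrable_of_real[OF gs(2) hz(1)]
      square_integrable_of_real[OF \<phi>(5) hz(2)] conv1 conv2
    by (intro conjI exI[of _ "\<lambda>n x. complex_of_real (hankel \<alpha> (\<phi> n) x)"] allI) auto
qed

text \<open>The test functions are the transforms of \<open>u\<close> cut to \<open>S'\<close>. They
  belong to the space for \<open>S\<close>, so the sampling constant of \<open>S\<close> is
  inherited by the smaller set.\<close>

lemma sampling_inequality:
  assumes \<alpha>: "\<alpha> > -1/2" and S: "S \<in> sets lebesgue" "S \<subseteq> {0<..}" and S': "S' \<in> sets borel" "S' \<subseteq> S" "S' \<subseteq> {0<..R}"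
    and t: "\<And>n. t n > 0" and sampling: "set_of_sampling \<alpha> S t"
  obtains A where "A > 0" "\<And>u. ennreal (A * inner_on S' u u) \<le> (\<Sum>n. ennreal ((inner_on S' u (kern \<alpha> (t n)))\<^sup>2))"
proof -
  obtain A where A: "A > 0" "\<forall>f\<in>bandlimited \<alpha> S. \<forall>g.
        has_hankel_transform \<alpha> f g \<longrightarrow> integrable half_line g \<longrightarrow>
        ennreal A * L2_sqnorm f \<le> (\<Sum>n. ennreal ((norm (point_value \<alpha> S g (t n)))\<^sup>2))"
    using sampling unfolding set_of_sampling_def by (elim exE conjE)
  have "ennreal (A * inner_on S' u u) \<le> (\<Sum>n. ennreal ((inner_on S' u (kern \<alpha> (t n)))\<^sup>2))" for u
  proof -
    define g where "g x = indicator S' x * apply_bcontfun u x" for x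
    note [measurable] = S'(1) sqrt_bessel_borel_measurable[OF \<alpha>]
    have g: "g \<in> borel_measurable borel" "\<And>x. \<bar>g x\<bar> \<le> norm u" "\<And>x. x \<notin> {0<..R} \<Longrightarrow> g x = 0"
      using abs_apply_bcontfun_le[of u] S'(3) by (auto simp: g_def[abs_def] indicator_def norm_ge_zero)
    have g0: "x \<le> 0 \<Longrightarrow> g x = 0" for x using g(3)[of x] by simp
    define f where "f = hankel \<alpha> g"
    have h: "has_hankel_transform \<alpha> (\<lambda>x. complex_of_real (f x)) (\<lambda>x. complex_of_real (g x))"
      unfolding f_def by (rule has_hankel_transform_hankel[OF \<alpha> g])
    have "AE x in half_line. x \<notin> S \<longrightarrow> complex_of_real (g x) = 0"
      using S'(2) by (auto simp: g_def indicator_def)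
    with h have bl: "(\<lambda>x. complex_of_real (f x)) \<in> bandlimited \<alpha> S"
      unfolding bandlimited_def by blast
    have gi: "integrable lborel g"
      using hankel_approx[OF \<alpha> g zero_less_one] by blast
    have "integrable half_line (\<lambda>x. complex_of_real (g x))"
      using g g0 gi by (subst half_line_integral(2)) auto
    with A(2) bl h have "ennreal A * L2_sqnorm (\<lambda>x. complex_of_real (f x))
       \<le> (\<Sum>n. ennreal ((norm (point_value \<alpha> S (\<lambda>x. complex_of_real (g x)) (t n)))\<^sup>2))" by blast
    also have "L2_sqnorm (\<lambda>x. complex_of_real (f x)) = ennreal (inner_on S' u u)"
    proof -
      have fe: "f = (\<lambda>y. inner_on S' u (kern \<alpha> y))"
        unfolding f_def g_def[abs_def] using hankel_cut[OF \<alpha>] by auto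
      have "L2_sqnorm (\<lambda>x. complex_of_real (f x)) = ennreal (\<integral>x. (f x)\<^sup>2 \<partial>lborel)"
        using inner_on_kern_isometry(1)[OF \<alpha> S'(1,3), of u] hankel_nonpos[of g, OF g0]
        by (intro L2_sqnorm_of_real) (auto simp: fe[symmetric] f_def)
      then show ?thesis using inner_on_kern_isometry(2)[OF \<alpha> S'(1,3), of u] by (simp add: fe)
    qed
    finally have main: "ennreal A * ennreal (inner_on S' u u)
       \<le> (\<Sum>n. ennreal ((norm (point_value \<alpha> S (\<lambda>x. complex_of_real (g x)) (t n)))\<^sup>2))" .
    have pv: "point_value \<alpha> S (\<lambda>x. complex_of_real (g x)) (t n) = complex_of_real (inner_on S' u (kern \<alpha> (t n)))" for n
    proof -
      have "point_value \<alpha> S (\<lambda>x. complex_of_real (g x)) (t n)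
         = (\<integral>x. indicator S x *\<^sub>R (complex_of_real (g x) * complex_of_real (hankel_kernel \<alpha> (t n) x)) \<partial>lebesgue)"
        unfolding point_value_def using S(1) by (subst integral_restrict_space) auto
      also have "\<dots> = (\<integral>x. complex_of_real (g x * sqrt_bessel \<alpha> (t n * x)) \<partial>lebesgue)"
      proof (intro Bochner_Integration.integral_cong refl)
        fix x
        show "indicator S x *\<^sub>R (complex_of_real (g x) * complex_of_real (hankel_kernel \<alpha> (t n) x))
           = complex_of_real (g x * sqrt_bessel \<alpha> (t n * x))"
        proof (cases "x \<in> S'")
          case True
          then have "x \<in> S" "t n * x > 0" using S' t[of n] by auto
          then show ?thesis by (simp add: hankel_kernel_eq_sqrt_bessel)
        qed (simp add: g_def)
      qed
      also have "\<dots> = (\<integral>x. complex_of_real (g x * sqrt_bessel \<alpha> (t n * x)) \<partial>lborel)"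
        using g(1) borel_measurable_continuous_onI[OF continuous_on_sqrt_bessel_mult[OF \<alpha>, of UNIV "t n"]]
        by (intro integral_completion) simp
      also have "\<dots> = complex_of_real (hankel \<alpha> g (t n))"
        by (simp only: integral_complex_of_real hankel_def)
      also have "hankel \<alpha> g (t n) = inner_on S' u (kern \<alpha> (t n))"
        unfolding g_def[abs_def] by (rule hankel_cut[OF \<alpha>])
      finally show ?thesis .
    qed
    show ?thesis
      using main A(1) psd_nonneg[OF psd_inner_on[OF S'(1,3)], of u] by (simp add: ennreal_mult pv)
  qed
  with A(1) show ?thesis by (rule that)
qed

section \<open>Counting sampling points\<close>

text \<open>Packing: the disjoint intervals of length \<open>d\<close> starting at the points fit
  into \<open>[p, q + d)\<close>. The bound for finite subsets then shows that the whole set is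
  finite.\<close>

lemma card_separated_le:
  fixes t :: "nat \<Rightarrow> real"
  assumes d: "d > 0" and sep: "\<And>m n. m \<noteq> n \<Longrightarrow> d \<le> \<bar>t m - t n\<bar>" and pq: "p \<le> q"
  shows "finite {n. t n \<in> {p..q}}" and "real (card {n. t n \<in> {p..q}}) \<le> (q - p) / d + 1"
proof -
  have F: "real (card F) \<le> (q - p) / d + 1" if F: "finite F" "F \<subseteq> {n. t n \<in> {p..q}}" for F
  proof -
    have i: "integrable lborel (indicator {p..<q + d} :: real \<Rightarrow> real)"
      using d pq by (intro integrable_real_indicator) auto
    have "(\<Sum>n\<in>F. d) = (\<Sum>n\<in>F. \<integral>s. indicator {t n..<t n + d} s * indicator {p..<q + d} s \<partial>lborel)"
    proof (rule sum.cong[OF refl])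
      fix n assume "n \<in> F"
      then have "t n \<in> {p..q}" using F by auto
      then have "(\<lambda>s. indicator {t n..<t n + d} s * indicator {p..<q + d} s :: real) = indicator {t n..<t n + d}"
        by (auto simp: indicator_def)
      then show "d = (\<integral>s. indicator {t n..<t n + d} s * indicator {p..<q + d} s \<partial>lborel)"
        using d by simp
    qed
    also have "\<dots> \<le> (\<integral>s. indicator {p..<q + d} s \<partial>lborel)"
      by (rule separated_sum_integral_le[OF F(1) _ i]) (auto intro: sep)
    also have "\<dots> = q + d - p" using d pq by simp
    finally have "real (card F) * d \<le> q + d - p" by simp
    then show ?thesis using d by (simp add: field_simps)
  qed
  show fin: "finite {n. t n \<in> {p..q}}"
  proof (rule ccontr)
    assume inf: "infinite {n. t n \<in> {p..q}}"
    obtain k :: nat where k: "real k > (q - p) / d + 1" using reals_Archimedean2 by blast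
    obtain G where "finite G" "card G = k" "G \<subseteq> {n. t n \<in> {p..q}}"
      using infinite_arbitrarily_large[OF inf] by blast
    with F[of G] k show False by simp
  qed
  show "real (card {n. t n \<in> {p..q}}) \<le> (q - p) / d + 1" by (rule F[OF fin order.refl])
qed

lemma psd_triangle_sq:
  assumes "psd_form b"
  shows "b (u - w) (u - w) \<le> 2 * b (u - v) (u - v) + 2 * b (v - w) (v - w)"
proof -
  note ps = psd_simps[OF assms]
  define p q where "p = u - v" and "q = v - w"
  have "u - w = p + q" by (simp add: p_def q_def)
  moreover have "b (p + q) (p + q) + b (p - q) (p - q) = 2 * b p p + 2 * b q q"
    by (simp add: ps)
  ultimately show ?thesis using psd_nonneg[OF assms, of "p - q"] by (simp add: p_def q_def)
qed

text \<open>After exchanging the integrals, the inner one runs over \<open>y\<close> and has a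
  closed form: a difference of primitives divided by \<open>x\<close>, which is at least
  \<open>L * r - 2 * C / x\<close>. The bound \<open>\<epsilon> \<le> x\<close> makes the error
  uniform.\<close>

lemma trace_lower_bound:
  assumes \<alpha>: "\<alpha> > -1/2" and LC: "\<And>z. z \<ge> 0 \<Longrightarrow> \<bar>sqrt_bessel_sq_primitive \<alpha> z - L * z\<bar> \<le> C"
    and S: "S \<in> sets borel" "S \<subseteq> {0<..R}" "\<And>x. x \<in> S \<Longrightarrow> \<epsilon> \<le> x" "\<epsilon> > 0" and a: "a \<ge> 0" "r > 0"
  shows "integrable lborel (\<lambda>y. indicator {a<..a + r} y * inner_on S (kern \<alpha> y) (kern \<alpha> y))"
    and "(L * r - 2 * C / \<epsilon>) * measure lborel S \<le> (\<integral>y. indicator {a<..a + r} y * inner_on S (kern \<alpha> y) (kern \<alpha> y) \<partial>lborel)"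
proof -
  obtain D where D: "D > 0" "\<And>z. \<bar>sqrt_bessel \<alpha> z\<bar> \<le> D" using sqrt_bessel_bound[OF \<alpha>] by blast
  define I where "I = {a<..a + r}"
  note [measurable] = sqrt_bessel_borel_measurable[OF \<alpha>] S(1)
  have I: "I \<in> sets borel" "I \<subseteq> {0<..a + r}" using a by (auto simp: I_def)
  note [measurable] = I(1)
  have Sfin: "emeasure lborel S < \<infinity>" by (rule emeasure_subset_Ioc_finite[OF S(2)])
  have Ifin: "emeasure lborel I < \<infinity>" by (rule emeasure_subset_Ioc_finite[OF I(2)])
  have Si: "integrable lborel (indicator S :: real \<Rightarrow> real)" using Sfin S(1) by (simp add: integrable_real_indicator)
  have Ii: "integrable lborel (indicator I :: real \<Rightarrow> real)" using Ifin I(1) by (simp add: integrable_real_indicator)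
  define q where "q x y = indicator S x * (indicator I y * (sqrt_bessel \<alpha> (y * x))\<^sup>2)" for x y :: real
  have qi: "integrable (lborel \<Otimes>\<^sub>M lborel) (case_prod q)"
  proof (rule Bochner_Integration.integrable_bound)
    show "integrable (lborel \<Otimes>\<^sub>M lborel) (\<lambda>(x, y). (indicator S x * D\<^sup>2) * indicator I y :: real)"
      using Si Ii by (intro lborel_pair.Fubini_integrable) (auto simp: abs_mult)
    show "case_prod q \<in> borel_measurable (lborel \<Otimes>\<^sub>M lborel)" unfolding q_def by measurable
    have "\<bar>q x y\<bar> \<le> (indicator S x * D\<^sup>2) * indicator I y" for x y
      using abs_le_square_iff[of "sqrt_bessel \<alpha> (y * x)" D] D by (auto simp: q_def indicator_def)
    then show "AE z in lborel \<Otimes>\<^sub>M lborel. norm (case_prod q z)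
       \<le> norm (case z of (x, y) \<Rightarrow> (indicator S x * D\<^sup>2) * indicator I y)"
      by (auto intro!: AE_I2 intro: order.trans[OF _ abs_ge_self])
  qed
  have qx: "(\<integral>x. q x y \<partial>lborel) = indicator I y * inner_on S (kern \<alpha> y) (kern \<alpha> y)" for y
  proof -
    have "q x y = indicator I y * (indicator S x * (apply_bcontfun (kern \<alpha> y) x * apply_bcontfun (kern \<alpha> y) x))" for x
      by (simp add: q_def apply_kern[OF \<alpha>] power2_eq_square)
    then show ?thesis by (simp only: inner_on_def integral_mult_right_zero)
  qed
  have qy: "(\<integral>y. q x y \<partial>lborel) = indicator S x * inner_on I (kern \<alpha> x) (kern \<alpha> x)" for x
  proof -
    have "q x y = indicator S x * (indicator I y * (apply_bcontfun (kern \<alpha> x) y * apply_bcontfun (kern \<alpha> x) y))" for y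
      by (simp add: q_def apply_kern[OF \<alpha>] power2_eq_square mult.commute[of x y])
    then show ?thesis by (simp only: inner_on_def integral_mult_right_zero)
  qed
  show "integrable lborel (\<lambda>y. indicator {a<..a + r} y * inner_on S (kern \<alpha> y) (kern \<alpha> y))"
    using lborel_pair.integrable_snd[OF qi] unfolding qx I_def .
  have "(L * r - 2 * C / \<epsilon>) * measure lborel S = (\<integral>x. indicator S x * (L * r - 2 * C / \<epsilon>) \<partial>lborel)"
    using Sfin S(1) by simp
  also have "\<dots> \<le> (\<integral>x. indicator S x * inner_on I (kern \<alpha> x) (kern \<alpha> x) \<partial>lborel)"
  proof (rule integral_mono)
    show "integrable lborel (\<lambda>x. indicator S x * (L * r - 2 * C / \<epsilon>))"
      by (intro integrable_mult_left Si)
    show "integrable lborel (\<lambda>x. indicator S x * inner_on I (kern \<alpha> x) (kern \<alpha> x))"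
      using lborel_pair.integrable_fst[OF qi] unfolding qy .
    fix x
    show "indicator S x * (L * r - 2 * C / \<epsilon>) \<le> indicator S x * inner_on I (kern \<alpha> x) (kern \<alpha> x)"
    proof (cases "x \<in> S")
      case True
      then have x: "x \<ge> \<epsilon>" "x > 0" using S by auto
      have C0: "C \<ge> 0" using LC[of 0] by (simp add: sqrt_bessel_sq_primitive_0)
      have "sqrt_bessel_sq_primitive \<alpha> (x * (a + r)) - sqrt_bessel_sq_primitive \<alpha> (x * a) \<ge> L * r * x - 2 * C"
        using LC[of "x * (a + r)"] LC[of "x * a"] x a by (simp add: abs_le_iff algebra_simps)
      then have "(L * r * x - 2 * C) / x \<le> (sqrt_bessel_sq_primitive \<alpha> (x * (a + r)) - sqrt_bessel_sq_primitive \<alpha> (x * a)) / x"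
        using x by (intro divide_right_mono) auto
      moreover have "(L * r * x - 2 * C) / x = L * r - 2 * C / x" using x by (simp add: field_simps)
      moreover have "2 * C / x \<le> 2 * C / \<epsilon>" using x C0 S(4) by (intro divide_left_mono) auto
      ultimately have "L * r - 2 * C / \<epsilon> \<le> inner_on I (kern \<alpha> x) (kern \<alpha> x)"
        unfolding I_def using inner_on_kern_diagonal[OF \<alpha>, of a "a + r" x] a x by simp
      then show ?thesis using True by simp
    qed simp
  qed
  also have "\<dots> = (\<integral>y. indicator I y * inner_on S (kern \<alpha> y) (kern \<alpha> y) \<partial>lborel)"
    using lborel_pair.Fubini_integral[OF qi] unfolding qx qy by simp
  finally show "(L * r - 2 * C / \<epsilon>) * measure lborel S \<le> (\<integral>y. indicator {a<..a + r} y * inner_on S (kern \<alpha> y) (kern \<alpha> y) \<partial>lborel)"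
    by (simp add: I_def)
qed

text \<open>One space has to serve all \<open>y\<close> of an interval, whereas
  \<open>low_rank_approximation\<close> treats finitely many vectors. Uniform continuity of the
  kernel on a compact interval bridges the gap.\<close>

lemma kern_finite_net:
  assumes \<alpha>: "\<alpha> > -1/2" and S: "S \<in> sets borel" "S \<subseteq> {0<..R}" and a: "a \<ge> 0" "\<kappa> > 0"
  shows "\<exists>K. finite K \<and> K \<subseteq> {a..b} \<and> (\<forall>y\<in>{a..b}. \<exists>y'\<in>K. inner_on S (kern \<alpha> y - kern \<alpha> y') (kern \<alpha> y - kern \<alpha> y') \<le> \<kappa>)"
proof -
  define R' where "R' = \<bar>R\<bar> + 1"
  have R': "R' > 0" "R \<le> R'" by (auto simp: R'_def)
  have Sfin: "emeasure lborel S < \<infinity>" by (rule emeasure_subset_Ioc_finite[OF S(2)])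
  \<comment> \<open>The added \<open>1\<close> avoids division by zero when \<open>S\<close> is a
    null set.\<close>
  define m where "m = measure lborel S + 1"
  have m: "m > 0" by (simp add: m_def add_nonneg_pos)
  define e where "e = sqrt (\<kappa> / m)"
  have e: "e > 0" "e\<^sup>2 = \<kappa> / m" using m a by (auto simp: e_def)
  have "uniformly_continuous_on {0..b * R'} (sqrt_bessel \<alpha>)"
    by (intro compact_uniformly_continuous continuous_on_sqrt_bessel \<alpha>) auto
  then obtain \<rho> where \<rho>: "\<rho> > 0" "\<And>z w. z \<in> {0..b * R'} \<Longrightarrow> w \<in> {0..b * R'} \<Longrightarrow> dist w z < \<rho> \<Longrightarrow> dist (sqrt_bessel \<alpha> w) (sqrt_bessel \<alpha> z) < e"
    using e(1) unfolding uniformly_continuous_on_def by meson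
  have "seq_compact {a..b}" using compact_Icc[of a b] by (simp add: compact_eq_seq_compact_metric)
  from seq_compact_imp_totally_bounded[OF this, rule_format, of "\<rho> / R'"]
  obtain K where K: "finite K" "K \<subseteq> {a..b}" "{a..b} \<subseteq> (\<Union>x\<in>K. ball x (\<rho> / R'))" using \<rho>(1) R' by auto
  show ?thesis
  proof (intro exI[of _ K] conjI ballI)
    fix y assume y: "y \<in> {a..b}"
    then obtain y' where y': "y' \<in> K" "dist y' y < \<rho> / R'" using K(3) by auto
    have y'b: "y' \<in> {a..b}" using y' K(2) by auto
    have le: "(sqrt_bessel \<alpha> (y * x) - sqrt_bessel \<alpha> (y' * x))\<^sup>2 \<le> e\<^sup>2" if "x \<in> S" for x
    proof -
      have x: "0 < x" "x \<le> R'" using that S(2) R' by auto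
      have "y * x \<in> {0..b * R'}" "y' * x \<in> {0..b * R'}"
        using y y'b x a(1) by (auto intro!: mult_mono)
      moreover have "dist (y * x) (y' * x) < \<rho>"
      proof -
        have "dist (y * x) (y' * x) = \<bar>y' - y\<bar> * x"
          using x by (simp add: dist_real_def abs_minus_commute flip: left_diff_distrib abs_mult_pos)
        also have "\<dots> \<le> \<bar>y' - y\<bar> * R'" using x by (intro mult_left_mono) auto
        also have "\<dots> < \<rho>" using y'(2) R' by (simp add: dist_real_def pos_less_divide_eq)
        finally show ?thesis .
      qed
      ultimately have "\<bar>sqrt_bessel \<alpha> (y * x) - sqrt_bessel \<alpha> (y' * x)\<bar> < e" using \<rho>(2) by (simp add: dist_real_def)
      then show ?thesis using e(1) abs_le_square_iff[of "sqrt_bessel \<alpha> (y * x) - sqrt_bessel \<alpha> (y' * x)" e] by simp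
    qed
    have "inner_on S (kern \<alpha> y - kern \<alpha> y') (kern \<alpha> y - kern \<alpha> y') \<le> (\<integral>x. indicator S x * e\<^sup>2 \<partial>lborel)"
      unfolding inner_on_def
    proof (rule integral_mono[OF integrable_inner_on[OF S]])
      show "integrable lborel (\<lambda>x. indicator S x * e\<^sup>2)"
        by (rule integrable_indicator_bounded[OF S, of _ "e\<^sup>2"]) auto
      show "indicator S x * (apply_bcontfun (kern \<alpha> y - kern \<alpha> y') x * apply_bcontfun (kern \<alpha> y - kern \<alpha> y') x) \<le> indicator S x * e\<^sup>2" for x
        using le[of x] by (auto simp: indicator_def minus_bcontfun.rep_eq apply_kern[OF \<alpha>] power2_eq_square)
    qed
    also have "\<dots> = measure lborel S * (\<kappa> / m)" using S(1) Sfin by (simp add: e(2))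
    also have "\<dots> \<le> m * (\<kappa> / m)" using a m by (intro mult_right_mono) (auto simp: m_def)
    also have "\<dots> = \<kappa>" using m by simp
    finally show "\<exists>y'\<in>K. inner_on S (kern \<alpha> y - kern \<alpha> y') (kern \<alpha> y - kern \<alpha> y') \<le> \<kappa>" using y'(1) by blast
  qed (use K in auto)
qed

text \<open>The part of the sampling sum outside \<open>J\<close> as a bilinear form, to be used as
  the form \<open>c\<close> of \<open>low_rank_approximation\<close>.\<close>

definition tail_form :: "real \<Rightarrow> (nat \<Rightarrow> real) \<Rightarrow> real set \<Rightarrow> nat set \<Rightarrow> (real \<Rightarrow>\<^sub>C real) \<Rightarrow> (real \<Rightarrow>\<^sub>C real) \<Rightarrow> real" where
  "tail_form \<alpha> t S J u v = (\<Sum>n. if n \<in> J then 0 else inner_on S u (kern \<alpha> (t n)) * inner_on S v (kern \<alpha> (t n)))"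

lemma
  assumes S: "S \<in> sets borel" "S \<subseteq> {0<..R}" and B: "\<And>u J. finite J \<Longrightarrow> (\<Sum>n\<in>J. (inner_on S u (kern \<alpha> (t n)))\<^sup>2) \<le> B * inner_on S u u"
  shows summable_samples: "summable (\<lambda>n. (inner_on S u (kern \<alpha> (t n)))\<^sup>2)"
    and summable_tail: "summable (\<lambda>n. if n \<in> J then 0 else inner_on S u (kern \<alpha> (t n)) * inner_on S v (kern \<alpha> (t n)))"
    and psd_tail_form: "psd_form (tail_form \<alpha> t S J)"
proof -
  show s1: "summable (\<lambda>n. (inner_on S u (kern \<alpha> (t n)))\<^sup>2)" for u
    by (rule summableI_nonneg_bounded[of _ "B * inner_on S u u"]) (auto intro: B)
  show s2: "summable (\<lambda>n. if n \<in> J then 0 else inner_on S u (kern \<alpha> (t n)) * inner_on S v (kern \<alpha> (t n)))" for u v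
  proof (rule summable_comparison_test'[OF summable_add[OF s1[of u] s1[of v]], of 0])
    fix n
    have "\<bar>p * q\<bar> \<le> p\<^sup>2 + q\<^sup>2" for p q :: real
      using sum_squares_bound[of "\<bar>p\<bar>" "\<bar>q\<bar>"] zero_le_power2[of p] zero_le_power2[of q]
      by (simp only: abs_mult power2_abs)
    then show "norm (if n \<in> J then 0 else inner_on S u (kern \<alpha> (t n)) * inner_on S v (kern \<alpha> (t n)))
       \<le> (inner_on S u (kern \<alpha> (t n)))\<^sup>2 + (inner_on S v (kern \<alpha> (t n)))\<^sup>2" by simp
  qed
  note ps = psd_simps[OF psd_inner_on[OF S]]
  show "psd_form (tail_form \<alpha> t S J)"
    unfolding psd_form_def
  proof (intro conjI allI)
    show "linear (\<lambda>u. tail_form \<alpha> t S J u v)" for v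
    proof (rule linearI)
      show "tail_form \<alpha> t S J (u + w) v = tail_form \<alpha> t S J u v + tail_form \<alpha> t S J w v" for u w
        unfolding tail_form_def suminf_add[OF s2 s2]
        by (intro arg_cong[where f=suminf] ext) (simp add: ps distrib_right)
      show "tail_form \<alpha> t S J (r *\<^sub>R u) v = r *\<^sub>R tail_form \<alpha> t S J u v" for r u
        unfolding tail_form_def real_scaleR_def suminf_mult[OF s2, symmetric]
        by (intro arg_cong[where f=suminf] ext) (simp add: ps)
    qed
    show "tail_form \<alpha> t S J u v = tail_form \<alpha> t S J v u" for u v
      unfolding tail_form_def by (intro arg_cong[where f=suminf] ext) (simp add: mult.commute)
    show "tail_form \<alpha> t S J u u \<ge> 0" for u
      unfolding tail_form_def by (intro suminf_nonneg s2) auto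
  qed
qed

lemma tail_form_le:
  assumes "summable (\<lambda>n. if n \<in> J then 0 else inner_on S u (kern \<alpha> (t n)) * inner_on S u (kern \<alpha> (t n)))"
    and "\<And>F. finite F \<Longrightarrow> F \<inter> J = {} \<Longrightarrow> (\<Sum>n\<in>F. (inner_on S u (kern \<alpha> (t n)))\<^sup>2) \<le> \<eta>"
  shows "tail_form \<alpha> t S J u u \<le> \<eta>"
  unfolding tail_form_def
proof (rule suminf_le_const[OF assms(1)])
  fix k :: nat
  have "(\<Sum>n<k. if n \<in> J then 0 else inner_on S u (kern \<alpha> (t n)) * inner_on S u (kern \<alpha> (t n)))
      = (\<Sum>n\<in>{..<k} - J. (inner_on S u (kern \<alpha> (t n)))\<^sup>2)"
    by (rule sum.mono_neutral_cong_right) (auto simp: power2_eq_square)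
  also have "\<dots> \<le> \<eta>" by (intro assms(2)) auto
  finally show "(\<Sum>n<k. if n \<in> J then 0 else inner_on S u (kern \<alpha> (t n)) * inner_on S u (kern \<alpha> (t n))) \<le> \<eta>" .
qed

text \<open>The width \<open>\<delta>\<close> is fixed before the interval, so the constant
  \<open>c\<close> depends on neither \<open>a\<close> nor \<open>r\<close>. That uniformity is what
  the infimum over \<open>a\<close> in the lower density requires.\<close>

lemma sampling_count_lower_bound:
  fixes t :: "nat \<Rightarrow> real"
  assumes \<alpha>: "\<alpha> > -1/2" and LC: "\<And>z. z \<ge> 0 \<Longrightarrow> \<bar>sqrt_bessel_sq_primitive \<alpha> z - L * z\<bar> \<le> C"
    and S: "S \<in> sets borel" "S \<subseteq> {0<..R}" "\<And>x. x \<in> S \<Longrightarrow> \<epsilon> \<le> x" "\<epsilon> > 0"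
    and \<tau>: "\<tau> > 0" "\<And>n. t n \<ge> \<tau>" and d: "d > 0" "\<And>m n. m \<noteq> n \<Longrightarrow> d \<le> \<bar>t m - t n\<bar>"
    and A: "A > 0" "\<And>u. ennreal (A * inner_on S u u) \<le> (\<Sum>n. ennreal ((inner_on S u (kern \<alpha> (t n)))\<^sup>2))"
    and \<eta>: "\<eta> > 0"
  shows "\<exists>c. \<forall>a\<ge>0. \<forall>r>0. r * (L * measure lborel S - \<eta>) - c \<le> real (card {n. t n \<in> {a..a + r}})"
proof -
  note psd = psd_inner_on[OF S(1,2)]
  have "\<exists>B>0. \<forall>S u J. S \<in> sets borel \<longrightarrow> S \<subseteq> {0<..R} \<longrightarrow> finite J \<longrightarrow>
      (\<Sum>n\<in>J. (inner_on S u (kern \<alpha> (t n)))\<^sup>2) \<le> B * inner_on S u u"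
    by (rule plancherel_polya[OF \<alpha> \<tau> d])
  then obtain B where "\<forall>S u J. S \<in> sets borel \<longrightarrow> S \<subseteq> {0<..R} \<longrightarrow> finite J \<longrightarrow>
      (\<Sum>n\<in>J. (inner_on S u (kern \<alpha> (t n)))\<^sup>2) \<le> B * inner_on S u u"
    by (elim exE conjE)
  note B = this[rule_format, OF S(1,2)]
  note summ = summable_samples[OF S(1,2) B] summable_tail[OF S(1,2) B] psd_tail_form[OF S(1,2) B]
  \<comment> \<open>The error budget: the low-rank approximation costs
    \<open>\<theta> / A = \<eta> / 4\<close> and the net \<open>\<kappa> = \<eta> / 4\<close>, and
    the squared triangle inequality doubles each, to \<open>\<eta>\<close> in total.\<close>
  define \<theta> where "\<theta> = \<eta> * A / 4"
  have \<theta>: "\<theta> > 0" using \<eta> A by (simp add: \<theta>_def)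
  have "S \<inter> {0<..R} = S" using S(2) by auto
  moreover have "small_tails \<alpha> t (S \<inter> {0<..R})" by (rule small_tails_borel[OF \<alpha> \<tau> d S(1)])
  ultimately have "\<exists>\<delta>. \<forall>y>0. \<forall>J. finite J \<longrightarrow> (\<forall>n\<in>J. \<bar>t n - y\<bar> > \<delta>) \<longrightarrow>
     (\<Sum>n\<in>J. (inner_on S (kern \<alpha> y) (kern \<alpha> (t n)))\<^sup>2) \<le> \<theta>"
    using \<theta> by (simp add: small_tails_def)
  then obtain \<delta>' where \<delta>': "\<forall>y>0. \<forall>J. finite J \<longrightarrow> (\<forall>n\<in>J. \<bar>t n - y\<bar> > \<delta>') \<longrightarrow>
     (\<Sum>n\<in>J. (inner_on S (kern \<alpha> y) (kern \<alpha> (t n)))\<^sup>2) \<le> \<theta>" by (elim exE)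
  define \<delta> where "\<delta> = max \<delta>' 0"
  have \<delta>: "\<delta> \<ge> 0" "\<delta> \<ge> \<delta>'" by (auto simp: \<delta>_def)
  \<comment> \<open>The first term is the boundary error of the trace. The second counts the points
    within \<open>\<delta>\<close> on either side of the interval, at most
    \<open>\<delta> / d + 1\<close> per side by separation.\<close>
  define c where "c = 2 * C / \<epsilon> * measure lborel S + 2 * (\<delta> / d + 1)"
  have "r * (L * measure lborel S - \<eta>) - c \<le> real (card {n. t n \<in> {a..a + r}})" if a: "a \<ge> 0" and r: "r > 0" for a r
  proof -
    define J where "J = {n. t n \<in> {a - \<delta>..a + r + \<delta>}}"
    have finJ: "finite J" unfolding J_def using r \<delta> by (intro card_separated_le[OF d]) auto
    have cardJ: "real (card J) \<le> real (card {n. t n \<in> {a..a + r}}) + 2 * (\<delta> / d + 1)"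
    proof -
      define J1 J2 J3 where "J1 = {n. t n \<in> {a - \<delta>..a}}" and "J2 = {n. t n \<in> {a..a + r}}" and "J3 = {n. t n \<in> {a + r..a + r + \<delta>}}"
      have fin: "finite J1" "finite J2" "finite J3"
        unfolding J1_def J2_def J3_def using r \<delta> by (intro card_separated_le[OF d]; simp)+
      have "J \<subseteq> J2 \<union> (J1 \<union> J3)" by (auto simp: J_def J1_def J2_def J3_def)
      then have "card J \<le> card (J2 \<union> (J1 \<union> J3))" using fin by (intro card_mono) auto
      also have "\<dots> \<le> card J2 + (card J1 + card J3)"
        by (intro order.trans[OF card_Un_le] add_left_mono card_Un_le)
      finally have "real (card J) \<le> real (card J2) + (real (card J1) + real (card J3))" by linarith
      moreover have "real (card J1) \<le> (a - (a - \<delta>)) / d + 1"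
        unfolding J1_def using \<delta> by (intro card_separated_le(2)[OF d]) auto
      moreover have "real (card J3) \<le> (a + r + \<delta> - (a + r)) / d + 1"
        unfolding J3_def using \<delta> by (intro card_separated_le(2)[OF d]) auto
      ultimately show ?thesis by (simp add: J2_def)
    qed
    have sampl: "A * inner_on S u u \<le> (\<Sum>j\<in>J. (inner_on S u (kern \<alpha> (t j)))\<^sup>2) + tail_form \<alpha> t S J u u" for u
    proof -
      have "(\<Sum>n. ennreal ((inner_on S u (kern \<alpha> (t n)))\<^sup>2)) = ennreal (\<Sum>n. (inner_on S u (kern \<alpha> (t n)))\<^sup>2)"
        by (rule suminf_ennreal2) (auto intro: summ(1))
      with A(2)[of u] have "A * inner_on S u u \<le> (\<Sum>n. (inner_on S u (kern \<alpha> (t n)))\<^sup>2)"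
        by (simp add: ennreal_le_iff suminf_nonneg summ(1))
      also have "\<dots> = (\<Sum>n. (if n \<in> J then (inner_on S u (kern \<alpha> (t n)))\<^sup>2 else 0)
         + (if n \<in> J then 0 else inner_on S u (kern \<alpha> (t n)) * inner_on S u (kern \<alpha> (t n))))"
        by (intro arg_cong[where f=suminf] ext) (simp add: power2_eq_square)
      also have "\<dots> = (\<Sum>n. if n \<in> J then (inner_on S u (kern \<alpha> (t n)))\<^sup>2 else 0) + tail_form \<alpha> t S J u u"
        unfolding tail_form_def
        by (intro suminf_add[symmetric] summ(2) summable_If_finite_set finJ)
      also have "(\<Sum>n. if n \<in> J then (inner_on S u (kern \<alpha> (t n)))\<^sup>2 else 0) = (\<Sum>j\<in>J. (inner_on S u (kern \<alpha> (t j)))\<^sup>2)"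
        by (rule sums_unique[OF sums_If_finite_set[OF finJ], symmetric])
      finally show ?thesis .
    qed
    define \<kappa> where "\<kappa> = \<eta> / 4"
    have "\<kappa> > 0" using \<eta> by (simp add: \<kappa>_def)
    obtain K where K: "finite K" "K \<subseteq> {a..a + r}"
      "\<And>y. y \<in> {a..a + r} \<Longrightarrow> \<exists>y'\<in>K. inner_on S (kern \<alpha> y - kern \<alpha> y') (kern \<alpha> y - kern \<alpha> y') \<le> \<kappa>"
      using kern_finite_net[OF \<alpha> S(1,2) a \<open>\<kappa> > 0\<close>, of "a + r"] by blast
    have lin: "linear (\<lambda>u. inner_on S u v)" for v by (rule psd_linear[OF psd])
    obtain W where W: "orthonormal_wrt (inner_on S) W" "card W \<le> card J"
      "\<And>v. v \<in> kern \<alpha> ` K \<Longrightarrow> inner_on S (v - proj_wrt (inner_on S) W v) (v - proj_wrt (inner_on S) W v) \<le> tail_form \<alpha> t S J v v / A"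
      using low_rank_approximation[OF psd summ(3) lin finJ finite_imageI[OF K(1)] A(1) sampl] by blast
    have tailK: "tail_form \<alpha> t S J (kern \<alpha> y) (kern \<alpha> y) \<le> \<theta>" if y: "y \<in> K" for y
    proof (rule tail_form_le[OF summ(2)])
      fix F :: "nat set" assume F: "finite F" "F \<inter> J = {}"
      show "(\<Sum>n\<in>F. (inner_on S (kern \<alpha> y) (kern \<alpha> (t n)))\<^sup>2) \<le> \<theta>"
      proof (cases "y > 0")
        case True
        have "\<bar>t n - y\<bar> > \<delta>'" if "n \<in> F" for n
        proof -
          have "n \<notin> J" using that F by auto
          then have "t n < a - \<delta> \<or> t n > a + r + \<delta>" by (auto simp: J_def)
          moreover have "a \<le> y" "y \<le> a + r" using y K(2) by auto
          ultimately show ?thesis using \<delta>(2) by linarith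
        qed
        then show ?thesis using \<delta>' True F(1) by blast
      next
        \<comment> \<open>For \<open>a = 0\<close> the net may contain \<open>y = 0\<close>, where
          the kernel vanishes on \<open>S\<close>; \<open>small_tails\<close> speaks of positive
          \<open>y\<close> only.\<close>
        case False
        then have "inner_on S (kern \<alpha> y) v = 0" for v
          using inner_on_kern_nonpos[OF \<alpha> S(2), of y v] psd_sym[OF psd] by simp
        then show ?thesis using \<theta> by simp
      qed
    qed
    \<comment> \<open>The squared distance of the kernel to the span of \<open>W\<close> is the
      difference of the two trace densities. It is at most the distance to the projection of a
      nearby kernel from the net.\<close>
    have res: "inner_on S (kern \<alpha> y) (kern \<alpha> y) \<le> (\<Sum>w\<in>W. (inner_on S w (kern \<alpha> y))\<^sup>2) + \<eta>" if y: "y \<in> {a..a + r}" for y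
    proof -
      obtain y' where y': "y' \<in> K" "inner_on S (kern \<alpha> y - kern \<alpha> y') (kern \<alpha> y - kern \<alpha> y') \<le> \<kappa>"
        using K(3)[OF y] by blast
      define p where "p = proj_wrt (inner_on S) W (kern \<alpha> y')"
      have 1: "inner_on S (kern \<alpha> y - proj_wrt (inner_on S) W (kern \<alpha> y)) (kern \<alpha> y - proj_wrt (inner_on S) W (kern \<alpha> y))
         = inner_on S (kern \<alpha> y) (kern \<alpha> y) - (\<Sum>w\<in>W. (inner_on S (kern \<alpha> y) w)\<^sup>2)"
        by (rule residual_sq[OF psd W(1)])
      have 2: "inner_on S (kern \<alpha> y - proj_wrt (inner_on S) W (kern \<alpha> y)) (kern \<alpha> y - proj_wrt (inner_on S) W (kern \<alpha> y))
         \<le> inner_on S (kern \<alpha> y - p) (kern \<alpha> y - p)"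
        by (rule residual_minimal[OF psd W(1), where u'=p]) (simp_all add: psd_simps[OF psd] p_def proj_wrt_in_span[OF psd])
      have 3: "inner_on S (kern \<alpha> y - p) (kern \<alpha> y - p)
         \<le> 2 * inner_on S (kern \<alpha> y - kern \<alpha> y') (kern \<alpha> y - kern \<alpha> y') + 2 * inner_on S (kern \<alpha> y' - p) (kern \<alpha> y' - p)"
        by (rule psd_triangle_sq[OF psd])
      have "inner_on S (kern \<alpha> y' - p) (kern \<alpha> y' - p) \<le> tail_form \<alpha> t S J (kern \<alpha> y') (kern \<alpha> y') / A"
        unfolding p_def using y'(1) by (intro W(3)) auto
      also have "\<dots> \<le> \<theta> / A" using tailK[OF y'(1)] A(1) by (intro divide_right_mono) auto
      also have "\<theta> / A = \<eta> / 4" using A(1) by (simp add: \<theta>_def)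
      finally have 4: "inner_on S (kern \<alpha> y' - p) (kern \<alpha> y' - p) \<le> \<eta> / 4" .
      have "(\<Sum>w\<in>W. (inner_on S (kern \<alpha> y) w)\<^sup>2) = (\<Sum>w\<in>W. (inner_on S w (kern \<alpha> y))\<^sup>2)"
        by (intro sum.cong refl arg_cong[where f="\<lambda>x. x\<^sup>2"] psd_sym[OF psd])
      then show ?thesis using 1 2 3 4 y'(2) unfolding \<kappa>_def by linarith
    qed
    have finW: "finite W" using W(1) by (simp add: orthonormal_wrt_def)
    have wi: "integrable lborel (\<lambda>y. (inner_on S w (kern \<alpha> y))\<^sup>2)" for w
      using inner_on_kern_isometry(1)[OF \<alpha> S(1,2), of w] by (simp add: sq_int_def)
    have ind: "integrable lborel (\<lambda>y. indicator {a<..a + r} y * \<eta>)"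
      using r by (intro integrable_mult_left integrable_real_indicator) auto
    have "(L * r - 2 * C / \<epsilon>) * measure lborel S
       \<le> (\<integral>y. indicator {a<..a + r} y * inner_on S (kern \<alpha> y) (kern \<alpha> y) \<partial>lborel)"
      by (rule trace_lower_bound(2)[OF \<alpha> LC S a r])
    also have "\<dots> \<le> (\<integral>y. (\<Sum>w\<in>W. (inner_on S w (kern \<alpha> y))\<^sup>2) + indicator {a<..a + r} y * \<eta> \<partial>lborel)"
    proof (rule integral_mono)
      show "integrable lborel (\<lambda>y. indicator {a<..a + r} y * inner_on S (kern \<alpha> y) (kern \<alpha> y))"
        by (rule trace_lower_bound(1)[OF \<alpha> LC S a r])
      show "integrable lborel (\<lambda>y. (\<Sum>w\<in>W. (inner_on S w (kern \<alpha> y))\<^sup>2) + indicator {a<..a + r} y * \<eta>)"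
        by (intro Bochner_Integration.integrable_add Bochner_Integration.integrable_sum wi ind)
      have "(\<Sum>w\<in>W. (inner_on S w (kern \<alpha> y))\<^sup>2) \<ge> 0" for y by (intro sum_nonneg) auto
      then show "indicator {a<..a + r} y * inner_on S (kern \<alpha> y) (kern \<alpha> y)
         \<le> (\<Sum>w\<in>W. (inner_on S w (kern \<alpha> y))\<^sup>2) + indicator {a<..a + r} y * \<eta>" for y
        using res[of y] by (cases "y \<in> {a<..a + r}") auto
    qed
    also have "\<dots> = (\<Sum>w\<in>W. \<integral>y. (inner_on S w (kern \<alpha> y))\<^sup>2 \<partial>lborel) + (\<integral>y. indicator {a<..a + r} y * \<eta> \<partial>lborel)"
      using wi ind by (subst Bochner_Integration.integral_add) (auto simp: Bochner_Integration.integral_sum)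
    also have "(\<Sum>w\<in>W. \<integral>y. (inner_on S w (kern \<alpha> y))\<^sup>2 \<partial>lborel) = real (card W)"
      using W(1) inner_on_kern_isometry(2)[OF \<alpha> S(1,2)] by (simp add: orthonormal_wrt_def)
    also have "(\<integral>y. indicator {a<..a + r} y * \<eta> \<partial>lborel) = r * \<eta>" using r by simp
    finally show ?thesis using W(2) cardJ by (simp add: c_def algebra_simps)
  qed
  then show ?thesis by blast
qed

text \<open>Half of \<open>e\<close> is spent on \<open>\<eta>\<close>, the other half absorbs the
  constant: \<open>c \<le> r * e / 2\<close> once \<open>r \<ge> 2 * c / e\<close>, for all
  \<open>a\<close> at once. Injectivity turns the count of indices into a count of points.\<close>

lemma lower_density_ge:
  assumes t: "inj t" and m: "m \<ge> 0"
    and count: "\<And>\<eta>. \<eta> > 0 \<Longrightarrow> \<exists>c. \<forall>a\<ge>0. \<forall>r>0. r * (m - \<eta>) - c \<le> real (card {n. t n \<in> {a..a + r}})"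
  shows "lower_density (range t) \<ge> ennreal m"
proof (rule ennreal_le_epsilon)
  fix e :: real assume e: "e > 0"
  obtain c where c: "\<And>a r. a \<ge> 0 \<Longrightarrow> r > 0 \<Longrightarrow> r * (m - e / 2) - c \<le> real (card {n. t n \<in> {a..a + r}})"
    using count[of "e / 2"] e by auto
  have "ennreal (m - e) \<le> lower_density (range t)"
    unfolding lower_density_def
  proof (rule Liminf_bounded)
    have "eventually (\<lambda>r. r > 0 \<and> r \<ge> 2 * c / e) at_top"
      by (intro eventually_conj eventually_gt_at_top eventually_ge_at_top)
    then show "\<forall>\<^sub>F r in at_top. ennreal (m - e) \<le> (INF a\<in>{0..}. ennreal (real (card (range t \<inter> {a..a + r})) / r))"
    proof eventually_elim
      case (elim r)
      show ?case
      proof (rule INF_greatest)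
        fix a :: real assume a: "a \<in> {0..}"
        have "range t \<inter> {a..a + r} = t ` {n. t n \<in> {a..a + r}}" by auto
        then have "card (range t \<inter> {a..a + r}) = card {n. t n \<in> {a..a + r}}"
          using t by (simp add: card_image inj_on_subset)
        moreover have "c \<le> r * (e / 2)" using elim e by (simp add: field_simps)
        ultimately have "(m - e) * r \<le> real (card (range t \<inter> {a..a + r}))"
          using c[of a r] a elim by (simp add: algebra_simps)
        then show "ennreal (m - e) \<le> ennreal (real (card (range t \<inter> {a..a + r})) / r)"
          using elim by (intro ennreal_leI) (simp add: pos_le_divide_eq)
      qed
    qed
  qed
  have "ennreal m \<le> ennreal (m - e) + ennreal e"
    using e m by (cases "m \<ge> e") (auto simp flip: ennreal_plus intro: ennreal_leI simp: ennreal_neg)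
  also have "\<dots> \<le> lower_density (range t) + ennreal e"
    by (intro add_right_mono) fact
  finally show "ennreal m \<le> lower_density (range t) + ennreal e" .
qed

theorem theorem1:
  fixes S :: "real set" and \<alpha> :: real and t :: "nat \<Rightarrow> real"
  assumes "S \<in> sets lebesgue" and "S \<subseteq> {0<..}"
    and "\<alpha> > -1/2"
    and "range t \<subseteq> {0<..}" and "inj t"
    and "uniform_discrete (range t)"
    and "set_of_sampling \<alpha> S t"
  shows "lower_density (range t) \<ge> ennreal (1 / pi) * emeasure lebesgue S"
proof -
  note \<alpha> = assms(3)
  have tpos: "t n > 0" for n using assms(4) by auto
  obtain d where d: "d > 0" "\<And>x y. x \<in> range t \<Longrightarrow> y \<in> range t \<Longrightarrow> dist x y < d \<Longrightarrow> x = y"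
    using assms(6) unfolding uniform_discrete_def by blast
  have sep: "d \<le> \<bar>t m - t n\<bar>" if "m \<noteq> n" for m n
  proof (rule ccontr)
    assume "\<not> d \<le> \<bar>t m - t n\<bar>"
    then have "t m = t n" by (intro d(2)) (auto simp: dist_real_def)
    with that \<open>inj t\<close> show False by (auto dest: injD)
  qed
  \<comment> \<open>Two points below \<open>d / 2\<close> would be closer than \<open>d\<close>. If
    one lies there, it is the smallest of all; otherwise \<open>d / 2\<close> is a lower
    bound.\<close>
  obtain \<tau> where \<tau>: "\<tau> > 0" "\<And>n. t n \<ge> \<tau>"
  proof (cases "\<exists>k. t k < d / 2")
    case True
    then obtain k where k: "t k < d / 2" by blast
    show ?thesis
    proof (rule that[of "t k"])
      fix n
      show "t n \<ge> t k"
      proof (cases "n = k")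
        case False
        then show ?thesis using sep[OF False] k tpos[of n] tpos[of k] by linarith
      qed simp
    qed (rule tpos)
  next
    case False
    then show ?thesis using d(1) by (intro that[of "d / 2"]) (auto simp: not_less)
  qed
  obtain L C where LC: "\<And>z. z \<ge> 0 \<Longrightarrow> \<bar>sqrt_bessel_sq_primitive \<alpha> z - L * z\<bar> \<le> C"
    using sqrt_bessel_sq_primitive_asymp[OF \<alpha>] by blast
  have L: "L \<ge> 1 / pi" by (rule sqrt_bessel_mean_square_ge[OF \<alpha> LC])
  \<comment> \<open>A Borel part of the Lebesgue set \<open>S\<close> that carries its full
    measure.\<close>
  define S0 where "S0 = main_part lborel S"
  have S0: "S0 \<in> sets borel" "S0 \<subseteq> S" "emeasure lebesgue S = emeasure lborel S0"
  proof -
    show "S0 \<in> sets borel" using main_part_sets[OF assms(1)] by (simp add: S0_def)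
    show "S0 \<subseteq> S" using main_part_null_part_Un[OF assms(1)] by (auto simp: S0_def)
    show "emeasure lebesgue S = emeasure lborel S0" using emeasure_completion[OF assms(1)] by (simp add: S0_def)
  qed
  \<comment> \<open>These pieces are bounded and bounded away from \<open>0\<close>, and they
    exhaust \<open>S0\<close>.\<close>
  define T where "T n = S0 \<inter> {1 / real (Suc n)..real (Suc n)}" for n
  have T: "T n \<in> sets borel" "T n \<subseteq> S" "T n \<subseteq> {0<..real (Suc n)}" "\<And>x. x \<in> T n \<Longrightarrow> 1 / real (Suc n) \<le> x" for n
    using S0 assms(2) by (auto simp: T_def)
  have "incseq T"
  proof (rule incseq_SucI)
    fix n
    have "1 / real (Suc (Suc n)) \<le> 1 / real (Suc n)" by (intro divide_left_mono) auto
    then show "T n \<subseteq> T (Suc n)" by (auto simp: T_def)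
  qed
  then have "(SUP n. emeasure lborel (T n)) = emeasure lborel (\<Union>n. T n)"
    using T(1) by (intro SUP_emeasure_incseq) auto
  also have "(\<Union>n. T n) = S0"
  proof (intro equalityI subsetI)
    fix x assume x: "x \<in> S0"
    then have xp: "x > 0" using S0(2) assms(2) by auto
    obtain n :: nat where n: "real n \<ge> max x (1 / x)" using real_arch_simple by blast
    have "1 / real (Suc n) \<le> x" using n xp by (simp add: field_simps)
    moreover have "x \<le> real (Suc n)" using n by simp
    ultimately show "x \<in> (\<Union>n. T n)" using x by (auto simp: T_def)
  qed (auto simp: T_def)
  finally have sup0: "(SUP n. emeasure lborel (T n)) = emeasure lborel S0" .
  \<comment> \<open>Each piece has finite measure, where real arithmetic applies; the supremum also
    covers the case of infinite measure.\<close>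
  have sup: "ennreal (1 / pi) * emeasure lebesgue S = (SUP n. ennreal (1 / pi) * emeasure lborel (T n))"
    by (simp only: S0(3) sup0[symmetric] SUP_mult_left_ennreal)
  have "ennreal (1 / pi) * emeasure lborel (T n) \<le> lower_density (range t)" for n
  proof -
    obtain A where A: "A > 0" "\<And>u. ennreal (A * inner_on (T n) u u) \<le> (\<Sum>k. ennreal ((inner_on (T n) u (kern \<alpha> (t k)))\<^sup>2))"
      using sampling_inequality[OF \<alpha> assms(1,2) T(1-3) tpos assms(7)] by blast
    have "ennreal (1 / pi) * emeasure lborel (T n) = ennreal (1 / pi * measure lborel (T n))"
      using emeasure_subset_Ioc_finite[OF T(3)[of n]] pi_gt_zero
      by (subst ennreal_mult) (simp_all add: emeasure_eq_ennreal_measure less_top)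
    also have "\<dots> \<le> ennreal (L * measure lborel (T n))"
      using L by (intro ennreal_leI mult_right_mono) auto
    also have "\<dots> \<le> lower_density (range t)"
    proof (rule lower_density_ge[OF assms(5)])
      show "L * measure lborel (T n) \<ge> 0"
        using L pi_gt_zero by (intro mult_nonneg_nonneg) (auto intro: order.trans[of _ "1 / pi"])
      show "\<exists>c. \<forall>a\<ge>0. \<forall>r>0. r * (L * measure lborel (T n) - \<eta>) - c \<le> real (card {k. t k \<in> {a..a + r}})"
        if "\<eta> > 0" for \<eta>
        by (rule sampling_count_lower_bound[OF \<alpha> LC T(1,3,4) _ \<tau> d(1) sep A that]) auto
    qed
    finally show ?thesis .
  qed
  then show ?thesis unfolding sup by (intro SUP_least)
qed

end
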